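(* Let $\theta\in(0,1]$, $f\in C_c(0,\infty)\cap\mathrm{Lip}^\theta_{\mathrm{loc},\mathrm{uni}}(0,\infty)$, $1<p\le\infty$, $\lambda>-\tfrac12$ and $m\in\mathbb N$. Then \[ \lim_{s\to0^+}\frac{(m+1)!}{s^{m+1}}\left(B_\lambda^sf-\left(f+\sum_{j=1}^m\frac{s^j}{j!}(\log^jB_\lambda)f\right)\right)=(\log^{m+1}B_\lambda)f,\quad\text{in }L^p(0,\infty), \] and \[ \lim_{s\to0^+}\frac{(m+1)!}{s^{m+1}}\left(B_\lambda^{-s}f-\left(f+\sum_{j=1}^m\frac{(-1)^js^j}{j!}(\log^jB_\lambda)f\right)\right)=(-1)^{m+1}(\log^{m+1}B_\lambda)f,\quad\text{in }L^p(0,\infty). \]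
   Context: $C_c(0,\infty)$ is the space of continuous functions with compact support in $(0,\infty)$. For $x,r\in(0,\infty)$, $B(x,r)=(0,\infty)\cap(x-r,x+r)$; $\mathcal X_E$ is the characteristic function of $E$. For $x\in(0,\infty)$ and $\theta\in(0,1]$, $f\in\mathrm{Lip}^\theta_{\mathrm{loc},x}(0,\infty)$ means $\|f\|_{\mathrm{Lip}^\theta_{\mathrm{loc},x}(0,\infty)}:=\sup_{y\in B(x,1)}\frac{|f(x)-f(y)|}{|x-y|^\theta}<\infty$, and $f\in\mathrm{Lip}^\theta_{\mathrm{loc},\mathrm{uni}}(0,\infty)$ means $\sup_{x\in(0,\infty)}\|f\|_{\mathrm{Lip}^\theta_{\mathrm{loc},x}(0,\infty)}<\infty$. For $x,y,t\in(0,\infty)$, $W_t^\lambda(x,y)=\frac{\sqrt{xy}}{2t}I_\lambda\left(\frac{xy}{2t}\right)e^{-\frac{x^2+y^2}{4t}}$, where $I_\lambda$ is the modified Bessel function of the first kind of order $\lambda$, and $W_t(z)=\frac{1}{2\sqrt{\pi t}}e^{-z^2/(4t)}$, $z\in\mathbb R$. The operators are associated with the Bessel operator $B_\lambda=-\frac{d^2}{dx^2}+\frac{\lambda^2-1/4}{x^2}$ and, for $f\in L^1((0,\infty),\frac{dy}{1+y})\cap\mathrm{Lip}^\theta_{\mathrm{loc},x}(0,\infty)$, are defined at the point $x$ by the following formulas. For $s\in(0,\frac\theta4)$, \[ \begin{aligned} B_\lambda^sf(x)&=-\frac{s}{\Gamma(1-s)}\Bigg[\int_0^\infty\big(f(y)-\mathcal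 X_{B(x,1)}(y)f(x)\big)\int_0^\infty\frac{W_t^\lambda(x,y)}{t^{1+s}}dt\,dy+f(x)\Bigg(-\int_{(0,\infty)\setminus B(x,1)}\int_0^1\frac{W_t^\lambda(x,y)}{t^{1+s}}dt\,dy\\ &\quad+\int_{B(x,1)}\int_1^\infty\frac{W_t^\lambda(x,y)}{t^{1+s}}dt\,dy+\int_0^\infty\int_0^1\frac{W_t^\lambda(x,y)-W_t(x-y)}{t^{1+s}}dt\,dy\Bigg)\Bigg]+\frac{f(x)}{\Gamma(1-s)}. \end{aligned} \] For $0<s<\min\{\frac\theta4,\frac\lambda2+\frac12\}$, \[ \begin{aligned} B_\lambda^{-s}f(x)&=\frac{s}{\Gamma(1+s)}\Bigg[\int_0^\infty\big(f(y)-\mathcal X_{B(x,1)}(y)f(x)\big)\int_0^\infty W_t^\lambda(x,y)t^{s-1}dt\,dy+f(x)\Bigg(-\int_{(0,\infty)\setminus B(x,1)}\int_0^1W_t^\lambda(x,y)t^{s-1}dt\,dy\\ &\quad+\int_{B(x,1)}\int_1^\infty W_t^\lambda(x,y)t^{s-1}dt\,dy+\int_0^\infty\int_0^1\big(W_t^\lambda(x,y)-W_t(x-y)\big)t^{s-1}dt\,dy\Bigg)\Bigg]+\frac{f(x)}{\Gamma(1+s)}. \end{aligned} \] For $m\in\mathbb N$, \[ \begin{aligned} (\log^mB_\lambda)f(x)&=-m\sum_{j=0}^{m-1}(-1)^j\binom{m-1}{j}\partial_s^{m-j-1}\left(\frac{1}{\Gamma(1-s)}\right)\Bigg|_{s=0}\Bigg[\int_0^\infty\big(f(y)-\mathcal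 X_{B(x,1)}(y)f(x)\big)\int_0^\infty W_t^\lambda(x,y)\frac{(\log t)^j}{t}dt\,dy\\ &\quad+f(x)\Bigg(-\int_{(0,\infty)\setminus B(x,1)}\int_0^1W_t^\lambda(x,y)\frac{(\log t)^j}{t}dt\,dy+\int_{B(x,1)}\int_1^\infty W_t^\lambda(x,y)\frac{(\log t)^j}{t}dt\,dy\\ &\quad+\int_0^\infty\int_0^1\big(W_t^\lambda(x,y)-W_t(x-y)\big)\frac{(\log t)^j}{t}dt\,dy\Bigg)\Bigg]+f(x)\,\partial_s^m\left(\frac{1}{\Gamma(1-s)}\right)\Bigg|_{s=0}. \end{aligned} \] *)

theory Defs
  imports "HOL-Analysis.Analysis" "HOL-Probability.Essential_Supremum"
begin

text \<open>
  Functions on the half-line are total functions \<^typ>\<open>real \<Rightarrow> complex\<close> whose values outside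
  \<^term>\<open>{0<..} :: real set\<close> are never used. Complex values subsume the real-valued case.
\<close>

definition Bpos :: "real \<Rightarrow> real \<Rightarrow> real set"
  where "Bpos x r = {0<..} \<inter> {x - r<..<x + r}"

text \<open>
  The closure below is taken in the whole real line, so its inclusion in the open half-line
  also keeps the support away from 0.
\<close>

definition Cc_pos :: "(real \<Rightarrow> complex) set"
  where "Cc_pos = {f. continuous_on {0<..} f \<and>
    compact (closure (support_on {0<..} f)) \<and> closure (support_on {0<..} f) \<subseteq> {0<..}}"

text \<open>The point \<open>y = x\<close> contributes \<open>0 / 0 = 0\<close> to the supremum.\<close>

definition Lip_loc_norm :: "real \<Rightarrow> real \<Rightarrow> (real \<Rightarrow> complex) \<Rightarrow> ennreal"
  where "Lip_loc_norm \<theta> x f =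
    (SUP y\<in>Bpos x 1. ennreal (norm (f x - f y) / \<bar>x - y\<bar> powr \<theta>))"

definition Lip_loc_uni :: "real \<Rightarrow> (real \<Rightarrow> complex) set"
  where "Lip_loc_uni \<theta> = {f. (SUP x\<in>{0<..}. Lip_loc_norm \<theta> x f) < \<infinity>}"

definition Lp_space :: "'a measure \<Rightarrow> ennreal \<Rightarrow> ('a \<Rightarrow> complex) set"
  where "Lp_space M p = {g \<in> borel_measurable M.
    if p = \<infinity> then esssup M (\<lambda>x. ereal (norm (g x))) < \<infinity>
    else integrable M (\<lambda>x. norm (g x) powr enn2real p)}"

text \<open>Meaningful for elements of \<^const>\<open>Lp_space\<close>.\<close>

definition Lp_norm :: "'a measure \<Rightarrow> ennreal \<Rightarrow> ('a \<Rightarrow> complex) \<Rightarrow> real"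
  where "Lp_norm M p g =
    (if p = \<infinity> then real_of_ereal (esssup M (\<lambda>x. ereal (norm (g x))))
     else (\<integral>x. norm (g x) powr enn2real p \<partial>M) powr (1 / enn2real p))"

text \<open>
  Convergence in the space \<open>L\<^sup>p\<close>: the limit belongs to the space, the family does so eventually,
  and the norm of the difference tends to 0.
\<close>

definition tendsto_Lp ::
    "'a measure \<Rightarrow> ennreal \<Rightarrow> ('s \<Rightarrow> 'a \<Rightarrow> complex) \<Rightarrow> ('a \<Rightarrow> complex) \<Rightarrow> 's filter \<Rightarrow> bool"
  where "tendsto_Lp M p G g F \<longleftrightarrow>
    g \<in> Lp_space M p \<and> (\<forall>\<^sub>F s in F. G s \<in> Lp_space M p) \<and>
    ((\<lambda>s. Lp_norm M p (\<lambda>x. G s x - g x)) \<longlongrightarrow> 0) F"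

abbreviation lborel_pos :: "real measure"
  where "lborel_pos \<equiv> restrict_space lborel {0<..}"

definition bessel_I :: "real \<Rightarrow> real \<Rightarrow> real"
  where "bessel_I l z = (\<Sum>k. (z / 2) powr (l + 2 * real k) / (fact k * Gamma (l + real k + 1)))"

definition W_bessel :: "real \<Rightarrow> real \<Rightarrow> real \<Rightarrow> real \<Rightarrow> real"
  where "W_bessel l t x y =
    sqrt (x * y) / (2 * t) * bessel_I l (x * y / (2 * t)) * exp (- (x\<^sup>2 + y\<^sup>2) / (4 * t))"

definition W_gauss :: "real \<Rightarrow> real \<Rightarrow> real"
  where "W_gauss t z = 1 / (2 * sqrt (pi * t)) * exp (- z\<^sup>2 / (4 * t))"

text \<open>
  The formulas for the positive powers, the negative powers and the logarithms share one
  bracketed expression; they differ only in the weight \<open>\<phi>\<close> in the time variable, which is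
  \<open>1 / t powr (1 + s)\<close>, \<open>t powr (s - 1)\<close> and \<open>(ln t) ^ j / t\<close>, respectively.
  All integrals are iterated Lebesgue integrals in the order \<open>dt dy\<close>. In the first one the inner
  integral diverges at the single point \<open>y = x\<close>, where the other factor vanishes.
\<close>

definition bessel_bracket ::
    "real \<Rightarrow> (real \<Rightarrow> real) \<Rightarrow> (real \<Rightarrow> complex) \<Rightarrow> real \<Rightarrow> complex"
  where "bessel_bracket l \<phi> f x =
    (LINT y:{0<..}|lborel.
       (LINT t:{0<..}|lborel. W_bessel l t x y * \<phi> t) *\<^sub>R
         (f y - indicator (Bpos x 1) y * f x)) +
    (- (LINT y:{0<..} - Bpos x 1|lborel. LINT t:{0<..<1}|lborel. W_bessel l t x y * \<phi> t)
     + (LINT y:Bpos x 1|lborel. LINT t:{1<..}|lborel. W_bessel l t x y * \<phi> t)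
     + (LINT y:{0<..}|lborel. LINT t:{0<..<1}|lborel.
          (W_bessel l t x y - W_gauss t (x - y)) * \<phi> t)) *\<^sub>R f x"

definition bessel_pow :: "real \<Rightarrow> real \<Rightarrow> (real \<Rightarrow> complex) \<Rightarrow> real \<Rightarrow> complex"
  where "bessel_pow l s f x =
    - (s / Gamma (1 - s)) *\<^sub>R bessel_bracket l (\<lambda>t. 1 / t powr (1 + s)) f x
    + (1 / Gamma (1 - s)) *\<^sub>R f x"

text \<open>The operator with exponent \<open>- s\<close>, for \<open>s > 0\<close>.\<close>

definition bessel_neg_pow :: "real \<Rightarrow> real \<Rightarrow> (real \<Rightarrow> complex) \<Rightarrow> real \<Rightarrow> complex"
  where "bessel_neg_pow l s f x =
    (s / Gamma (1 + s)) *\<^sub>R bessel_bracket l (\<lambda>t. t powr (s - 1)) f x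
    + (1 / Gamma (1 + s)) *\<^sub>R f x"

definition D_inv_Gamma :: "nat \<Rightarrow> real"
  where "D_inv_Gamma n = (deriv ^^ n) (\<lambda>s. 1 / Gamma (1 - s)) 0"

definition bessel_log :: "real \<Rightarrow> nat \<Rightarrow> (real \<Rightarrow> complex) \<Rightarrow> real \<Rightarrow> complex"
  where "bessel_log l m f x =
    - (real m *\<^sub>R (\<Sum>j<m. ((-1) ^ j * real (m - 1 choose j) * D_inv_Gamma (m - j - 1)) *\<^sub>R
        bessel_bracket l (\<lambda>t. ln t ^ j / t) f x))
    + D_inv_Gamma m *\<^sub>R f x"

end

theory Submission
  imports Defs "HOL-Probability.Sinc_Integral" "HOL-Complex_Analysis.Cauchy_Integral_Formula"
begin

text \<open>
  Apart from a multiple of \<open>f x\<close>, the powers and the logarithms are built from one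
  functional, the bracket, which is linear in the weight \<open>\<phi>\<close> on the time axis. For the power \<open>s\<close> the weight is
  \<open>1 / t powr (1 + s) = exp (- s ln t) / t\<close>, whose Taylor coefficients in \<open>s\<close> are, up to sign and
  factorials, the weights \<open>(ln t) ^ j / t\<close> of the logarithms. The Taylor remainder of order \<open>n\<close> is at
  most a constant times \<open>\<bar>s\<bar> ^ n\<close> times \<open>\<psi> t = (t powr e + t powr (- e)) / t\<close>, as long as \<open>\<bar>s\<bar> \<le> e / 2\<close>
  (\<open>power_weight_remainder\<close>). Hence everything follows from one estimate: a weight bounded by \<open>A \<psi>\<close>
  gives a bracket bounded by a constant times \<open>A (1 + x) powr (- \<beta>)\<close> with \<open>\<beta> = 1 - 4 e\<close>
  (\<open>norm_bessel_bracket_le\<close>). Multiplication by the Taylor expansion of \<open>1 / Gamma (1 - s)\<close> then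
  reproduces the logarithms (\<open>sum_bessel_log\<close>), and the error after the term of order \<open>m + 1\<close> is
  pointwise at most a constant times \<open>\<bar>s\<bar> ^ (m + 2) (1 + x) powr (- \<beta>)\<close> (\<open>bessel_pow_expansion\<close>). Since
  \<open>e\<close> may be taken as small as desired, \<open>\<beta> p > 1\<close> can be achieved for every \<open>p > 1\<close>, and the
  normalized remainder converges in the Lebesgue space at rate \<open>s\<close>. The expansion holds for both
  signs of \<open>s\<close>, and the negative powers are the positive ones with \<open>- s\<close> in place of \<open>s\<close>.

  The estimate of the bracket rests on comparing the Bessel heat kernel with the Gaussian one. Their
  quotient is a function of \<open>z = x y / (2 t)\<close> alone; it is bounded and differs from 1 by \<open>O(1 / z)\<close>
  (\<open>bessel_ratio_asymptotics\<close>), which follows from Poisson's integral for the Bessel function. The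
  Gaussian factor is then bounded by a product of a power of \<open>t\<close> and a power of \<open>\<bar>x - y\<bar>\<close>, with an
  exponent that depends on the region: near the diagonal the Hoelder condition on \<open>f\<close> makes the
  resulting singularity integrable, in the comparison term the \<open>O(1 / z)\<close> supplies a factor \<open>t\<close>, and
  for large \<open>x\<close> the long times leave a decay just below \<open>1 / x\<close>. As all bounds are products of a
  function of \<open>t\<close> and a function of \<open>(x, y)\<close>, the four integrals of the bracket combine into one
  absolutely convergent double integral (\<open>bessel_bracket_eq\<close>), which gives linearity and the bound at once.
\<close>

section \<open>Poisson's integral for the modified Bessel function\<close>

text \<open>
  The decay of the Gaussian is exploited through this trade of exponential for power decay: the
  exponent \<open>k\<close> can be chosen differently in each region of space and time.
\<close>

lemma exp_minus_le_powr:
  fixes u k :: real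
  assumes "0 < u" "0 < k"
  shows "exp (- u) \<le> k powr k * u powr (- k)"
proof -
  have "ln (u / k) \<le> u / k - 1"
    using assms by (intro ln_le_minus_one) auto
  then have "k * ln (u / k) \<le> k * (u / k - 1)"
    using assms by (intro mult_left_mono) auto
  then have "k * (ln u - ln k) \<le> u - k"
    using assms by (simp add: ln_div algebra_simps)
  then have "- u \<le> k * ln k + (- k) * ln u"
    using assms by (simp add: algebra_simps)
  then have "exp (- u) \<le> exp (k * ln k + (- k) * ln u)"
    by simp
  also have "\<dots> = k powr k * u powr (- k)"
    using assms by (simp add: powr_def exp_diff exp_minus divide_inverse)
  finally show ?thesis .
qed

text \<open>
  The integrands of the Beta and Gamma integrals, cut off to their natural domains, so that all
  integrals below run over the whole line and differ only in their integrands.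
\<close>

definition beta_kernel :: "real \<Rightarrow> real \<Rightarrow> real \<Rightarrow> real"
  where "beta_kernel a b v = indicator {0<..<1} v * (v powr (a - 1) * (1 - v) powr (b - 1))"

definition gamma_kernel :: "real \<Rightarrow> real \<Rightarrow> real \<Rightarrow> real"
  where "gamma_kernel a c w = indicator {0<..} w * (w powr (a - 1) * exp (- (c * w)))"

lemma beta_kernel_nonneg: "0 \<le> beta_kernel a b v"
  by (simp add: beta_kernel_def)

lemma gamma_kernel_nonneg: "0 \<le> gamma_kernel a b v"
  by (simp add: gamma_kernel_def)

lemma measurable_beta_kernel [measurable]: "beta_kernel a b \<in> borel_measurable borel"
  unfolding beta_kernel_def by measurable

lemma measurable_gamma_kernel [measurable]: "gamma_kernel a b \<in> borel_measurable borel"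
  unfolding gamma_kernel_def by measurable

lemma has_bochner_integral_beta_kernel:
  assumes "0 < a" "0 < b"
  shows "has_bochner_integral lborel (beta_kernel a b) (Beta a b)"
proof -
  let ?g = "\<lambda>t::real. t powr (a - 1) * (1 - t) powr (b - 1)"
  have eq: "beta_kernel a b = (\<lambda>t. indicator {0..1} t *\<^sub>R ?g t)"
    by (rule ext) (auto simp: beta_kernel_def indicator_def)
  note I = integrable_Beta[OF assms]
  have "integral {0..1} ?g = Beta a b"
    using has_integral_Beta_real[OF assms] by (rule integral_unique)
  with I show ?thesis
    unfolding eq has_bochner_integral_iff set_integrable_def
    using set_borel_integral_eq_integral(2)[OF I] by (simp add: set_lebesgue_integral_def)
qed

lemma has_bochner_integral_gamma_kernel:
  assumes "0 < a" "0 < c"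
  shows "has_bochner_integral lborel (gamma_kernel a c) (Gamma a / c powr a)"
proof -
  have G: "0 < Gamma a"
    using assms by (intro Gamma_real_pos) auto
  have "ennreal (Gamma a) = (\<integral>\<^sup>+t. ennreal (gamma_kernel a 1 t) \<partial>lborel)"
    unfolding Gamma_conv_nn_integral_real[OF assms(1)]
    by (intro nn_integral_cong)
       (auto simp: gamma_kernel_def indicator_def exp_minus divide_inverse)
  also have "\<dots> = ennreal \<bar>c\<bar> * (\<integral>\<^sup>+t. ennreal (gamma_kernel a 1 (0 + c * t)) \<partial>lborel)"
    using assms by (intro nn_integral_real_affine) auto
  also have "\<dots> = ennreal \<bar>c\<bar> * (\<integral>\<^sup>+t. ennreal (c powr (a - 1)) * ennreal (gamma_kernel a c t) \<partial>lborel)"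
    using assms by (intro arg_cong2[where f="(*)"] nn_integral_cong refl)
      (auto simp: gamma_kernel_def indicator_def powr_mult zero_less_mult_iff ennreal_mult'[symmetric] mult_ac)
  also have "\<dots> = ennreal (c powr a) * (\<integral>\<^sup>+t. ennreal (gamma_kernel a c t) \<partial>lborel)"
  proof -
    have "c * c powr (a - 1) = c powr a"
      using assms by (simp add: powr_diff)
    then have "ennreal \<bar>c\<bar> * ennreal (c powr (a - 1)) = ennreal (c powr a)"
      using assms by (simp flip: ennreal_mult')
    then show ?thesis
      by (subst nn_integral_cmult) (auto simp: mult.assoc[symmetric])
  qed
  finally have *: "ennreal (Gamma a) = ennreal (c powr a) * (\<integral>\<^sup>+t. ennreal (gamma_kernel a c t) \<partial>lborel)" .
  have "(\<integral>\<^sup>+t. ennreal (gamma_kernel a c t) \<partial>lborel)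
      = ennreal (1 / c powr a) * (ennreal (c powr a) * (\<integral>\<^sup>+t. ennreal (gamma_kernel a c t) \<partial>lborel))"
    using assms by (simp add: mult.assoc[symmetric] ennreal_mult'[symmetric])
  also have "\<dots> = ennreal (Gamma a / c powr a)"
    unfolding *[symmetric] using G by (simp add: ennreal_mult'[symmetric])
  finally show ?thesis
    using G by (intro has_bochner_integral_nn_integral) (auto simp: gamma_kernel_nonneg)
qed

lemma Gamma_nat_plus_half:
  "Gamma (real k + 1 / 2) = sqrt pi * fact (2 * k) / (4 ^ k * fact k)"
proof (induction k)
  case 0
  then show ?case by (simp add: Gamma_one_half_real)
next
  case (Suc k)
  have ni: "real k + 1/2 \<notin> \<int>\<^sub>\<le>\<^sub>0"
    by (auto elim!: nonpos_Ints_cases)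
  have "Gamma (real (Suc k) + 1 / 2) = Gamma ((real k + 1/2) + 1)"
    by (simp add: algebra_simps)
  also have "\<dots> = (real k + 1/2) * Gamma (real k + 1 / 2)"
    using Gamma_plus1 ni by blast
  also have "\<dots> = sqrt pi * ((real k + 1/2) * fact (2 * k)) / (4 ^ k * fact k)"
    unfolding Suc by simp
  also have "(real k + 1/2) * fact (2 * k) = fact (2 * Suc k) / (4 * (real k + 1))"
    by (simp add: field_simps)
  finally show ?case
    by (simp add: field_simps)
qed

lemma cosh_sums_even: "(\<lambda>k. (x::real) ^ (2 * k) / fact (2 * k)) sums cosh x"
proof -
  have "(\<lambda>n. (if even n then x ^ n /\<^sub>R fact n else 0)) sums cosh x"
    by (rule cosh_converges)
  then show ?thesis
    by (subst (asm) sums_mono_reindex[symmetric, where g="\<lambda>k. 2 * k"])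
      (auto simp: strict_mono_def divide_inverse mult_ac elim: evenE)
qed

lemma integrable_beta_kernel_mult:
  assumes "0 < a" "0 < b" "g \<in> borel_measurable borel" "\<And>v. v \<in> {0<..<1} \<Longrightarrow> \<bar>g v\<bar> \<le> C"
  shows "integrable lborel (\<lambda>v. beta_kernel a b v * g v)"
proof (rule Bochner_Integration.integrable_bound)
  show "integrable lborel (\<lambda>v. C * beta_kernel a b v)"
    using has_bochner_integral_beta_kernel[OF assms(1,2)]
    by (simp add: has_bochner_integral_iff)
  show "AE v in lborel. norm (beta_kernel a b v * g v) \<le> norm (C * beta_kernel a b v)"
  proof (rule AE_I2)
    fix v
    show "norm (beta_kernel a b v * g v) \<le> norm (C * beta_kernel a b v)"
      using assms(4)[of v]
      by (auto simp: beta_kernel_def indicator_def abs_mult mult_ac intro!: mult_left_mono)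
  qed
qed (use assms in measurable)

text \<open>
  Poisson's formula in the variable \<open>v\<close>, the square of the usual one: the even power series of \<open>cosh\<close>
  then consists of integer powers of \<open>v\<close>, each term is a Beta integral, and the half-integer Gamma
  values turn these Beta values into the coefficients of the Bessel series. All terms are
  nonnegative, so sum and integral may be exchanged.
\<close>

lemma bessel_I_Poisson:
  assumes l: "- 1 / 2 < l" and z: "0 < z"
  shows "bessel_I l z = (z / 2) powr l / (sqrt pi * Gamma (l + 1 / 2)) *
           (\<integral>v. beta_kernel (1 / 2) (l + 1 / 2) v * cosh (z * sqrt v) \<partial>lborel)"
proof -
  define \<nu> where "\<nu> = l + 1 / 2"
  have nu: "0 < \<nu>" using l by (simp add: \<nu>_def)
  have G: "0 < Gamma \<nu>" using nu by (rule Gamma_real_pos)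
  define J where "J = (\<integral>v. beta_kernel (1 / 2) \<nu> v * cosh (z * sqrt v) \<partial>lborel)"
  define c where "c k = z ^ (2 * k) / fact (2 * k) * Beta (real k + 1 / 2) \<nu>" for k :: nat
  have Beta_pos: "0 < Beta (real k + 1 / 2) \<nu>" for k
    using nu unfolding Beta_def by (intro divide_pos_pos mult_pos_pos Gamma_real_pos) auto
  have c_nonneg: "0 \<le> c k" for k
    using z Beta_pos[of k] by (simp add: c_def)
  have J_int: "integrable lborel (\<lambda>v. beta_kernel (1 / 2) \<nu> v * cosh (z * sqrt v))"
  proof (rule integrable_beta_kernel_mult)
    fix v :: real assume "v \<in> {0<..<1}"
    then have "\<bar>z * sqrt v\<bar> \<le> \<bar>z\<bar>" using z by simp
    then show "\<bar>cosh (z * sqrt v)\<bar> \<le> cosh z"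
      using z \<open>v \<in> _\<close> by (subst abs_of_nonneg, simp, subst cosh_real_nonneg_le_iff) auto
  qed (use nu in \<open>auto simp: cosh_def\<close>)
  have "ennreal J = (\<integral>\<^sup>+v. ennreal (beta_kernel (1 / 2) \<nu> v * cosh (z * sqrt v)) \<partial>lborel)"
    unfolding J_def using J_int
    by (intro nn_integral_eq_integral[symmetric]) (auto simp: beta_kernel_nonneg)
  also have "\<dots> = (\<integral>\<^sup>+v. (\<Sum>k. ennreal (z ^ (2 * k) / fact (2 * k) * beta_kernel (real k + 1 / 2) \<nu> v)) \<partial>lborel)"
  proof (rule nn_integral_cong)
    fix v :: real
    have "(\<lambda>k. beta_kernel (1 / 2) \<nu> v * ((z * sqrt v) ^ (2 * k) / fact (2 * k)))
        sums (beta_kernel (1 / 2) \<nu> v * cosh (z * sqrt v))"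
      by (intro sums_mult cosh_sums_even)
    also have "(\<lambda>k. beta_kernel (1 / 2) \<nu> v * ((z * sqrt v) ^ (2 * k) / fact (2 * k)))
        = (\<lambda>k. z ^ (2 * k) / fact (2 * k) * beta_kernel (real k + 1 / 2) \<nu> v)"
    proof (rule ext)
      fix k :: nat
      show "beta_kernel (1 / 2) \<nu> v * ((z * sqrt v) ^ (2 * k) / fact (2 * k))
        = z ^ (2 * k) / fact (2 * k) * beta_kernel (real k + 1 / 2) \<nu> v"
      proof (cases "v \<in> {0<..<1}")
        case True
        have "v powr (real k + 1 / 2 - 1) = v ^ k * v powr (1/2 - 1)"
          using True by (simp add: powr_realpow[symmetric] powr_add[symmetric])
        moreover have "(z * sqrt v) ^ (2 * k) = z ^ (2 * k) * v ^ k"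
          using True by (simp add: power_mult_distrib power_mult[of "sqrt v"])
        ultimately show ?thesis using True
          by (simp add: beta_kernel_def mult_ac)
      qed (simp add: beta_kernel_def)
    qed
    finally show "ennreal (beta_kernel (1 / 2) \<nu> v * cosh (z * sqrt v))
       = (\<Sum>k. ennreal (z ^ (2 * k) / fact (2 * k) * beta_kernel (real k + 1 / 2) \<nu> v))"
      using z by (intro suminf_ennreal_eq[symmetric]) (auto simp: beta_kernel_nonneg)
  qed
  also have "\<dots> = (\<Sum>k. \<integral>\<^sup>+v. ennreal (z ^ (2 * k) / fact (2 * k) * beta_kernel (real k + 1 / 2) \<nu> v) \<partial>lborel)"
    by (rule nn_integral_suminf) auto
  also have "\<dots> = (\<Sum>k. ennreal (c k))"
  proof (rule arg_cong[where f=suminf], rule ext)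
    fix k :: nat
    have "has_bochner_integral lborel (\<lambda>v. z ^ (2 * k) / fact (2 * k) * beta_kernel (real k + 1 / 2) \<nu> v) (c k)"
      unfolding c_def using nu
      by (intro has_bochner_integral_mult_right has_bochner_integral_beta_kernel) auto
    then show "(\<integral>\<^sup>+v. ennreal (z ^ (2 * k) / fact (2 * k) * beta_kernel (real k + 1 / 2) \<nu> v) \<partial>lborel) = ennreal (c k)"
      using z by (subst nn_integral_eq_integral)
        (auto simp: has_bochner_integral_iff beta_kernel_nonneg)
  qed
  finally have sum: "(\<Sum>k. ennreal (c k)) = ennreal J" ..
  then have "summable c"
    by (intro summable_suminf_not_top c_nonneg) auto
  moreover have "0 \<le> J"
    unfolding J_def by (intro Bochner_Integration.integral_nonneg) (auto simp: beta_kernel_nonneg)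
  ultimately have "suminf c = J"
    using sum c_nonneg by (subst (asm) suminf_ennreal2) (auto simp: suminf_nonneg)
  have "bessel_I l z = (\<Sum>k. (z / 2) powr l / (sqrt pi * Gamma \<nu>) * c k)"
    unfolding bessel_I_def
  proof (rule arg_cong[where f=suminf], rule ext)
    fix k :: nat
    have "(z / 2) powr (l + 2 * real k) = (z / 2) powr l * (z ^ (2 * k) / 4 ^ k)"
      using z powr_realpow[of "z / 2" "2 * k"]
      by (simp add: powr_add power_divide power_mult)
    moreover have "c k = z ^ (2 * k) / fact (2 * k) *
        (Gamma (real k + 1 / 2) * Gamma \<nu> / Gamma (l + real k + 1))"
      by (simp add: c_def Beta_def \<nu>_def add_ac)
    ultimately show "(z / 2) powr (l + 2 * real k) / (fact k * Gamma (l + real k + 1)) =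
        (z / 2) powr l / (sqrt pi * Gamma \<nu>) * c k"
      using G unfolding Gamma_nat_plus_half by simp
  qed
  also have "\<dots> = (z / 2) powr l / (sqrt pi * Gamma \<nu>) * J"
    by (simp only: suminf_mult[OF \<open>summable c\<close>] \<open>suminf c = J\<close>)
  finally show ?thesis by (simp add: \<nu>_def J_def)
qed

section \<open>Asymptotics of the Bessel kernel\<close>

lemma integral_reflect_unit:
  fixes g :: "real \<Rightarrow> real"
  shows "(\<integral>v. g (1 - v) \<partial>lborel) = (\<integral>v. g v \<partial>lborel)"
  using lborel_integral_real_affine[of "-1" g 1] by simp

text \<open>
  The singularity of the Beta weight at \<open>w = 1\<close> costs nothing: for \<open>w \<le> 1 / 2\<close> the weight is comparable
  to a Gamma integrand, which yields \<open>z powr - a\<close>, and for \<open>w > 1 / 2\<close> the exponential is at most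
  \<open>exp (- z / 4)\<close>, which decays faster than any power.
\<close>

lemma beta_kernel_exp_integral_bound:
  assumes a: "0 < a"
  obtains C where "0 < C"
    "\<And>z. 0 < z \<Longrightarrow> integrable lborel (\<lambda>w. beta_kernel a (1 / 2) w * exp (- (z * w / 2)))"
    "\<And>z. 0 < z \<Longrightarrow> (\<integral>w. beta_kernel a (1 / 2) w * exp (- (z * w / 2)) \<partial>lborel) \<le> C * z powr (- a)"
proof -
  define C where "C = sqrt 2 * Gamma a * 2 powr a + a powr a * 4 powr a * Beta a (1/2)"
  have G: "0 < Gamma a" using a by (rule Gamma_real_pos)
  have B: "0 < Beta a (1/2)"
    using a unfolding Beta_def by (intro divide_pos_pos mult_pos_pos Gamma_real_pos) auto
  have "0 < C" unfolding C_def using a G B by (intro add_pos_pos mult_pos_pos) auto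
  moreover have I: "integrable lborel (\<lambda>w. beta_kernel a (1 / 2) w * exp (- (z * w / 2)))" if "0 < z" for z
    by (rule integrable_beta_kernel_mult[where C=1]) (use a that in auto)
  moreover have "(\<integral>w. beta_kernel a (1 / 2) w * exp (- (z * w / 2)) \<partial>lborel) \<le> C * z powr (- a)"
    if z: "0 < z" for z
  proof -
    have g: "has_bochner_integral lborel (gamma_kernel a (z / 2)) (Gamma a / (z / 2) powr a)"
      using a z by (intro has_bochner_integral_gamma_kernel) auto
    have b: "has_bochner_integral lborel (beta_kernel a (1 / 2)) (Beta a (1 / 2))"
      using a by (intro has_bochner_integral_beta_kernel) auto
    have gb: "has_bochner_integral lborel
        (\<lambda>w. sqrt 2 * gamma_kernel a (z / 2) w + exp (- (z / 4)) * beta_kernel a (1 / 2) w)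
        (sqrt 2 * (Gamma a / (z / 2) powr a) + exp (- (z / 4)) * Beta a (1 / 2))"
      by (intro has_bochner_integral_add has_bochner_integral_mult_right g b)
    have "(\<integral>w. beta_kernel a (1 / 2) w * exp (- (z * w / 2)) \<partial>lborel)
        \<le> (\<integral>w. sqrt 2 * gamma_kernel a (z / 2) w + exp (- (z / 4)) * beta_kernel a (1 / 2) w \<partial>lborel)"
    proof (rule integral_mono)
      show "integrable lborel (\<lambda>w. sqrt 2 * gamma_kernel a (z / 2) w + exp (- (z / 4)) * beta_kernel a (1 / 2) w)"
        using gb by (simp add: has_bochner_integral_iff)
      fix w :: real
      consider "w \<notin> {0<..<1}" | "0 < w" "w \<le> 1/2" | "1/2 < w" "w < 1" by fastforce
      then show "beta_kernel a (1 / 2) w * exp (- (z * w / 2)) \<le>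
           sqrt 2 * gamma_kernel a (z / 2) w + exp (- (z / 4)) * beta_kernel a (1 / 2) w"
      proof cases
        case 1
        then show ?thesis
          using gamma_kernel_nonneg[of a "z / 2" w] by (simp add: beta_kernel_def)
      next
        case 2
        have "(1 - w) powr (- (1/2)) \<le> (1/2) powr (- (1/2))"
          using 2 by (intro powr_mono2') auto
        also have "(1/2) powr (- (1/2)) = sqrt (2::real)"
          by (simp add: powr_minus_divide powr_half_sqrt real_sqrt_divide)
        finally have "w powr (a - 1) * exp (- (z * w / 2)) * (1 - w) powr (- (1/2))
            \<le> w powr (a - 1) * exp (- (z * w / 2)) * sqrt 2"
          by (intro mult_left_mono) auto
        then have "beta_kernel a (1 / 2) w * exp (- (z * w / 2)) \<le> sqrt 2 * gamma_kernel a (z / 2) w"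
          using 2 by (simp add: beta_kernel_def gamma_kernel_def mult_ac)
        then show ?thesis
          using beta_kernel_nonneg[of a "1/2" w] by (smt (verit) exp_ge_zero mult_nonneg_nonneg)
      next
        case 3
        then have "exp (- (z * w / 2)) \<le> exp (- (z / 4))" using z by simp
        then have "beta_kernel a (1 / 2) w * exp (- (z * w / 2)) \<le> exp (- (z / 4)) * beta_kernel a (1 / 2) w"
          using beta_kernel_nonneg[of a "1/2" w] by (metis mult.commute mult_left_mono)
        then show ?thesis
          using gamma_kernel_nonneg[of a "z / 2" w] by (smt (verit) real_sqrt_ge_zero mult_nonneg_nonneg)
      qed
    qed (rule I[OF z])
    also have "\<dots> = sqrt 2 * (Gamma a / (z / 2) powr a) + exp (- (z / 4)) * Beta a (1 / 2)"
      using gb by (simp add: has_bochner_integral_iff)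
    also have "\<dots> \<le> sqrt 2 * (Gamma a / (z / 2) powr a) + (a powr a * (z / 4) powr (- a)) * Beta a (1 / 2)"
      using exp_minus_le_powr[of "z / 4" a] z a B by (intro add_left_mono mult_right_mono) auto
    also have "\<dots> = C * z powr (- a)"
      using z by (simp add: C_def powr_divide powr_minus field_simps)
    finally show ?thesis .
  qed
  ultimately show ?thesis by (rule that)
qed

text \<open>
  The quotient of the Bessel heat kernel and the Gaussian heat kernel depends only on
  \<open>z = x y / (2 t)\<close> and equals this function.
\<close>

definition bessel_ratio :: "real \<Rightarrow> real \<Rightarrow> real"
  where "bessel_ratio l z = sqrt (2 * pi * z) * exp (- z) * bessel_I l z"

text \<open>
  The factor \<open>2 exp (- z) cosh (z sqrt v)\<close> of Poisson's integral at \<open>v = 1 - w\<close>. The reflection moves the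
  point where the exponent vanishes to \<open>w = 0\<close>, next to which the integral concentrates.
\<close>

definition bessel_phase :: "real \<Rightarrow> real \<Rightarrow> real"
  where "bessel_phase z w = exp (- (z * (1 - sqrt (1 - w)))) + exp (- (z * (1 + sqrt (1 - w))))"

lemma measurable_bessel_phase [measurable]: "bessel_phase z \<in> borel_measurable borel"
  unfolding bessel_phase_def by measurable

text \<open>
  With \<open>q = sqrt (1 - w)\<close> the error of the linear approximation is exactly \<open>(1 - q)\<^sup>2 / 2\<close>.
\<close>

lemma half_le_one_minus_sqrt:
  fixes w :: real
  assumes "0 \<le> w" "w \<le> 1"
  shows "w / 2 \<le> 1 - sqrt (1 - w)" "1 - sqrt (1 - w) \<le> w / 2 + w\<^sup>2 / 2" "1 - sqrt (1 - w) \<le> w"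
proof -
  define q where "q = sqrt (1 - w)"
  have q: "0 \<le> q" "q\<^sup>2 = 1 - w" "q \<le> 1" using assms by (auto simp: q_def)
  have eq: "1 - q - w / 2 = (1 - q)\<^sup>2 / 2"
    using q(2) by (simp add: power2_eq_square algebra_simps)
  show "w / 2 \<le> 1 - sqrt (1 - w)"
    using eq zero_le_power2[of "1 - q"] unfolding q_def[symmetric] by linarith
  have "q * q \<le> q * 1" using q by (intro mult_left_mono) auto
  then have le: "1 - q \<le> w" using q(2) by (simp add: power2_eq_square)
  then show "1 - sqrt (1 - w) \<le> w" by (simp add: q_def)
  have "(1 - q)\<^sup>2 \<le> w\<^sup>2" using le q by (intro power_mono) auto
  then show "1 - sqrt (1 - w) \<le> w / 2 + w\<^sup>2 / 2"
    using eq by (simp add: q_def)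
qed

lemma bessel_phase_le:
  assumes "0 < z" "0 < w" "w < 1"
  shows "bessel_phase z w \<le> 2 * exp (- (z * w / 2))"
proof -
  have "z * (w / 2) \<le> z * (1 - sqrt (1 - w))"
    using assms half_le_one_minus_sqrt[of w] by (intro mult_left_mono) auto
  moreover have "z * (w / 2) \<le> z * (1 + sqrt (1 - w))"
    using assms by (intro mult_left_mono) (auto intro: order_trans[of _ 1])
  ultimately have "exp (- (z * (1 - sqrt (1 - w)))) \<le> exp (- (z * w / 2))"
    "exp (- (z * (1 + sqrt (1 - w)))) \<le> exp (- (z * w / 2))"
    by auto
  then show ?thesis unfolding bessel_phase_def by linarith
qed

text \<open>
  The integrand of Poisson's integral is compared with that of a Gamma integral. The three error
  terms come from the quadratic error in the exponent, from the second exponential, and from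
  \<open>(1 - w) powr (- 1 / 2)\<close>. On the scale \<open>w = O(1 / z)\<close>, where the exponential lives, each of them is
  smaller than the main term by a factor \<open>1 / z\<close>.
\<close>

lemma bessel_phase_approx:
  assumes "0 < z" "0 < w" "w < 1"
  shows "\<bar>(1 - w) powr (- 1 / 2) * bessel_phase z w - exp (- (z * w / 2))\<bar>
    \<le> (1 - w) powr (- 1 / 2) * ((z * w\<^sup>2 / 2 + 1 / z + w) * exp (- (z * w / 2)))"
proof -
  let ?e = "exp (- (z * w / 2))"
  define q where "q = sqrt (1 - w)"
  have q: "0 < q" "q\<^sup>2 = 1 - w" "q < 1" using assms by (auto simp: q_def)
  have qw: "w / 2 \<le> 1 - q" "1 - q \<le> w / 2 + w\<^sup>2 / 2" "1 - q \<le> w"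
    using half_le_one_minus_sqrt[of w] assms by (auto simp: q_def)
  have p: "(1 - w) powr (- 1 / 2) = 1 / q"
    using assms by (simp add: q_def powr_minus_divide powr_half_sqrt)
  have zw: "z * (w / 2) \<le> z * (1 - q)"
    using qw assms by (intro mult_left_mono) auto
  have e1: "exp (- (z * (1 - q))) \<le> ?e"
    using zw by simp
  have "z * (1 - q) \<le> z * (w / 2 + w\<^sup>2 / 2)"
    using qw(2) assms(1) by (intro mult_left_mono) auto
  then have z2: "z * (1 - q) \<le> z * w / 2 + z * w\<^sup>2 / 2" by (simp add: algebra_simps)
  have "1 + (- (z * w\<^sup>2 / 2)) \<le> exp (- (z * w\<^sup>2 / 2))" by (rule exp_ge_add_one_self)
  then have "?e * (1 - z * w\<^sup>2 / 2) \<le> ?e * exp (- (z * w\<^sup>2 / 2))"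
    by (intro mult_left_mono) auto
  also have "\<dots> = exp (- (z * w / 2 + z * w\<^sup>2 / 2))"
    by (simp add: exp_add[symmetric])
  also have "\<dots> \<le> exp (- (z * (1 - q)))"
    using z2 by simp
  finally have e2: "?e - z * w\<^sup>2 / 2 * ?e \<le> exp (- (z * (1 - q)))"
    by (simp add: algebra_simps)
  have "exp (- (z * (1 + q))) \<le> exp (- (z / 2)) * ?e"
  proof -
    have "z * (1/2 + w / 2) \<le> z * (1 + q)" using assms q by (intro mult_left_mono) auto
    then show ?thesis by (simp add: exp_add[symmetric] algebra_simps)
  qed
  also have "exp (- (z / 2)) \<le> 1 / z"
  proof -
    have "(1 + z / 4)\<^sup>2 \<le> (exp (z / 4))\<^sup>2"
      using assms exp_ge_add_one_self[of "z / 4"] by (intro power_mono) auto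
    also have "(exp (z / 4))\<^sup>2 = exp (z / 2)"
      by (simp add: exp_double[symmetric])
    finally have "z \<le> exp (z / 2)"
      using assms sum_squares_bound[of 1 "z/4"] by (simp add: power2_eq_square algebra_simps)
    then show ?thesis using assms by (simp add: exp_minus field_simps)
  qed
  finally have e3: "exp (- (z * (1 + q))) \<le> 1 / z * ?e" by simp
  have E: "\<bar>bessel_phase z w - ?e\<bar> \<le> (z * w\<^sup>2 / 2 + 1 / z) * ?e"
  proof -
    have "0 \<le> exp (- (z * (1 + q)))" "0 \<le> z * w\<^sup>2 / 2 * ?e" using assms by auto
    then show ?thesis
      using e1 e2 e3 unfolding bessel_phase_def q_def[symmetric] distrib_right by linarith
  qed
  have "\<bar>bessel_phase z w - q * ?e\<bar> \<le> \<bar>bessel_phase z w - ?e\<bar> + \<bar>(1 - q) * ?e\<bar>"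
    by (simp add: algebra_simps)
  also have "\<bar>(1 - q) * ?e\<bar> \<le> w * ?e"
    using q qw by (simp add: abs_mult)
  finally have "\<bar>bessel_phase z w - q * ?e\<bar> \<le> (z * w\<^sup>2 / 2 + 1 / z + w) * ?e"
    using E by (simp add: distrib_right)
  then have "1 / q * \<bar>bessel_phase z w - q * ?e\<bar> \<le> 1 / q * ((z * w\<^sup>2 / 2 + 1 / z + w) * ?e)"
    using q by (intro mult_left_mono) auto
  moreover have "1 / q * \<bar>bessel_phase z w - q * ?e\<bar> = \<bar>1 / q * bessel_phase z w - ?e\<bar>"
  proof -
    have "1 / q * \<bar>bessel_phase z w - q * ?e\<bar> = \<bar>1 / q * (bessel_phase z w - q * ?e)\<bar>"
      using q by (simp only: abs_mult) simp
    also have "1 / q * (bessel_phase z w - q * ?e) = 1 / q * bessel_phase z w - ?e"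
      using q by (simp add: field_simps)
    finally show ?thesis .
  qed
  ultimately show ?thesis by (simp only: p)
qed

lemma bessel_ratio_eq:
  assumes l: "- 1 / 2 < l" and z: "0 < z"
  shows "bessel_ratio l z = z powr (l + 1 / 2) / (2 powr (l + 1 / 2) * Gamma (l + 1 / 2)) *
    (\<integral>w. beta_kernel (l + 1 / 2) (1 / 2) w * bessel_phase z w \<partial>lborel)"
proof -
  define \<nu> where "\<nu> = l + 1 / 2"
  have "(\<integral>w. beta_kernel \<nu> (1 / 2) w * bessel_phase z w \<partial>lborel)
     = (\<integral>v. beta_kernel \<nu> (1 / 2) (1 - v) * bessel_phase z (1 - v) \<partial>lborel)"
    by (rule integral_reflect_unit[symmetric])
  also have "\<dots> = (\<integral>v. (2 * exp (- z)) * (beta_kernel (1 / 2) \<nu> v * cosh (z * sqrt v)) \<partial>lborel)"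
  proof (rule Bochner_Integration.integral_cong[OF refl])
    fix v :: real
    have "bessel_phase z (1 - v) = 2 * exp (- z) * cosh (z * sqrt v)"
      by (simp add: bessel_phase_def cosh_def distrib_left right_diff_distrib mult_exp_exp)
    moreover have "beta_kernel \<nu> (1 / 2) (1 - v) = beta_kernel (1 / 2) \<nu> v"
      by (auto simp: beta_kernel_def indicator_def)
    ultimately show "beta_kernel \<nu> (1 / 2) (1 - v) * bessel_phase z (1 - v) =
       (2 * exp (- z)) * (beta_kernel (1 / 2) \<nu> v * cosh (z * sqrt v))" by simp
  qed
  also have "\<dots> = 2 * exp (- z) * (\<integral>v. beta_kernel (1 / 2) \<nu> v * cosh (z * sqrt v) \<partial>lborel)"
    by simp
  finally have eq: "(\<integral>w. beta_kernel \<nu> (1 / 2) w * bessel_phase z w \<partial>lborel)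
    = 2 * exp (- z) * (\<integral>v. beta_kernel (1 / 2) \<nu> v * cosh (z * sqrt v) \<partial>lborel)" .
  have "sqrt (2 * pi * z) * (z / 2) powr l = sqrt pi * (z powr \<nu> / 2 powr \<nu>) * 2"
  proof -
    have "(z / 2) powr \<nu> = (z / 2) powr l * sqrt (z / 2)"
      using z by (simp add: \<nu>_def powr_add powr_half_sqrt)
    moreover have "(z / 2) powr \<nu> = z powr \<nu> / 2 powr \<nu>" using z by (simp add: powr_divide)
    moreover have "sqrt (2 * pi * z) = sqrt pi * (2 * sqrt (z / 2))"
    proof -
      have "2 * sqrt (z / 2) = sqrt (4 * (z / 2))" by (subst real_sqrt_mult) simp
      then show ?thesis using z by (simp add: real_sqrt_mult[symmetric] mult_ac)
    qed
    ultimately show ?thesis by (simp add: mult_ac)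
  qed
  note S = this
  define J where "J = (\<integral>v. beta_kernel (1 / 2) \<nu> v * cosh (z * sqrt v) \<partial>lborel)"
  have "bessel_ratio l z
      = (sqrt (2 * pi * z) * (z / 2) powr l) * (exp (- z) * J / (sqrt pi * Gamma \<nu>))"
    unfolding bessel_ratio_def bessel_I_Poisson[OF l z] \<nu>_def[symmetric] J_def by simp
  also have "\<dots> = z powr \<nu> / (2 powr \<nu> * Gamma \<nu>) * (2 * exp (- z) * J)"
    unfolding S by simp
  finally show ?thesis
    unfolding \<nu>_def[symmetric] eq J_def .
qed

text \<open>
  Replacing the integrand of Poisson's integral by \<open>w powr (\<nu> - 1) * exp (- z w / 2)\<close> on the half-line
  produces a Gamma integral whose value makes the ratio exactly 1. Every error is a Beta or Gamma
  integral with one more power of \<open>1 / z\<close>. Both estimates hold for all \<open>z > 0\<close>; the first one is the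
  useful one for small \<open>z\<close>.
\<close>

theorem bessel_ratio_asymptotics:
  assumes l: "- 1 / 2 < l"
  obtains C where "0 < C" "\<And>z. 0 < z \<Longrightarrow> \<bar>bessel_ratio l z - 1\<bar> \<le> C"
    "\<And>z. 0 < z \<Longrightarrow> \<bar>bessel_ratio l z - 1\<bar> \<le> C / z"
proof -
  define \<nu> where "\<nu> = l + 1 / 2"
  have nu: "0 < \<nu>" using l by (simp add: \<nu>_def)
  have G: "0 < Gamma \<nu>" using nu by (rule Gamma_real_pos)
  have G1: "0 < Gamma (\<nu> + 1)" using nu by (intro Gamma_real_pos) simp
  define H where "H a z = (\<integral>w. beta_kernel a (1 / 2) w * exp (- (z * w / 2)) \<partial>lborel)" for a z
  obtain C0 where C0: "0 < C0"
    "\<And>z. 0 < z \<Longrightarrow> integrable lborel (\<lambda>w. beta_kernel \<nu> (1 / 2) w * exp (- (z * w / 2)))"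
    "\<And>z. 0 < z \<Longrightarrow> H \<nu> z \<le> C0 * z powr (- \<nu>)"
    by (rule beta_kernel_exp_integral_bound[OF nu, folded H_def]) (rule that; assumption)
  have nu': "0 < \<nu> + 1" "0 < \<nu> + 2" using nu by auto
  obtain C1 where C1: "0 < C1"
    "\<And>z. 0 < z \<Longrightarrow> integrable lborel (\<lambda>w. beta_kernel (\<nu> + 1) (1 / 2) w * exp (- (z * w / 2)))"
    "\<And>z. 0 < z \<Longrightarrow> H (\<nu> + 1) z \<le> C1 * z powr (- (\<nu> + 1))"
    by (rule beta_kernel_exp_integral_bound[OF nu'(1), folded H_def]) (rule that; assumption)
  obtain C2 where C2: "0 < C2"
    "\<And>z. 0 < z \<Longrightarrow> integrable lborel (\<lambda>w. beta_kernel (\<nu> + 2) (1 / 2) w * exp (- (z * w / 2)))"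
    "\<And>z. 0 < z \<Longrightarrow> H (\<nu> + 2) z \<le> C2 * z powr (- (\<nu> + 2))"
    by (rule beta_kernel_exp_integral_bound[OF nu'(2), folded H_def]) (rule that; assumption)
  define J where "J z = (\<integral>w. beta_kernel \<nu> (1 / 2) w * bessel_phase z w \<partial>lborel)" for z
  have J_int: "integrable lborel (\<lambda>w. beta_kernel \<nu> (1 / 2) w * bessel_phase z w)" if "0 < z" for z
  proof (rule integrable_beta_kernel_mult[where C=2])
    fix v :: real assume "v \<in> {0<..<1}"
    then have v: "0 < v" "v < 1" by auto
    have "bessel_phase z v \<le> 2 * exp (- (z * v / 2))"
      using that v by (rule bessel_phase_le)
    also have "\<dots> \<le> 2" using that v by simp
    finally show "\<bar>bessel_phase z v\<bar> \<le> 2"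
      by (simp add: bessel_phase_def add_nonneg_nonneg)
  qed (use nu in auto)
  have g: "has_bochner_integral lborel (gamma_kernel a (z / 2)) (Gamma a * 2 powr a * z powr (- a))"
    if "0 < a" "0 < z" for a z
    using has_bochner_integral_gamma_kernel[of a "z / 2"] that
    by (simp add: powr_divide powr_minus field_simps)
  have ratio: "bessel_ratio l z = z powr \<nu> / (2 powr \<nu> * Gamma \<nu>) * J z" if "0 < z" for z
    using bessel_ratio_eq[OF l that] by (simp add: \<nu>_def J_def)
  have b1: "\<bar>bessel_ratio l z\<bar> \<le> 2 * C0 / (2 powr \<nu> * Gamma \<nu>)" if z: "0 < z" for z
  proof -
    have "0 \<le> J z" unfolding J_def
      by (intro Bochner_Integration.integral_nonneg) (auto simp: beta_kernel_nonneg bessel_phase_def)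
    have "J z \<le> (\<integral>w. 2 * (beta_kernel \<nu> (1 / 2) w * exp (- (z * w / 2))) \<partial>lborel)"
      unfolding J_def
    proof (intro integral_mono J_int z integrable_mult_right C0)
      fix w :: real
      show "beta_kernel \<nu> (1 / 2) w * bessel_phase z w \<le> 2 * (beta_kernel \<nu> (1 / 2) w * exp (- (z * w / 2)))"
      proof (cases "w \<in> {0<..<1}")
        case True
        then have "beta_kernel \<nu> (1 / 2) w * bessel_phase z w \<le> beta_kernel \<nu> (1 / 2) w * (2 * exp (- (z * w / 2)))"
          using bessel_phase_le[OF z, of w] by (intro mult_left_mono) (auto simp: beta_kernel_nonneg)
        then show ?thesis by (simp add: mult_ac)
      qed (simp add: beta_kernel_def)
    qed
    also have "\<dots> \<le> 2 * (C0 * z powr (- \<nu>))"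
      using C0(3)[OF z] by (simp add: H_def)
    finally have "z powr \<nu> / (2 powr \<nu> * Gamma \<nu>) * J z \<le> z powr \<nu> / (2 powr \<nu> * Gamma \<nu>) * (2 * (C0 * z powr (- \<nu>)))"
      using G by (intro mult_left_mono) auto
    also have "\<dots> = 2 * C0 / (2 powr \<nu> * Gamma \<nu>)"
      using z by (simp add: powr_minus field_simps)
    finally show ?thesis
      unfolding ratio[OF z] using \<open>0 \<le> J z\<close> G by (simp add: abs_mult)
  qed
  \<comment> \<open>The four terms bound, in this order, the three errors of the phase approximation and the part of the Gamma integral over \<open>w \<ge> 1\<close>.\<close>
  define D where "D = C2 / 2 + C0 + C1 + Gamma (\<nu> + 1) * 2 powr (\<nu> + 1)"
  have D: "0 < D" unfolding D_def using C0(1) C1(1) C2(1) G1 by (intro add_pos_pos mult_pos_pos) auto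
  have b2: "\<bar>bessel_ratio l z - 1\<bar> \<le> D / (2 powr \<nu> * Gamma \<nu>) / z" if z: "0 < z" for z
  proof -
    let ?e = "\<lambda>w. exp (- (z * w / 2))"
    have gn: "has_bochner_integral lborel (gamma_kernel \<nu> (z / 2)) (Gamma \<nu> * 2 powr \<nu> * z powr (- \<nu>))"
      using nu z by (rule g)
    have gn1: "has_bochner_integral lborel (gamma_kernel (\<nu> + 1) (z / 2))
        (Gamma (\<nu> + 1) * 2 powr (\<nu> + 1) * z powr (- (\<nu> + 1)))"
      using nu z by (intro g) auto
    define R where "R w = z / 2 * (beta_kernel (\<nu> + 2) (1 / 2) w * ?e w) + 1 / z * (beta_kernel \<nu> (1 / 2) w * ?e w)
        + beta_kernel (\<nu> + 1) (1 / 2) w * ?e w + gamma_kernel (\<nu> + 1) (z / 2) w" for w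
    have R_int: "integrable lborel R"
      unfolding R_def using C0(2)[OF z] C1(2)[OF z] C2(2)[OF z] gn1
      by (intro Bochner_Integration.integrable_add integrable_mult_right) (auto simp: has_bochner_integral_iff)
    have "\<bar>J z - Gamma \<nu> * 2 powr \<nu> * z powr (- \<nu>)\<bar>
      = \<bar>\<integral>w. beta_kernel \<nu> (1 / 2) w * bessel_phase z w - gamma_kernel \<nu> (z / 2) w \<partial>lborel\<bar>"
      using gn J_int[OF z] by (simp add: J_def has_bochner_integral_iff)
    also have "\<dots> \<le> (\<integral>w. R w \<partial>lborel)"
    proof (rule integral_abs_bound[THEN order_trans], rule integral_mono)
      fix w :: real
      consider "w \<le> 0" | "1 \<le> w" | "0 < w" "w < 1" by linarith
      then show "\<bar>beta_kernel \<nu> (1 / 2) w * bessel_phase z w - gamma_kernel \<nu> (z / 2) w\<bar> \<le> R w"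
      proof cases
        case 1
        then show ?thesis by (simp add: R_def beta_kernel_def gamma_kernel_def)
      next
        case 2
        \<comment> \<open>Beyond \<open>w = 1\<close> an extra factor \<open>w\<close> may be inserted; it produces the extra power of \<open>1 / z\<close>.\<close>
        then have "w powr (\<nu> - 1) \<le> w powr \<nu>" by (intro powr_mono) auto
        then show ?thesis using 2 by (simp add: R_def beta_kernel_def gamma_kernel_def abs_mult)
      next
        case 3
        have w2: "w powr (\<nu> + 2 - 1) = w powr (\<nu> - 1) * w\<^sup>2" "w powr (\<nu> + 1 - 1) = w powr (\<nu> - 1) * w"
          using 3 powr_add[of w "\<nu> - 1" 2] powr_add[of w "\<nu> - 1" 1] by (simp_all add: algebra_simps)
        have "w powr (\<nu> - 1) * \<bar>(1 - w) powr (- 1 / 2) * bessel_phase z w - ?e w\<bar>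
          \<le> w powr (\<nu> - 1) * ((1 - w) powr (- 1 / 2) * ((z * w\<^sup>2 / 2 + 1 / z + w) * ?e w))"
          using bessel_phase_approx[OF z 3] by (intro mult_left_mono) auto
        also have "\<dots> = z / 2 * (beta_kernel (\<nu> + 2) (1 / 2) w * ?e w) + 1 / z * (beta_kernel \<nu> (1 / 2) w * ?e w)
            + beta_kernel (\<nu> + 1) (1 / 2) w * ?e w"
          using 3 unfolding beta_kernel_def w2 by (simp add: algebra_simps)
        also have "\<dots> \<le> R w" by (simp add: R_def gamma_kernel_nonneg)
        finally have "w powr (\<nu> - 1) * \<bar>(1 - w) powr (- 1 / 2) * bessel_phase z w - ?e w\<bar> \<le> R w" .
        moreover have "beta_kernel \<nu> (1 / 2) w * bessel_phase z w - gamma_kernel \<nu> (z / 2) w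
          = w powr (\<nu> - 1) * ((1 - w) powr (- 1 / 2) * bessel_phase z w - ?e w)"
          using 3 by (simp add: beta_kernel_def gamma_kernel_def algebra_simps)
        ultimately show ?thesis by (simp add: abs_mult)
      qed
    qed (use R_int gn J_int[OF z] in \<open>auto simp: has_bochner_integral_iff\<close>)
    also have "(\<integral>w. R w \<partial>lborel) = z / 2 * H (\<nu> + 2) z + 1 / z * H \<nu> z + H (\<nu> + 1) z
        + Gamma (\<nu> + 1) * 2 powr (\<nu> + 1) * z powr (- (\<nu> + 1))"
      unfolding R_def H_def using C0(2)[OF z] C1(2)[OF z] C2(2)[OF z] gn1
      by (simp add: has_bochner_integral_iff)
    also have "\<dots> \<le> z / 2 * (C2 * z powr (- (\<nu> + 2))) + 1 / z * (C0 * z powr (- \<nu>)) + C1 * z powr (- (\<nu> + 1))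
        + Gamma (\<nu> + 1) * 2 powr (\<nu> + 1) * z powr (- (\<nu> + 1))"
      using z C0(3)[OF z] C1(3)[OF z] C2(3)[OF z] by (intro add_mono mult_left_mono order_refl) auto
    also have "\<dots> = D * z powr (- \<nu>) / z"
    proof -
      have "z powr (- (\<nu> + 1)) = z powr (- \<nu>) / z" "z powr (- (\<nu> + 2)) = z powr (- \<nu>) / z / z"
        using z powr_realpow[of z 2]
        by (simp_all add: powr_diff powr_minus_divide power2_eq_square)
      then show ?thesis unfolding D_def using z by (simp only:) (simp add: field_simps)
    qed
    finally have *: "\<bar>J z - Gamma \<nu> * 2 powr \<nu> * z powr (- \<nu>)\<bar> \<le> D * z powr (- \<nu>) / z" .
    have "bessel_ratio l z - 1 = z powr \<nu> / (2 powr \<nu> * Gamma \<nu>) * (J z - Gamma \<nu> * 2 powr \<nu> * z powr (- \<nu>))"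
      using z G unfolding ratio[OF z] by (simp add: powr_minus field_simps)
    then have "\<bar>bessel_ratio l z - 1\<bar> = z powr \<nu> / (2 powr \<nu> * Gamma \<nu>) * \<bar>J z - Gamma \<nu> * 2 powr \<nu> * z powr (- \<nu>)\<bar>"
      using G by (simp add: abs_mult)
    also have "\<dots> \<le> z powr \<nu> / (2 powr \<nu> * Gamma \<nu>) * (D * z powr (- \<nu>) / z)"
      using * G by (intro mult_left_mono) auto
    also have "\<dots> = D / (2 powr \<nu> * Gamma \<nu>) / z"
      using z by (simp add: powr_minus field_simps)
    finally show ?thesis .
  qed
  define C where "C = max (2 * C0 / (2 powr \<nu> * Gamma \<nu>) + 1) (D / (2 powr \<nu> * Gamma \<nu>))"
  show ?thesis
  proof (rule that[of C])
    show "0 < C" unfolding C_def using D G by (simp add: less_max_iff_disj)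
    show "\<bar>bessel_ratio l z - 1\<bar> \<le> C" if "0 < z" for z
      using b1[OF that] unfolding C_def by linarith
    show "\<bar>bessel_ratio l z - 1\<bar> \<le> C / z" if "0 < z" for z
    proof -
      have "D / (2 powr \<nu> * Gamma \<nu>) / z \<le> C / z"
        using that by (intro divide_right_mono) (auto simp: C_def)
      then show ?thesis using b2[OF that] by linarith
    qed
  qed
qed

section \<open>Gaussian bounds\<close>

lemma W_gauss_nonneg: "0 < t \<Longrightarrow> 0 \<le> W_gauss t z"
  by (simp add: W_gauss_def)

lemma W_gauss_le_uniform:
  assumes "0 < t"
  shows "W_gauss t z \<le> t powr (- 1 / 2) * exp (- (z\<^sup>2 / (4 * t)))"
proof -
  have "1 \<le> sqrt pi" using pi_gt3 by simp
  then have "1 \<le> 2 * sqrt pi" by linarith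
  then have "1 * sqrt t \<le> (2 * sqrt pi) * sqrt t"
    using assms by (intro mult_right_mono) auto
  then have "1 / (2 * sqrt (pi * t)) \<le> 1 / sqrt t"
    using assms by (intro divide_left_mono) (auto simp: real_sqrt_mult)
  also have "1 / sqrt t = t powr (- 1 / 2)"
    using assms by (simp add: powr_minus_divide powr_half_sqrt)
  finally show ?thesis
    unfolding W_gauss_def using assms by (intro mult_mono) auto
qed

lemma W_gauss_le_powr:
  assumes t: "0 < t" and k: "0 \<le> \<kappa>" "\<kappa> \<le> 1" and z: "z \<noteq> 0"
  shows "W_gauss t z \<le> 4 * (t powr (\<kappa> - 1 / 2) * \<bar>z\<bar> powr (- (2 * \<kappa>)))"
proof -
  have "exp (- (z\<^sup>2 / (4 * t))) \<le> 4 * (t powr \<kappa> * \<bar>z\<bar> powr (- (2 * \<kappa>)))"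
  proof (cases "\<kappa> = 0")
    case True
    then show ?thesis using t z by (simp add: order_trans[of _ 1])
  next
    case False
    define u where "u = z\<^sup>2 / (4 * t)"
    have u: "0 < u" using t z by (simp add: u_def)
    have "exp (- u) \<le> \<kappa> powr \<kappa> * u powr (- \<kappa>)"
      using False k u by (intro exp_minus_le_powr) auto
    also have "\<dots> \<le> 1 * u powr (- \<kappa>)"
      using k False by (intro mult_right_mono powr_le1) auto
    also have "1 * u powr (- \<kappa>) = 4 powr \<kappa> * (t powr \<kappa> * \<bar>z\<bar> powr (- (2 * \<kappa>)))"
    proof -
      have "(z\<^sup>2) powr \<kappa> = (\<bar>z\<bar> powr 2) powr \<kappa>" using z by simp
      also have "\<dots> = \<bar>z\<bar> powr (2 * \<kappa>)" by (rule powr_powr)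
      finally show ?thesis
        using t z by (simp add: u_def powr_minus_divide powr_divide powr_mult)
    qed
    also have "\<dots> \<le> 4 * (t powr \<kappa> * \<bar>z\<bar> powr (- (2 * \<kappa>)))"
      using k powr_mono[of \<kappa> 1 4] by (intro mult_right_mono) auto
    finally show ?thesis by (simp add: u_def)
  qed
  then have "t powr (- 1 / 2) * exp (- (z\<^sup>2 / (4 * t)))
    \<le> t powr (- 1 / 2) * (4 * (t powr \<kappa> * \<bar>z\<bar> powr (- (2 * \<kappa>))))"
    by (intro mult_left_mono) auto
  also have "\<dots> = 4 * (t powr (\<kappa> - 1 / 2) * \<bar>z\<bar> powr (- (2 * \<kappa>)))"
    using powr_add[of t "- 1 / 2" \<kappa>] by simp
  finally show ?thesis
    using W_gauss_le_uniform[OF t, of z] by linarith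
qed

text \<open>
  In the variable \<open>u = ln t\<close> this is \<open>2 cosh (e u)\<close> with respect to \<open>dt / t\<close>. It dominates all the weights
  \<open>(ln t) ^ j / t\<close> and all \<open>1 / t powr (1 + s)\<close> with \<open>\<bar>s\<bar> \<le> e\<close>, up to constants.
\<close>

definition log_weight :: "real \<Rightarrow> real \<Rightarrow> real"
  where "log_weight e t = (t powr e + t powr (- e)) / t"

lemma measurable_log_weight [measurable]: "log_weight e \<in> borel_measurable borel"
  unfolding log_weight_def by measurable

lemma log_weight_nonneg: "0 < t \<Longrightarrow> 0 \<le> log_weight e t"
  by (simp add: log_weight_def)

lemma log_weight_le_small:
  assumes "0 < t" "t < 1" "0 < e"
  shows "log_weight e t \<le> 2 * t powr (- 1 - e)"
proof -
  have "t powr e \<le> t powr (- e)" using assms by (intro powr_mono') auto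
  then have "(t powr e + t powr (- e)) / t \<le> (2 * t powr (- e)) / t"
    using assms by (intro divide_right_mono) auto
  also have "\<dots> = 2 * t powr (- 1 - e)"
    using assms powr_add[of t "- 1" "- e"] by (simp add: powr_minus_divide)
  finally show ?thesis by (simp add: log_weight_def)
qed

lemma log_weight_le_large:
  assumes "1 \<le> t" "0 < e"
  shows "log_weight e t \<le> 2 * t powr (- 1 + e)"
proof -
  have "t powr (- e) \<le> t powr e" using assms by (intro powr_mono) auto
  then have "(t powr e + t powr (- e)) / t \<le> (2 * t powr e) / t"
    using assms by (intro divide_right_mono) auto
  also have "\<dots> = 2 * t powr (- 1 + e)"
    using assms powr_diff[of t e 1] by (simp add: algebra_simps)
  finally show ?thesis by (simp add: log_weight_def)
qed

text \<open>
  Integrable at both ends, with exponents within \<open>e\<close> of the critical exponent \<open>- 1\<close>. In each region the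
  Gaussian bound is used with the power of the distance that leaves at least this much room in time.
\<close>

definition time_profile :: "real \<Rightarrow> real \<Rightarrow> real"
  where "time_profile e t =
    indicator {0<..<1} t * t powr (e - 1) + indicator {1..} t * t powr (- 1 - e)"

lemma measurable_time_profile [measurable]: "time_profile e \<in> borel_measurable borel"
  unfolding time_profile_def by measurable

lemma time_profile_nonneg: "0 \<le> time_profile e t"
  by (simp add: time_profile_def)

lemma powr_le_time_profile_small:
  assumes "0 < t" "t < 1" "e - 1 \<le> a"
  shows "t powr a \<le> time_profile e t"
  using assms by (auto simp: time_profile_def intro: powr_mono')

lemma powr_le_time_profile_large:
  assumes "1 \<le> t" "a \<le> - 1 - e"
  shows "t powr a \<le> time_profile e t"
  using assms by (auto simp: time_profile_def intro: powr_mono)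

lemma gauss_weight_le_small:
  assumes t: "0 < t" "t < 1" and e: "0 < e" and k: "0 \<le> \<kappa>" "\<kappa> \<le> 1" "e - 1 \<le> \<kappa> - 3 / 2 - e" and z: "z \<noteq> 0"
  shows "W_gauss t z * log_weight e t \<le> 8 * (time_profile e t * \<bar>z\<bar> powr (- (2 * \<kappa>)))"
proof -
  have "W_gauss t z * log_weight e t
      \<le> (4 * (t powr (\<kappa> - 1 / 2) * \<bar>z\<bar> powr (- (2 * \<kappa>)))) * (2 * t powr (- 1 - e))"
    using t e k z
    by (intro mult_mono W_gauss_le_powr log_weight_le_small log_weight_nonneg mult_nonneg_nonneg) auto
  also have "\<dots> = 8 * ((t powr (\<kappa> - 1 / 2) * t powr (- 1 - e)) * \<bar>z\<bar> powr (- (2 * \<kappa>)))"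
    by simp
  also have "t powr (\<kappa> - 1 / 2) * t powr (- 1 - e) = t powr (\<kappa> - 3 / 2 - e)"
    by (simp add: powr_add[symmetric] algebra_simps)
  also have "8 * (t powr (\<kappa> - 3 / 2 - e) * \<bar>z\<bar> powr (- (2 * \<kappa>))) \<le> 8 * (time_profile e t * \<bar>z\<bar> powr (- (2 * \<kappa>)))"
    using t k by (intro mult_left_mono mult_right_mono powr_le_time_profile_small) auto
  finally show ?thesis .
qed

lemma gauss_weight_le_large:
  assumes t: "1 \<le> t" and e: "0 < e" and k: "0 \<le> \<kappa>" "\<kappa> \<le> 1" "\<kappa> - 3 / 2 + e \<le> - 1 - e" and z: "z \<noteq> 0"
  shows "W_gauss t z * log_weight e t \<le> 8 * (time_profile e t * \<bar>z\<bar> powr (- (2 * \<kappa>)))"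
proof -
  have "W_gauss t z * log_weight e t
      \<le> (4 * (t powr (\<kappa> - 1 / 2) * \<bar>z\<bar> powr (- (2 * \<kappa>)))) * (2 * t powr (- 1 + e))"
    using t e k z
    by (intro mult_mono W_gauss_le_powr log_weight_le_large log_weight_nonneg mult_nonneg_nonneg) auto
  also have "\<dots> = 8 * ((t powr (\<kappa> - 1 / 2) * t powr (- 1 + e)) * \<bar>z\<bar> powr (- (2 * \<kappa>)))"
    by simp
  also have "t powr (\<kappa> - 1 / 2) * t powr (- 1 + e) = t powr (\<kappa> - 3 / 2 + e)"
    by (simp add: powr_add[symmetric] algebra_simps)
  also have "8 * (t powr (\<kappa> - 3 / 2 + e) * \<bar>z\<bar> powr (- (2 * \<kappa>))) \<le> 8 * (time_profile e t * \<bar>z\<bar> powr (- (2 * \<kappa>)))"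
    using t k by (intro mult_left_mono mult_right_mono powr_le_time_profile_large) auto
  finally show ?thesis .
qed

lemma gauss_weight_le_large0:
  assumes t: "1 \<le> t" and e: "0 < e" "e < 1 / 4"
  shows "W_gauss t z * log_weight e t \<le> 2 * time_profile e t"
proof -
  have "W_gauss t z \<le> t powr (- 1 / 2) * 1"
    using t by (intro W_gauss_le_uniform[THEN order_trans] mult_left_mono) auto
  then have "W_gauss t z * log_weight e t \<le> t powr (- 1 / 2) * (2 * t powr (- 1 + e))"
    using t e by (intro mult_mono log_weight_le_large log_weight_nonneg) auto
  also have "\<dots> = 2 * t powr (- 3 / 2 + e)"
    by (simp add: powr_add[symmetric])
  also have "\<dots> \<le> 2 * time_profile e t"
    using t e by (intro mult_left_mono powr_le_time_profile_large) auto
  finally show ?thesis .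
qed

text \<open>
  For short times a power \<open>1 / 2 + 2 e\<close> of the exponential is spent, just enough for integrability in
  time and little enough for \<open>\<bar>z\<bar> powr (- 1 - 4 * e)\<close> to become integrable after multiplication by
  \<open>\<bar>z\<bar> powr \<theta>\<close>.
\<close>

lemma gauss_weight_le_near:
  assumes t: "0 < t" and e: "0 < e" "e < 1 / 4" and z: "z \<noteq> 0" "\<bar>z\<bar> < 1"
  shows "W_gauss t z * log_weight e t \<le> 8 * (time_profile e t * \<bar>z\<bar> powr (- 1 - 4 * e))"
proof (cases "t < 1")
  case True
  have "- (2 * (1 / 2 + 2 * e)) = - 1 - 4 * e" by simp
  then show ?thesis
    \<comment> \<open>With this power of the distance the time exponent is \<open>(1 / 2 + 2 * e) - 3 / 2 - e = e - 1\<close>.\<close>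
    using gauss_weight_le_small[OF t True e(1), of "1 / 2 + 2 * e" z] z e by simp
next
  case False
  have "1 powr (- 1 - 4 * e) \<le> \<bar>z\<bar> powr (- 1 - 4 * e)"
    using z e by (intro powr_mono2') auto
  then have "2 * (time_profile e t * 1) \<le> 8 * (time_profile e t * \<bar>z\<bar> powr (- 1 - 4 * e))"
    using time_profile_nonneg[of e t] by (intro mult_mono) auto
  then show ?thesis
    using gauss_weight_le_large0[of t e z] False e by simp
qed

text \<open>
  The large times decide: they allow only the power \<open>1 / 2 - 2 e\<close>, hence a spatial decay slightly
  slower than \<open>1 / \<bar>z\<bar>\<close>. This is the decay of the brackets at infinity.
\<close>

lemma gauss_weight_le_far:
  assumes t: "0 < t" and e: "0 < e" "e < 1 / 4" and z: "1 \<le> \<bar>z\<bar>"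
  shows "W_gauss t z * log_weight e t \<le> 8 * (time_profile e t * \<bar>z\<bar> powr (- (1 - 4 * e)))"
proof (cases "t < 1")
  case True
  have "\<bar>z\<bar> powr (- 2) \<le> \<bar>z\<bar> powr (- (1 - 4 * e))"
    using z e by (intro powr_mono) auto
  then have "8 * (time_profile e t * \<bar>z\<bar> powr (- 2)) \<le> 8 * (time_profile e t * \<bar>z\<bar> powr (- (1 - 4 * e)))"
    using time_profile_nonneg[of e t] by (intro mult_left_mono) auto
  moreover have "W_gauss t z * log_weight e t \<le> 8 * (time_profile e t * \<bar>z\<bar> powr (- 2))"
    using gauss_weight_le_small[OF t True e(1), of 1 z] z e by auto
  ultimately show ?thesis by linarith
next
  case False
  have "- (2 * (1 / 2 - 2 * e)) = - (1 - 4 * e)" by simp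
  then show ?thesis
    \<comment> \<open>With this power of the distance the time exponent is \<open>(1 / 2 - 2 * e) - 3 / 2 + e = - 1 - e\<close>.\<close>
    using gauss_weight_le_large[OF _ e(1), of t "1 / 2 - 2 * e" z] z e False by simp
qed

lemma gauss_weight_le_far_small:
  assumes t: "0 < t" "t < 1" and e: "0 < e" "e < 1 / 4" and z: "d \<le> \<bar>z\<bar>" "0 < d"
  shows "W_gauss t z * log_weight e t \<le> 8 * (1 / d\<^sup>2 + 1) * (time_profile e t * (1 / (1 + z\<^sup>2)))"
proof -
  have z0: "z \<noteq> 0" using z by auto
  have d: "d\<^sup>2 \<le> z\<^sup>2" using power_mono[OF z(1), of 2] z(2) by simp
  then have "1 \<le> z\<^sup>2 / d\<^sup>2" using z by (simp add: le_divide_eq)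
  then have "1 + z\<^sup>2 \<le> (1 / d\<^sup>2 + 1) * z\<^sup>2" by (simp add: algebra_simps)
  then have "1 / z\<^sup>2 \<le> (1 / d\<^sup>2 + 1) * (1 / (1 + z\<^sup>2))"
    using z0 by (simp add: field_simps add_pos_nonneg)
  moreover have "\<bar>z\<bar> powr (- 2) = 1 / z\<^sup>2"
    using z0 by (simp add: powr_minus_divide)
  ultimately have "8 * (time_profile e t * \<bar>z\<bar> powr (- 2)) \<le> 8 * (time_profile e t * ((1 / d\<^sup>2 + 1) * (1 / (1 + z\<^sup>2))))"
    using time_profile_nonneg[of e t] by (intro mult_left_mono) auto
  then show ?thesis
    using gauss_weight_le_small[OF t e(1), of 1 z] z0 e by (simp add: mult_ac)
qed

text \<open>
  The additional factor \<open>t\<close>, which the relative error of the Bessel ratio supplies, makes the diagonal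
  integrable for short times.
\<close>

lemma gauss_time_weight_le_small:
  assumes t: "0 < t" "t < 1" and e: "0 < e" "e < 1 / 4"
  shows "W_gauss t z * (t * log_weight e t) \<le> 16 * (time_profile e t * (1 / (1 + z\<^sup>2)))"
proof -
  have tw: "t * log_weight e t \<le> 2 * t powr (- e)"
  proof -
    have "t * log_weight e t \<le> t * (2 * t powr (- 1 - e))"
      using t e by (intro mult_left_mono log_weight_le_small) auto
    also have "\<dots> = 2 * t powr (- e)" using t powr_add[of t 1 "- 1 - e"] by simp
    finally show ?thesis .
  qed
  have g: "W_gauss t z \<le> 8 * (t powr (- 1 / 2) * (1 / (1 + z\<^sup>2)))"
  proof (cases "\<bar>z\<bar> < 1")
    case True
    then have "z\<^sup>2 < 1" by (simp add: abs_square_less_1)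
    then have "1 \<le> 8 * (1 / (1 + z\<^sup>2))"
      by (simp add: le_divide_eq add_pos_nonneg)
    then have "t powr (- 1 / 2) * 1 \<le> t powr (- 1 / 2) * (8 * (1 / (1 + z\<^sup>2)))"
      by (intro mult_left_mono) auto
    moreover have "W_gauss t z \<le> t powr (- 1 / 2) * 1"
      using t by (intro W_gauss_le_uniform[THEN order_trans] mult_left_mono) auto
    ultimately have "W_gauss t z \<le> t powr (- 1 / 2) * (8 * (1 / (1 + z\<^sup>2)))" by linarith
    then show ?thesis by (simp add: mult_ac)
  next
    case False
    then have "1 \<le> z\<^sup>2" using abs_square_less_1[of z] by linarith
    then have "1 / z\<^sup>2 \<le> 2 / (1 + z\<^sup>2)"
      using order.strict_trans2[OF zero_less_one \<open>1 \<le> z\<^sup>2\<close>]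
      by (simp add: field_simps add_pos_nonneg)
    moreover have "t powr (1 / 2) \<le> t powr (- 1 / 2)" using t by (intro powr_mono') auto
    ultimately have "4 * (t powr (1 / 2) * (1 / z\<^sup>2)) \<le> 4 * (t powr (- 1 / 2) * (2 / (1 + z\<^sup>2)))"
      by (intro mult_left_mono mult_mono) auto
    moreover have "\<bar>z\<bar> powr (- 2) = 1 / z\<^sup>2"
      using False by (simp add: powr_minus_divide)
    moreover have "W_gauss t z \<le> 4 * (t powr (1 / 2) * \<bar>z\<bar> powr (- 2))"
      using W_gauss_le_powr[OF t(1), of 1 z] False by auto
    ultimately have "W_gauss t z \<le> 4 * (t powr (- 1 / 2) * (2 / (1 + z\<^sup>2)))"
      by simp
    then show ?thesis by simp
  qed
  have "W_gauss t z * (t * log_weight e t) \<le> 8 * (t powr (- 1 / 2) * (1 / (1 + z\<^sup>2))) * (2 * t powr (- e))"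
    using t by (intro mult_mono g tw mult_nonneg_nonneg log_weight_nonneg) (auto intro: add_nonneg_nonneg)
  also have "\<dots> = 16 * ((t powr (- 1 / 2) * t powr (- e)) * (1 / (1 + z\<^sup>2)))"
    by simp
  also have "t powr (- 1 / 2) * t powr (- e) = t powr (- 1 / 2 - e)"
    by (simp add: powr_add[symmetric])
  also have "16 * (t powr (- 1 / 2 - e) * (1 / (1 + z\<^sup>2))) \<le> 16 * (time_profile e t * (1 / (1 + z\<^sup>2)))"
    using t e by (intro mult_left_mono mult_right_mono powr_le_time_profile_small) auto
  finally show ?thesis .
qed

lemma W_bessel_eq_ratio:
  assumes "0 < x" "0 < y" "0 < t"
  shows "W_bessel l t x y = bessel_ratio l (x * y / (2 * t)) * W_gauss t (x - y)"
proof -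
  have "sqrt (2 * pi * (x * y / (2 * t))) / (2 * sqrt (pi * t)) = sqrt (x * y) / (2 * t)"
    using assms by (simp add: real_sqrt_mult real_sqrt_divide field_simps)
  moreover have "exp (- (x * y / (2 * t))) * exp (- (x - y)\<^sup>2 / (4 * t)) = exp (- (x\<^sup>2 + y\<^sup>2) / (4 * t))"
  proof -
    have "- (x * y / (2 * t)) + - (x - y)\<^sup>2 / (4 * t) = - (x\<^sup>2 + y\<^sup>2) / (4 * t)"
      using assms by (simp add: field_simps power2_eq_square)
    then show ?thesis by (simp add: exp_add[symmetric])
  qed
  moreover have "bessel_ratio l (x * y / (2 * t)) * W_gauss t (x - y) =
     (sqrt (2 * pi * (x * y / (2 * t))) / (2 * sqrt (pi * t))) * bessel_I l (x * y / (2 * t))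
     * (exp (- (x * y / (2 * t))) * exp (- (x - y)\<^sup>2 / (4 * t)))"
    unfolding bessel_ratio_def W_gauss_def by simp
  ultimately show ?thesis
    by (simp add: W_bessel_def)
qed

lemma W_bessel_nonneg:
  assumes "- 1 / 2 < l" "0 < x" "0 < y" "0 < t"
  shows "0 \<le> W_bessel l t x y"
proof -
  have z: "0 < x * y / (2 * t)" using assms by simp
  have "0 \<le> bessel_I l (x * y / (2 * t))"
    unfolding bessel_I_Poisson[OF assms(1) z] using assms(1)
    by (intro mult_nonneg_nonneg divide_nonneg_nonneg Bochner_Integration.integral_nonneg)
       (auto simp: beta_kernel_nonneg intro!: less_imp_le[OF Gamma_real_pos])
  then show ?thesis using assms by (simp add: W_bessel_def)
qed

lemma borel_measurable_bessel_I [measurable]: "bessel_I l \<in> borel_measurable borel"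
  unfolding bessel_I_def by measurable

section \<open>Pointwise domination of the bracket\<close>

text \<open>
  The data extracted from a compactly supported \<open>f\<close> with local Hoelder exponent \<open>\<theta>\<close>, together with
  the amount \<open>e\<close> by which all exponents are perturbed. Here \<open>f\<close> is extended by 0 to the whole line.
\<close>

locale bessel_log_setting =
  fixes l \<theta> e a b M L :: real and f :: "real \<Rightarrow> complex"
  assumes l: "- 1 / 2 < l"
    and e: "0 < e" "4 * e < \<theta>" and \<theta>: "\<theta> \<le> 1"
    and f_measurable [measurable]: "f \<in> borel_measurable borel"
    and a: "0 < a" and b: "0 < b"
    and f_support: "\<And>x. x \<notin> {a..b} \<Longrightarrow> f x = 0"
    and f_bound: "\<And>x. norm (f x) \<le> M"
    and L: "0 \<le> L"
    and f_holder: "\<And>x y. 0 < x \<Longrightarrow> 0 < y \<Longrightarrow> \<bar>x - y\<bar> < 1 \<Longrightarrow> norm (f x - f y) \<le> L * \<bar>x - y\<bar> powr \<theta>"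
begin

lemma e_less: "e < 1 / 4"
  using e \<theta> by simp

lemma M_nonneg: "0 \<le> M"
  using f_bound[of 0] norm_ge_zero[of "f 0"] by linarith

definition \<beta> :: real where "\<beta> = 1 - 4 * e"

lemma \<beta>: "0 < \<beta>" "\<beta> < 1"
  using e e_less by (auto simp: \<beta>_def)

text \<open>
  The three terms dominate, in this order, the singularity on the diagonal after the Hoelder
  condition has been used, the contributions with factor \<open>f x\<close>, and the contributions with factor
  \<open>f y\<close> away from the diagonal. The integral over \<open>y\<close> is the same for all \<open>x\<close>; the decay in \<open>x\<close> is
  carried by a separate factor.
\<close>

definition space_profile :: "real \<Rightarrow> real \<Rightarrow> real"
  where "space_profile x y =
    indicator {- 1<..<1} (x - y) * \<bar>x - y\<bar> powr (\<theta> - 4 * e - 1) + 1 / (1 + (x - y)\<^sup>2) + indicator {a..b} y"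

lemma space_profile_ge:
  "\<bar>x - y\<bar> < 1 \<Longrightarrow> \<bar>x - y\<bar> powr (\<theta> - 4 * e - 1) \<le> space_profile x y"
  "1 / (1 + (x - y)\<^sup>2) \<le> space_profile x y"
  "y \<in> {a..b} \<Longrightarrow> 1 \<le> space_profile x y"
  "0 \<le> space_profile x y"
proof -
  have *: "0 \<le> indicator {- 1<..<1} (x - y) * \<bar>x - y\<bar> powr (\<theta> - 4 * e - 1)" "0 \<le> 1 / (1 + (x - y)\<^sup>2)"
    "0 \<le> (indicator {a..b} y :: real)"
    by (auto simp: add_nonneg_nonneg)
  show "1 / (1 + (x - y)\<^sup>2) \<le> space_profile x y" "0 \<le> space_profile x y"
    using * unfolding space_profile_def by linarith+
  show "1 \<le> space_profile x y" if "y \<in> {a..b}"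
    using * that unfolding space_profile_def by simp
  show "\<bar>x - y\<bar> powr (\<theta> - 4 * e - 1) \<le> space_profile x y" if "\<bar>x - y\<bar> < 1"
  proof -
    have "indicator {- 1<..<1} (x - y) = (1::real)" using that by (auto simp: abs_less_iff)
    then show ?thesis using * unfolding space_profile_def by (simp only: mult_1_left)
  qed
qed

text \<open>
  Where \<open>f x\<close> or the near part of the kernel does not vanish, \<open>x\<close> is bounded, so that the decay factor
  may be inserted at the price of a constant.
\<close>

lemma decay_ge_1:
  assumes "0 < x" "x \<le> b + 1"
  shows "1 \<le> (2 + b) * (1 + x) powr (- \<beta>)"
proof -
  have "(1 + x) powr \<beta> \<le> (1 + x) powr 1"
    using assms \<beta> by (intro powr_mono) auto
  also have "\<dots> \<le> 2 + b" using assms by simp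
  finally show ?thesis using assms
    by (simp add: powr_minus_divide le_divide_eq)
qed

text \<open>
  Since \<open>y\<close> stays below \<open>b\<close>, a distance of at least 1 is comparable to \<open>1 + x\<close>.
\<close>

lemma decay_far:
  assumes "0 < x" "0 < y" "y \<le> b" "1 \<le> \<bar>x - y\<bar>"
  shows "\<bar>x - y\<bar> powr (- \<beta>) \<le> (2 + b) * (1 + x) powr (- \<beta>)"
proof -
  define r where "r = \<bar>x - y\<bar>"
  have r: "1 \<le> r" "x \<le> y + r" using assms by (auto simp: r_def)
  have "b * 1 \<le> b * r" using b r by (intro mult_left_mono) auto
  then have "1 + x \<le> (2 + b) * r"
    using r assms(3) unfolding distrib_right by linarith
  then have "1 + x \<le> (2 + b) * \<bar>x - y\<bar>" by (simp only: r_def)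
  then have "((2 + b) * \<bar>x - y\<bar>) powr (- \<beta>) \<le> (1 + x) powr (- \<beta>)"
    using assms \<beta> by (intro powr_mono2') auto
  then have "(2 + b) powr \<beta> * ((2 + b) * \<bar>x - y\<bar>) powr (- \<beta>) \<le> (2 + b) powr \<beta> * (1 + x) powr (- \<beta>)"
    by (intro mult_left_mono) auto
  also have "(2 + b) powr \<beta> * ((2 + b) * \<bar>x - y\<bar>) powr (- \<beta>) = \<bar>x - y\<bar> powr (- \<beta>)"
    using b by (simp add: powr_mult powr_minus_divide)
  also have "(2 + b) powr \<beta> * (1 + x) powr (- \<beta>) \<le> (2 + b) powr 1 * (1 + x) powr (- \<beta>)"
    using b \<beta> by (intro mult_right_mono powr_mono) auto
  finally show ?thesis using b by simp
qed

definition W :: "real \<Rightarrow> real \<Rightarrow> real \<Rightarrow> real" where "W x y t = W_bessel l t x y"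

definition G :: "real \<Rightarrow> real \<Rightarrow> real \<Rightarrow> real" where "G x y t = W_gauss t (x - y)"

definition profile :: "real \<Rightarrow> real \<Rightarrow> real \<Rightarrow> real"
  where "profile x y t = time_profile e t * space_profile x y * (1 + x) powr (- \<beta>)"

lemma profile_nonneg: "0 \<le> profile x y t"
  by (simp add: profile_def time_profile_nonneg space_profile_ge)

text \<open>
  The way all kernel bounds are concluded: \<open>s\<close> is the spatial factor obtained from the Gaussian, and
  \<open>r\<close> is what remains of it to be converted into decay in \<open>x\<close>.
\<close>

lemma profileI:
  assumes "0 \<le> c1" "A \<le> c1 * (time_profile e t * s)" "s \<le> space_profile x y * r"
    "0 \<le> r" "r \<le> c2 * (1 + x) powr (- \<beta>)"
  shows "A \<le> (c1 * c2) * profile x y t"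
proof -
  have "s \<le> space_profile x y * (c2 * (1 + x) powr (- \<beta>))"
    using assms(3,5) mult_left_mono[OF assms(5) space_profile_ge(4)[of x y]] by linarith
  then have "c1 * (time_profile e t * s) \<le> c1 * (time_profile e t * (space_profile x y * (c2 * (1 + x) powr (- \<beta>))))"
    using assms time_profile_nonneg by (intro mult_left_mono) auto
  then show ?thesis using assms(2) by (simp add: profile_def mult_ac)
qed

text \<open>
  The integrands of the four integrals in the bracket, with the domains of integration encoded by
  indicators and without the weight.
\<close>

definition compensated_kernel :: "real \<Rightarrow> real \<Rightarrow> real \<Rightarrow> complex"
  where "compensated_kernel x y t = (indicator {0<..} y * indicator {0<..} t * W x y t) *\<^sub>R
    (f y - indicator (Bpos x 1) y * f x)"

definition far_kernel :: "real \<Rightarrow> real \<Rightarrow> real \<Rightarrow> complex"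
  where "far_kernel x y t = (indicator ({0<..} - Bpos x 1) y * indicator {0<..<1} t * W x y t) *\<^sub>R f x"

definition near_kernel :: "real \<Rightarrow> real \<Rightarrow> real \<Rightarrow> complex"
  where "near_kernel x y t = (indicator (Bpos x 1) y * indicator {1<..} t * W x y t) *\<^sub>R f x"

definition difference_kernel :: "real \<Rightarrow> real \<Rightarrow> real \<Rightarrow> complex"
  where "difference_kernel x y t =
    (indicator {0<..} y * indicator {0<..<1} t * (W x y t - G x y t)) *\<^sub>R f x"

lemma W_le_G:
  obtains C where "1 \<le> C"
    "\<And>x y t. 0 < x \<Longrightarrow> 0 < y \<Longrightarrow> 0 < t \<Longrightarrow> 0 \<le> W x y t"
    "\<And>x y t. 0 < x \<Longrightarrow> 0 < y \<Longrightarrow> 0 < t \<Longrightarrow> W x y t \<le> C * G x y t"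
    "\<And>x y t. 0 < x \<Longrightarrow> 0 < y \<Longrightarrow> 0 < t \<Longrightarrow> \<bar>W x y t - G x y t\<bar> \<le> C * G x y t"
    "\<And>x y t. 0 < x \<Longrightarrow> 0 < y \<Longrightarrow> 0 < t \<Longrightarrow> \<bar>W x y t - G x y t\<bar> \<le> C * (2 * t / (x * y)) * G x y t"
proof -
  obtain C where C: "0 < C" "\<And>z. 0 < z \<Longrightarrow> \<bar>bessel_ratio l z - 1\<bar> \<le> C"
    "\<And>z. 0 < z \<Longrightarrow> \<bar>bessel_ratio l z - 1\<bar> \<le> C / z"
    by (rule bessel_ratio_asymptotics[OF l]) (rule that; assumption)
  have diff: "\<bar>W x y t - G x y t\<bar> = \<bar>bessel_ratio l (x * y / (2 * t)) - 1\<bar> * G x y t"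
    and G0: "0 \<le> G x y t" and z0: "0 < x * y / (2 * t)"
    if "0 < x" "0 < y" "0 < t" for x y t
  proof -
    show G0: "0 \<le> G x y t" using that by (simp add: G_def W_gauss_nonneg)
    have "W x y t - G x y t = (bessel_ratio l (x * y / (2 * t)) - 1) * G x y t"
      using that by (simp add: W_def G_def W_bessel_eq_ratio algebra_simps)
    then show "\<bar>W x y t - G x y t\<bar> = \<bar>bessel_ratio l (x * y / (2 * t)) - 1\<bar> * G x y t"
      using G0 by (simp add: abs_mult)
    show "0 < x * y / (2 * t)" using that by simp
  qed
  have d1: "\<bar>W x y t - G x y t\<bar> \<le> C * G x y t" if "0 < x" "0 < y" "0 < t" for x y t
    unfolding diff[OF that] using G0[OF that] C(2)[OF z0[OF that]] by (intro mult_right_mono)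
  show ?thesis
  proof (rule that[of "C + 1"])
    fix x y t :: real assume xyt: "0 < x" "0 < y" "0 < t"
    show "0 \<le> W x y t" using l xyt by (simp add: W_def W_bessel_nonneg)
    show "W x y t \<le> (C + 1) * G x y t"
      using d1[OF xyt] unfolding distrib_right mult_1_left by linarith
    show "\<bar>W x y t - G x y t\<bar> \<le> (C + 1) * G x y t"
      using d1[OF xyt] G0[OF xyt] unfolding distrib_right mult_1_left by linarith
    have "\<bar>bessel_ratio l (x * y / (2 * t)) - 1\<bar> \<le> C * (2 * t / (x * y))"
      using C(3)[OF z0[OF xyt]] by simp
    also have "\<dots> \<le> (C + 1) * (2 * t / (x * y))"
      using xyt by (intro mult_right_mono) auto
    finally show "\<bar>W x y t - G x y t\<bar> \<le> (C + 1) * (2 * t / (x * y)) * G x y t"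
      unfolding diff[OF xyt] using G0[OF xyt] by (intro mult_right_mono)
  qed (use C in auto)
qed

text \<open>
  Near the diagonal the Hoelder condition turns \<open>\<bar>x - y\<bar> powr (- 1 - 4 * e)\<close> into an integrable
  singularity, and \<open>x\<close> is at most \<open>b + 1\<close>. Away from it only \<open>f y\<close> remains, which
  confines \<open>y\<close> and lets the distance measure the size of \<open>x\<close>.
\<close>

lemma compensated_kernel_bound:
  "\<exists>C\<ge>0. \<forall>x>0. \<forall>y>0. \<forall>t>0. norm (compensated_kernel x y t) * log_weight e t \<le> C * profile x y t"
proof -
  obtain C where C: "1 \<le> C"
    "\<And>x y t. 0 < x \<Longrightarrow> 0 < y \<Longrightarrow> 0 < t \<Longrightarrow> 0 \<le> W x y t"
    "\<And>x y t. 0 < x \<Longrightarrow> 0 < y \<Longrightarrow> 0 < t \<Longrightarrow> W x y t \<le> C * G x y t"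
    by (rule W_le_G) (rule that; assumption)
  have "norm (compensated_kernel x y t) * log_weight e t \<le> (8 * C * (L + M) * (2 + b)) * profile x y t"
    if x: "0 < x" and y: "0 < y" and t: "0 < t" for x y t
  proof -
    define D where "D = norm (f y - indicator (Bpos x 1) y * f x)"
    have norm: "norm (compensated_kernel x y t) = W x y t * D"
      using C(2)[OF x y t] y t by (simp add: compensated_kernel_def D_def)
    have w0: "0 \<le> log_weight e t" using t by (rule log_weight_nonneg)
    have "norm (compensated_kernel x y t) * log_weight e t \<le> (C * G x y t * D) * log_weight e t"
      unfolding norm using C(3)[OF x y t] w0 by (intro mult_right_mono) (auto simp: D_def)
    also have "\<dots> = C * D * (G x y t * log_weight e t)" by simp
    finally have le: "norm (compensated_kernel x y t) * log_weight e t \<le> C * D * (G x y t * log_weight e t)" .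
    consider "D = 0" | "D \<noteq> 0" "\<bar>x - y\<bar> < 1" | "D \<noteq> 0" "1 \<le> \<bar>x - y\<bar>" by linarith
    then show ?thesis
    proof cases
      case 1
      have "0 \<le> (8 * C * (L + M) * (2 + b)) * profile x y t"
        using C(1) L M_nonneg b by (intro mult_nonneg_nonneg profile_nonneg) auto
      then show ?thesis using le 1 by simp
    next
      case 2
      then have B: "y \<in> Bpos x 1" using y by (auto simp: Bpos_def abs_less_iff)
      then have D: "D = norm (f y - f x)" by (simp add: D_def)
      have ne: "x - y \<noteq> 0" using 2(1) by (auto simp: D)
      have xb: "x \<le> b + 1"
      proof (rule ccontr)
        assume "\<not> x \<le> b + 1"
        then have "f x = 0" "f y = 0" using 2(2) by (auto intro!: f_support)
        then show False using 2(1) by (simp add: D)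
      qed
      have "D \<le> L * \<bar>x - y\<bar> powr \<theta>"
        using f_holder[OF x y 2(2)] by (simp add: D norm_minus_commute)
      then have D_le: "C * D \<le> C * (L * \<bar>x - y\<bar> powr \<theta>)"
        using C(1) by (intro mult_left_mono) auto
      have G_le: "G x y t * log_weight e t \<le> 8 * (time_profile e t * \<bar>x - y\<bar> powr (- 1 - 4 * e))"
        using gauss_weight_le_near[OF t e(1) e_less ne 2(2)] by (simp add: G_def)
      have "C * D * (G x y t * log_weight e t)
        \<le> C * (L * \<bar>x - y\<bar> powr \<theta>) * (8 * (time_profile e t * \<bar>x - y\<bar> powr (- 1 - 4 * e)))"
        using C(1) L w0 t by (intro mult_mono[OF D_le G_le]) (auto simp: G_def W_gauss_nonneg)
      also have "\<dots> = (8 * C * L) * (time_profile e t * (\<bar>x - y\<bar> powr \<theta> * \<bar>x - y\<bar> powr (- 1 - 4 * e)))"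
        by simp
      also have "\<bar>x - y\<bar> powr \<theta> * \<bar>x - y\<bar> powr (- 1 - 4 * e) = \<bar>x - y\<bar> powr (\<theta> - 4 * e - 1)"
        by (simp add: powr_add[symmetric] algebra_simps)
      finally have "C * D * (G x y t * log_weight e t) \<le> (8 * C * L) * (time_profile e t * \<bar>x - y\<bar> powr (\<theta> - 4 * e - 1))" .
      then have "C * D * (G x y t * log_weight e t) \<le> ((8 * C * L) * (2 + b)) * profile x y t"
        using C(1) L decay_ge_1[OF x xb] space_profile_ge(1)[OF 2(2)]
        by (intro profileI[where r=1]) auto
      also have "\<dots> \<le> (8 * C * (L + M) * (2 + b)) * profile x y t"
        using C(1) L M_nonneg b profile_nonneg by (intro mult_right_mono mult_left_mono) auto
      finally show ?thesis using le by simp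
    next
      case 3
      then have "y \<notin> Bpos x 1" by (auto simp: Bpos_def)
      then have D: "D = norm (f y)" by (simp add: D_def)
      then have yab: "y \<in> {a..b}" using 3(1) f_support[of y] by auto
      have "D \<le> M" using f_bound D by simp
      then have D_le: "C * D \<le> C * M"
        using C(1) by (intro mult_left_mono) auto
      have G_le: "G x y t * log_weight e t \<le> 8 * (time_profile e t * \<bar>x - y\<bar> powr (- (1 - 4 * e)))"
        using gauss_weight_le_far[OF t e(1) e_less 3(2)] by (simp add: G_def)
      have "C * D * (G x y t * log_weight e t)
        \<le> C * M * (8 * (time_profile e t * \<bar>x - y\<bar> powr (- (1 - 4 * e))))"
        using C(1) M_nonneg w0 t by (intro mult_mono[OF D_le G_le]) (auto simp: G_def W_gauss_nonneg)
      also have "\<dots> = (8 * C * M) * (time_profile e t * \<bar>x - y\<bar> powr (- \<beta>))"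
        by (simp add: \<beta>_def)
      finally have "C * D * (G x y t * log_weight e t) \<le> (8 * C * M) * (time_profile e t * \<bar>x - y\<bar> powr (- \<beta>))" .
      moreover have "\<bar>x - y\<bar> powr (- \<beta>) \<le> space_profile x y * \<bar>x - y\<bar> powr (- \<beta>)"
        using space_profile_ge(3)[OF yab, of x] by (simp add: mult_le_cancel_right1)
      ultimately have "C * D * (G x y t * log_weight e t) \<le> ((8 * C * M) * (2 + b)) * profile x y t"
        using C(1) M_nonneg decay_far[OF x y _ 3(2)] yab
        by (intro profileI[where r="\<bar>x - y\<bar> powr (- \<beta>)"]) auto
      also have "\<dots> \<le> (8 * C * (L + M) * (2 + b)) * profile x y t"
        using C(1) L M_nonneg b profile_nonneg by (intro mult_right_mono mult_left_mono) auto
      finally show ?thesis using le by simp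
    qed
  qed
  moreover have "0 \<le> 8 * C * (L + M) * (2 + b)" using C(1) L M_nonneg b by auto
  ultimately show ?thesis by blast
qed

lemma far_kernel_bound:
  "\<exists>C\<ge>0. \<forall>x>0. \<forall>y>0. \<forall>t>0. norm (far_kernel x y t) * log_weight e t \<le> C * profile x y t"
proof -
  obtain C where C: "1 \<le> C"
    "\<And>x y t. 0 < x \<Longrightarrow> 0 < y \<Longrightarrow> 0 < t \<Longrightarrow> 0 \<le> W x y t"
    "\<And>x y t. 0 < x \<Longrightarrow> 0 < y \<Longrightarrow> 0 < t \<Longrightarrow> W x y t \<le> C * G x y t"
    by (rule W_le_G) (rule that; assumption)
  have "norm (far_kernel x y t) * log_weight e t \<le> (16 * C * M * (2 + b)) * profile x y t"
    if x: "0 < x" and y: "0 < y" and t: "0 < t" for x y t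
  proof (cases "far_kernel x y t = 0")
    case True
    have "0 \<le> (16 * C * M * (2 + b)) * profile x y t"
      using C(1) M_nonneg b by (intro mult_nonneg_nonneg profile_nonneg) auto
    then show ?thesis using True by simp
  next
    case False
    then have t1: "t < 1" and fx: "f x \<noteq> 0" and r: "1 \<le> \<bar>x - y\<bar>"
      by (auto simp: far_kernel_def indicator_def Bpos_def split: if_splits)
    have xb: "x \<le> b + 1" using fx f_support[of x] by fastforce
    have w0: "0 \<le> log_weight e t" using t by (rule log_weight_nonneg)
    have "norm (far_kernel x y t) \<le> W x y t * norm (f x)"
      using C(2)[OF x y t] by (auto simp: far_kernel_def indicator_def)
    also have "\<dots> \<le> (C * G x y t) * M"
      using C(1) C(3)[OF x y t] C(2)[OF x y t] f_bound by (intro mult_mono) auto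
    finally have "norm (far_kernel x y t) * log_weight e t \<le> (C * G x y t) * M * log_weight e t"
      using w0 by (intro mult_right_mono)
    also have "\<dots> = C * M * (G x y t * log_weight e t)" by simp
    also have "\<dots> \<le> C * M * (16 * (time_profile e t * (1 / (1 + (x - y)\<^sup>2))))"
      using gauss_weight_le_far_small[OF t t1 e(1) e_less r] C(1) M_nonneg
      by (intro mult_left_mono) (auto simp: G_def)
    also have "\<dots> = (16 * C * M) * (time_profile e t * (1 / (1 + (x - y)\<^sup>2)))" by simp
    finally show ?thesis
      using C(1) M_nonneg decay_ge_1[OF x xb] space_profile_ge(2)[of x y]
      by (intro profileI[where r=1]) auto
  qed
  moreover have "0 \<le> 16 * C * M * (2 + b)" using C(1) M_nonneg b by auto
  ultimately show ?thesis by blast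
qed

lemma near_kernel_bound:
  "\<exists>C\<ge>0. \<forall>x>0. \<forall>y>0. \<forall>t>0. norm (near_kernel x y t) * log_weight e t \<le> C * profile x y t"
proof -
  obtain C where C: "1 \<le> C"
    "\<And>x y t. 0 < x \<Longrightarrow> 0 < y \<Longrightarrow> 0 < t \<Longrightarrow> 0 \<le> W x y t"
    "\<And>x y t. 0 < x \<Longrightarrow> 0 < y \<Longrightarrow> 0 < t \<Longrightarrow> W x y t \<le> C * G x y t"
    by (rule W_le_G) (rule that; assumption)
  have "norm (near_kernel x y t) * log_weight e t \<le> (4 * C * M * (2 + b)) * profile x y t"
    if x: "0 < x" and y: "0 < y" and t: "0 < t" for x y t
  proof (cases "near_kernel x y t = 0")
    case True
    have "0 \<le> (4 * C * M * (2 + b)) * profile x y t"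
      using C(1) M_nonneg b by (intro mult_nonneg_nonneg profile_nonneg) auto
    then show ?thesis using True by simp
  next
    case False
    then have t1: "1 \<le> t" and fx: "f x \<noteq> 0" and r: "\<bar>x - y\<bar> < 1"
      by (auto simp: near_kernel_def indicator_def Bpos_def split: if_splits)
    have xb: "x \<le> b + 1" using fx f_support[of x] by fastforce
    have w0: "0 \<le> log_weight e t" using t by (rule log_weight_nonneg)
    have "norm (near_kernel x y t) \<le> W x y t * norm (f x)"
      using C(2)[OF x y t] by (auto simp: near_kernel_def indicator_def)
    also have "\<dots> \<le> (C * G x y t) * M"
      using C(1) C(3)[OF x y t] C(2)[OF x y t] f_bound by (intro mult_mono) auto
    finally have "norm (near_kernel x y t) * log_weight e t \<le> (C * G x y t) * M * log_weight e t"
      using w0 by (intro mult_right_mono)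
    also have "\<dots> = C * M * (G x y t * log_weight e t)" by simp
    also have "\<dots> \<le> C * M * (2 * time_profile e t)"
      using gauss_weight_le_large0[OF t1 e(1) e_less] C(1) M_nonneg
      by (intro mult_left_mono) (auto simp: G_def)
    also have "\<dots> \<le> (4 * C * M) * (time_profile e t * (1 / (1 + (x - y)\<^sup>2)))"
    proof -
      have "(x - y)\<^sup>2 < 1" using r by (simp add: abs_square_less_1)
      then have "1 \<le> 2 * (1 / (1 + (x - y)\<^sup>2))"
        by (simp add: le_divide_eq add_pos_nonneg)
      then have "(2 * C * M * time_profile e t) * 1 \<le> (2 * C * M * time_profile e t) * (2 * (1 / (1 + (x - y)\<^sup>2)))"
        using C(1) M_nonneg time_profile_nonneg[of e t] by (intro mult_left_mono) auto
      then show ?thesis by (simp add: mult_ac)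
    qed
    finally show ?thesis
      using C(1) M_nonneg decay_ge_1[OF x xb] space_profile_ge(2)[of x y]
      by (intro profileI[where r=1]) auto
  qed
  moreover have "0 \<le> 4 * C * M * (2 + b)" using C(1) M_nonneg b by auto
  ultimately show ?thesis by blast
qed

text \<open>
  Here \<open>f x\<close> confines \<open>x\<close> to \<open>[a, b]\<close>. If \<open>y \<le> x / 2\<close>, then \<open>\<bar>x - y\<bar> \<ge> a / 2\<close>
  and the Bessel and Gaussian kernels are each small for short times. If \<open>y > x / 2\<close>, then \<open>x y\<close> is
  bounded below and the asymptotics of the Bessel ratio give a relative error of order \<open>t\<close>.
\<close>

lemma difference_kernel_bound:
  "\<exists>C\<ge>0. \<forall>x>0. \<forall>y>0. \<forall>t>0. norm (difference_kernel x y t) * log_weight e t \<le> C * profile x y t"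
proof -
  obtain C where C: "1 \<le> C"
    "\<And>x y t. 0 < x \<Longrightarrow> 0 < y \<Longrightarrow> 0 < t \<Longrightarrow> \<bar>W x y t - G x y t\<bar> \<le> C * G x y t"
    "\<And>x y t. 0 < x \<Longrightarrow> 0 < y \<Longrightarrow> 0 < t \<Longrightarrow> \<bar>W x y t - G x y t\<bar> \<le> C * (2 * t / (x * y)) * G x y t"
    by (rule W_le_G) (rule that; assumption)
  define K where "K = 8 * (1 / (a / 2)\<^sup>2 + 1) + 16 * (4 / a\<^sup>2)"
  have K: "0 \<le> K" using a by (simp add: K_def)
  have "norm (difference_kernel x y t) * log_weight e t \<le> ((C * M * K) * (2 + b)) * profile x y t"
    if x: "0 < x" and y: "0 < y" and t: "0 < t" for x y t
  proof (cases "difference_kernel x y t = 0")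
    case True
    have "0 \<le> ((C * M * K) * (2 + b)) * profile x y t"
      using C(1) M_nonneg b K by (intro mult_nonneg_nonneg profile_nonneg) auto
    then show ?thesis using True by simp
  next
    case False
    then have t1: "t < 1" and fx: "f x \<noteq> 0"
      by (auto simp: difference_kernel_def indicator_def split: if_splits)
    have xb: "x \<le> b + 1" and xa: "a \<le> x" using fx f_support[of x] by fastforce+
    have w0: "0 \<le> log_weight e t" using t by (rule log_weight_nonneg)
    have G0: "0 \<le> G x y t" using t by (simp add: G_def W_gauss_nonneg)
    have d: "\<bar>W x y t - G x y t\<bar> * log_weight e t \<le> (C * K) * (time_profile e t * (1 / (1 + (x - y)\<^sup>2)))"
    proof (cases "y \<le> x / 2")
      case True
      have r: "a / 2 \<le> \<bar>x - y\<bar>" using True xa by linarith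
      have "\<bar>W x y t - G x y t\<bar> * log_weight e t \<le> C * (G x y t * log_weight e t)"
        using mult_right_mono[OF C(2)[OF x y t] w0] by (simp add: mult_ac)
      also have "\<dots> \<le> C * (8 * (1 / (a / 2)\<^sup>2 + 1) * (time_profile e t * (1 / (1 + (x - y)\<^sup>2))))"
        using gauss_weight_le_far_small[OF t t1 e(1) e_less r] C(1) a
        by (intro mult_left_mono) (auto simp: G_def)
      also have "\<dots> \<le> C * (K * (time_profile e t * (1 / (1 + (x - y)\<^sup>2))))"
        using C(1) time_profile_nonneg[of e t]
        by (intro mult_left_mono mult_right_mono) (auto simp: K_def add_nonneg_nonneg)
      finally show ?thesis by simp
    next
      case False
      have "a * a / 2 \<le> x * y"
        using False xa a mult_mono[of a x "a / 2" y] by simp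
      then have "2 * t / (x * y) \<le> 2 * t / (a * a / 2)"
        using a t x y by (intro divide_left_mono) auto
      also have "\<dots> = 4 / a\<^sup>2 * t" by (simp add: power2_eq_square)
      finally have "C * (2 * t / (x * y)) * G x y t \<le> C * (4 / a\<^sup>2 * t) * G x y t"
        using C(1) G0 by (intro mult_right_mono mult_left_mono) auto
      then have "\<bar>W x y t - G x y t\<bar> \<le> C * (4 / a\<^sup>2 * t) * G x y t"
        using C(3)[OF x y t] by linarith
      then have "\<bar>W x y t - G x y t\<bar> * log_weight e t \<le> C * (4 / a\<^sup>2 * t) * G x y t * log_weight e t"
        using w0 by (intro mult_right_mono)
      also have "\<dots> = C * (4 / a\<^sup>2 * (G x y t * (t * log_weight e t)))" by simp
      also have "\<dots> \<le> C * (4 / a\<^sup>2 * (16 * (time_profile e t * (1 / (1 + (x - y)\<^sup>2)))))"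
        using gauss_time_weight_le_small[OF t t1 e(1) e_less, of "x - y"] C(1)
        by (intro mult_left_mono) (auto simp: G_def)
      also have "\<dots> = C * (16 * (4 / a\<^sup>2) * (time_profile e t * (1 / (1 + (x - y)\<^sup>2))))"
        by simp
      also have "\<dots> \<le> C * (K * (time_profile e t * (1 / (1 + (x - y)\<^sup>2))))"
        using C(1) time_profile_nonneg[of e t]
        by (intro mult_left_mono mult_right_mono) (auto simp: K_def add_nonneg_nonneg)
      finally show ?thesis by simp
    qed
    have "norm (difference_kernel x y t) * log_weight e t = \<bar>W x y t - G x y t\<bar> * log_weight e t * norm (f x)"
      using y t t1 by (simp add: difference_kernel_def)
    also have "\<dots> \<le> (C * K) * (time_profile e t * (1 / (1 + (x - y)\<^sup>2))) * M"
      using C(1) K time_profile_nonneg[of e t]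
      by (intro mult_mono[OF d f_bound]) (auto simp: add_nonneg_nonneg)
    also have "\<dots> = (C * M * K) * (time_profile e t * (1 / (1 + (x - y)\<^sup>2)))"
      by simp
    finally show ?thesis
      using C(1) M_nonneg K decay_ge_1[OF x xb] space_profile_ge(2)[of x y]
      by (intro profileI[where r=1]) auto
  qed
  moreover have "0 \<le> (C * M * K) * (2 + b)" using C(1) M_nonneg b K by auto
  ultimately show ?thesis by blast
qed

definition bracket_kernel :: "real \<Rightarrow> real \<Rightarrow> real \<Rightarrow> complex"
  where "bracket_kernel x y t = compensated_kernel x y t - far_kernel x y t + near_kernel x y t + difference_kernel x y t"

end

section \<open>The bracket as a double integral\<close>

lemma integrable_time_profile:
  assumes "0 < e"
  shows "integrable lborel (time_profile e)"
proof -
  have 1: "integrable lborel (beta_kernel e 1)"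
    using has_bochner_integral_beta_kernel[of e 1] assms by (simp add: has_bochner_integral_iff)
  have "((\<lambda>t. t powr (- 1 - e)) has_integral - (1 powr ((- 1 - e) + 1)) / ((- 1 - e) + 1)) {1::real..}"
    using assms by (intro has_integral_powr_to_inf) auto
  then have "(\<lambda>t. t powr (- 1 - e)) absolutely_integrable_on {1::real..}"
    by (subst absolutely_integrable_on_iff_nonneg) (auto simp: integrable_on_def)
  then have 2: "integrable lborel (\<lambda>t. indicator {1..} t *\<^sub>R t powr (- 1 - e))"
    unfolding set_integrable_def by (subst (asm) integrable_completion) auto
  have "time_profile e = (\<lambda>t. beta_kernel e 1 t + indicator {1..} t *\<^sub>R t powr (- 1 - e))"
    by (rule ext) (auto simp: time_profile_def beta_kernel_def indicator_def)
  then show ?thesis using 1 2 by simp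
qed

text \<open>
  Both halves of the interval are Beta integrands with second parameter 1.
\<close>

lemma integrable_abs_powr_unit:
  assumes "0 < (\<eta>::real)"
  shows "integrable lborel (\<lambda>r. indicator {- 1<..<1} r * \<bar>r\<bar> powr (\<eta> - 1))"
proof -
  have 1: "integrable lborel (beta_kernel \<eta> 1)"
    using has_bochner_integral_beta_kernel[of \<eta> 1] assms by (simp add: has_bochner_integral_iff)
  have 2: "integrable lborel (\<lambda>r. beta_kernel \<eta> 1 (0 + (- 1) * r))"
    by (rule lborel_integrable_real_affine[OF 1]) auto
  have "(\<lambda>r. indicator {- 1<..<1} r * \<bar>r\<bar> powr (\<eta> - 1)) = (\<lambda>r. beta_kernel \<eta> 1 r + beta_kernel \<eta> 1 (0 + (- 1) * r))"
    by (rule ext) (auto simp: beta_kernel_def indicator_def)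
  then show ?thesis using 1 2 by simp
qed

lemma integrable_inverse_1_plus_square_real: "integrable lborel (\<lambda>r::real. 1 / (1 + r\<^sup>2))"
  using integrable_inverse_1_plus_square by (simp add: set_integrable_def divide_inverse)

text \<open>
  For \<open>c \<noteq> 0\<close> the two integrands are integrable or not at the same time, and in the latter case both
  sides are 0. The case \<open>c = 0\<close> covers the diagonal, where the inner integral in the first term of
  the bracket diverges.
\<close>

lemma scaleR_integral_left:
  fixes c :: complex
  shows "(\<integral>t. g t \<partial>M) *\<^sub>R c = (\<integral>t. g t *\<^sub>R c \<partial>M)"
proof (cases "c = 0 \<or> integrable M g")
  case True
  then show ?thesis by auto
next
  case False
  have "\<not> integrable M (\<lambda>t. g t *\<^sub>R c)"
  proof
    assume "integrable M (\<lambda>t. g t *\<^sub>R c)"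
    then have "integrable M (\<lambda>t. complex_of_real (g t) * c)"
      by (simp add: scaleR_conv_of_real)
    then have "integrable M (\<lambda>t. complex_of_real (g t) * c * inverse c)"
      by - (rule integrable_mult_left)
    then have "integrable M (\<lambda>t. complex_of_real (g t))"
      using False by (simp add: mult.assoc)
    then have "integrable M (\<lambda>t. Re (complex_of_real (g t)))" by (rule integrable_Re)
    then show False using False by simp
  qed
  then show ?thesis using False by (simp add: not_integrable_integral_eq)
qed

lemma set_integral_scaleR:
  fixes c :: complex
  shows "(LINT y:A|M. g y) *\<^sub>R c = (\<integral>y. indicator A y *\<^sub>R (g y *\<^sub>R c) \<partial>M)"
  by (simp add: set_lebesgue_integral_def scaleR_integral_left)

lemma indicator_Bpos: "indicator (Bpos x 1) y = (indicator {0<..} y * indicator {- 1<..<1} (x - y) :: 'a::{semiring_1})"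
  by (auto simp: Bpos_def indicator_def)

lemma indicator_Bpos_compl:
  "indicator ({0<..} - Bpos x 1) y = (indicator {0<..} y * (1 - indicator {- 1<..<1} (x - y)) :: real)"
  by (auto simp: Bpos_def indicator_def)

context bessel_log_setting
begin

lemma integrable_space_core:
  "integrable lborel (\<lambda>r. indicator {- 1<..<1} r * \<bar>r\<bar> powr (\<theta> - 4 * e - 1) + 1 / (1 + r\<^sup>2))"
  using integrable_abs_powr_unit[of "\<theta> - 4 * e"] integrable_inverse_1_plus_square_real e by simp

definition profile_mass :: real where
  "profile_mass = (\<integral>t. time_profile e t \<partial>lborel) *
    ((\<integral>r. indicator {- 1<..<1} r * \<bar>r\<bar> powr (\<theta> - 4 * e - 1) + 1 / (1 + r\<^sup>2) \<partial>lborel)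
      + (\<integral>y. indicator {a..b} y \<partial>lborel))"

lemma profile_mass_nonneg: "0 \<le> profile_mass"
  unfolding profile_mass_def
  by (intro mult_nonneg_nonneg add_nonneg_nonneg Bochner_Integration.integral_nonneg)
    (auto simp: time_profile_nonneg)

lemma has_bochner_integral_profile:
  "has_bochner_integral (lborel \<Otimes>\<^sub>M lborel) (\<lambda>z. profile x (fst z) (snd z)) (profile_mass * (1 + x) powr (- \<beta>))"
proof -
  let ?g = "\<lambda>r. indicator {- 1<..<1} r * \<bar>r\<bar> powr (\<theta> - 4 * e - 1) + 1 / (1 + r\<^sup>2)"
  have [measurable]: "space_profile x \<in> borel_measurable borel"
    unfolding space_profile_def by measurable
  have "(\<lambda>z. space_profile x (fst z)) \<in> borel_measurable (lborel \<Otimes>\<^sub>M lborel)"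
    by measurable
  then have profile_measurable: "(\<lambda>z. profile x (fst z) (snd z)) \<in> borel_measurable (lborel \<Otimes>\<^sub>M lborel)"
    unfolding profile_def by measurable
  have s: "has_bochner_integral lborel (space_profile x)
      ((\<integral>r. ?g r \<partial>lborel) + (\<integral>y. indicator {a..b} y \<partial>lborel))"
  proof -
    have "has_bochner_integral lborel (\<lambda>y. ?g (x + (- 1) * y)) (\<integral>r. ?g r \<partial>lborel)"
      using lborel_integrable_real_affine[OF integrable_space_core, of "- 1" x]
        lborel_integral_real_affine[of "- 1" ?g x]
      by (simp add: has_bochner_integral_iff)
    moreover have "has_bochner_integral lborel (\<lambda>y. indicator {a..b} y :: real) (\<integral>y. indicator {a..b} y \<partial>lborel)"
      using integrable_real_indicator[of "{a..b}" lborel]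
      by (simp add: has_bochner_integral_iff emeasure_lborel_Icc_eq)
    ultimately have "has_bochner_integral lborel (\<lambda>y. ?g (x + (- 1) * y) + indicator {a..b} y)
        ((\<integral>r. ?g r \<partial>lborel) + (\<integral>y. indicator {a..b} y \<partial>lborel))"
      by (rule has_bochner_integral_add)
    moreover have "(\<lambda>y. ?g (x + (- 1) * y) + indicator {a..b} y) = space_profile x"
      by (simp add: space_profile_def fun_eq_iff)
    ultimately show ?thesis by simp
  qed
  have t: "has_bochner_integral lborel (time_profile e) (\<integral>t. time_profile e t \<partial>lborel)"
    using integrable_time_profile[OF e(1)] by (simp add: has_bochner_integral_iff)
  have T0: "0 \<le> (\<integral>t. time_profile e t \<partial>lborel)"
    by (simp add: time_profile_nonneg)
  have nt: "(\<integral>\<^sup>+t. ennreal (time_profile e t) \<partial>lborel) = ennreal (\<integral>t. time_profile e t \<partial>lborel)"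
    using integrable_time_profile[OF e(1)] by (simp add: nn_integral_eq_integral time_profile_nonneg)
  have ns: "(\<integral>\<^sup>+y. ennreal (space_profile x y) \<partial>lborel)
     = ennreal ((\<integral>r. ?g r \<partial>lborel) + (\<integral>y. indicator {a..b} y \<partial>lborel))"
    using s by (subst nn_integral_eq_integral) (auto simp: has_bochner_integral_iff space_profile_ge)
  have S0: "0 \<le> (\<integral>r. ?g r \<partial>lborel) + (\<integral>y. indicator {a..b} y \<partial>lborel)"
    by (intro add_nonneg_nonneg Bochner_Integration.integral_nonneg) auto
  have "(\<integral>\<^sup>+z. ennreal (profile x (fst z) (snd z)) \<partial>(lborel \<Otimes>\<^sub>M lborel))
    = (\<integral>\<^sup>+y. \<integral>\<^sup>+t. ennreal (profile x y t) \<partial>lborel \<partial>lborel)"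
    unfolding profile_def by (subst lborel.nn_integral_fst[symmetric]) auto
  also have "\<dots> = (\<integral>\<^sup>+y. \<integral>\<^sup>+t. ennreal (time_profile e t) * (ennreal (space_profile x y) * ennreal ((1 + x) powr (- \<beta>))) \<partial>lborel \<partial>lborel)"
    by (intro nn_integral_cong)
      (simp add: profile_def ennreal_mult time_profile_nonneg space_profile_ge mult.assoc)
  also have "\<dots> = ennreal (\<integral>t. time_profile e t \<partial>lborel) *
     (ennreal ((\<integral>r. ?g r \<partial>lborel) + (\<integral>y. indicator {a..b} y \<partial>lborel)) * ennreal ((1 + x) powr (- \<beta>)))"
    by (simp add: nn_integral_multc nn_integral_cmult nt ns del: ennreal_plus)
  also have "\<dots> = ennreal (profile_mass * (1 + x) powr (- \<beta>))"
    unfolding profile_mass_def using T0 S0 by (simp add: ennreal_mult mult.assoc del: ennreal_plus)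
  finally show ?thesis
    using profile_measurable
    by (intro has_bochner_integral_nn_integral) (auto simp: profile_nonneg profile_mass_nonneg)
qed

text \<open>
  The kernels and weights for which the weighted integral over space and time converges absolutely,
  with a bound of order \<open>(1 + x) powr (- \<beta>)\<close>; see \<open>kernel_integral\<close>.
\<close>

definition dominated_kernel :: "real \<Rightarrow> (real \<Rightarrow> real \<Rightarrow> real \<Rightarrow> complex) \<Rightarrow> bool"
  where "dominated_kernel C k \<longleftrightarrow> 0 \<le> C \<and>
    (\<lambda>(x, y, t). k x y t) \<in> borel_measurable (borel \<Otimes>\<^sub>M (borel \<Otimes>\<^sub>M borel)) \<and>
    (\<forall>x y t. t \<le> 0 \<longrightarrow> k x y t = 0) \<and>
    (\<forall>x>0. \<forall>y t. norm (k x y t) * log_weight e t \<le> C * profile x y t)"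

definition dominated_weight :: "real \<Rightarrow> (real \<Rightarrow> real) \<Rightarrow> bool"
  where "dominated_weight A \<phi> \<longleftrightarrow> 0 \<le> A \<and> \<phi> \<in> borel_measurable borel \<and> (\<forall>t>0. \<bar>\<phi> t\<bar> \<le> A * log_weight e t)"

lemma dominated_kernel_measurable1:
  assumes "dominated_kernel C k"
  shows "(\<lambda>z. k x (fst z) (snd z)) \<in> borel_measurable (lborel \<Otimes>\<^sub>M lborel)"
proof -
  have k: "(\<lambda>(x, y, t). k x y t) \<in> borel_measurable (borel \<Otimes>\<^sub>M (borel \<Otimes>\<^sub>M borel))"
    using assms by (simp add: dominated_kernel_def)
  have "(\<lambda>z. (\<lambda>(x, y, t). k x y t) (x, z)) \<in> borel_measurable (borel \<Otimes>\<^sub>M borel)"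
    by (rule measurable_compose[OF measurable_Pair1' k]) simp
  then have "(\<lambda>z. k x (fst z) (snd z)) \<in> borel_measurable (borel \<Otimes>\<^sub>M borel)"
    by (simp add: case_prod_beta')
  moreover have "sets (lborel \<Otimes>\<^sub>M lborel) = sets (borel \<Otimes>\<^sub>M (borel :: real measure))"
    by (intro sets_pair_measure_cong) auto
  ultimately show ?thesis
    using measurable_cong_sets by blast
qed

lemma kernel_integral:
  assumes k: "dominated_kernel C k" and w: "dominated_weight A \<phi>" and x: "0 < x"
  shows "integrable (lborel \<Otimes>\<^sub>M lborel) (\<lambda>z. \<phi> (snd z) *\<^sub>R k x (fst z) (snd z))"
    and "norm (\<integral>z. \<phi> (snd z) *\<^sub>R k x (fst z) (snd z) \<partial>(lborel \<Otimes>\<^sub>M lborel))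
      \<le> A * C * profile_mass * (1 + x) powr (- \<beta>)"
proof -
  have [measurable]: "\<phi> \<in> borel_measurable borel" using w by (simp add: dominated_weight_def)
  note [measurable] = dominated_kernel_measurable1[OF k]
  have bound: "norm (\<phi> (snd z) *\<^sub>R k x (fst z) (snd z)) \<le> A * C * profile x (fst z) (snd z)" for z
  proof (cases "snd z \<le> 0")
    case True
    then show ?thesis using k w by (simp add: dominated_kernel_def dominated_weight_def profile_nonneg)
  next
    case False
    then have "norm (\<phi> (snd z) *\<^sub>R k x (fst z) (snd z)) \<le> A * log_weight e (snd z) * norm (k x (fst z) (snd z))"
      using w by (auto simp: dominated_weight_def intro!: mult_right_mono)
    also have "\<dots> = A * (norm (k x (fst z) (snd z)) * log_weight e (snd z))" by simp
    also have "\<dots> \<le> A * (C * profile x (fst z) (snd z))"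
      using k w x by (intro mult_left_mono) (auto simp: dominated_kernel_def dominated_weight_def)
    finally show ?thesis by simp
  qed
  have p: "has_bochner_integral (lborel \<Otimes>\<^sub>M lborel) (\<lambda>z. A * C * profile x (fst z) (snd z))
     (A * C * (profile_mass * (1 + x) powr (- \<beta>)))"
    by (intro has_bochner_integral_mult_right has_bochner_integral_profile)
  have p_int: "integrable (lborel \<Otimes>\<^sub>M lborel) (\<lambda>z. A * C * profile x (fst z) (snd z))"
    using p unfolding has_bochner_integral_iff by (rule conjunct1)
  show I: "integrable (lborel \<Otimes>\<^sub>M lborel) (\<lambda>z. \<phi> (snd z) *\<^sub>R k x (fst z) (snd z))"
  proof (rule Bochner_Integration.integrable_bound)
    show "integrable (lborel \<Otimes>\<^sub>M lborel) (\<lambda>z. A * C * profile x (fst z) (snd z))"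
      by (rule p_int)
    show "AE z in lborel \<Otimes>\<^sub>M lborel. norm (\<phi> (snd z) *\<^sub>R k x (fst z) (snd z))
        \<le> norm (A * C * profile x (fst z) (snd z))"
      using bound by (intro AE_I2) (metis abs_ge_self order_trans real_norm_def)
  qed measurable
  have "norm (\<integral>z. \<phi> (snd z) *\<^sub>R k x (fst z) (snd z) \<partial>(lborel \<Otimes>\<^sub>M lborel))
    \<le> (\<integral>z. norm (\<phi> (snd z) *\<^sub>R k x (fst z) (snd z)) \<partial>(lborel \<Otimes>\<^sub>M lborel))"
    by (rule integral_norm_bound)
  also have "\<dots> \<le> (\<integral>z. A * C * profile x (fst z) (snd z) \<partial>(lborel \<Otimes>\<^sub>M lborel))"
    by (intro integral_mono bound integrable_norm I p_int)
  also have "\<dots> = A * C * (profile_mass * (1 + x) powr (- \<beta>))"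
    using p unfolding has_bochner_integral_iff by (rule conjunct2)
  finally show "norm (\<integral>z. \<phi> (snd z) *\<^sub>R k x (fst z) (snd z) \<partial>(lborel \<Otimes>\<^sub>M lborel))
      \<le> A * C * profile_mass * (1 + x) powr (- \<beta>)" by (simp add: mult.assoc)
qed

lemma borel_measurable_W: "(\<lambda>(x, y, t). W x y t) \<in> borel_measurable (borel \<Otimes>\<^sub>M (borel \<Otimes>\<^sub>M borel))"
  unfolding W_def W_bessel_def case_prod_beta' by measurable

lemma borel_measurable_G: "(\<lambda>(x, y, t). G x y t) \<in> borel_measurable (borel \<Otimes>\<^sub>M (borel \<Otimes>\<^sub>M borel))"
  unfolding G_def W_gauss_def case_prod_beta' by measurable

lemma dominated_kernelI:
  assumes "\<exists>C\<ge>0. \<forall>x>0. \<forall>y>0. \<forall>t>0. norm (k x y t) * log_weight e t \<le> C * profile x y t"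
    and "(\<lambda>(x, y, t). k x y t) \<in> borel_measurable (borel \<Otimes>\<^sub>M (borel \<Otimes>\<^sub>M borel))"
    and "\<And>x y t. t \<le> 0 \<Longrightarrow> k x y t = 0" "\<And>x y t. y \<le> 0 \<Longrightarrow> k x y t = 0"
  shows "\<exists>C. dominated_kernel C k"
proof -
  from assms(1) obtain C where C: "0 \<le> C" "\<And>x y t. 0 < x \<Longrightarrow> 0 < y \<Longrightarrow> 0 < t \<Longrightarrow>
    norm (k x y t) * log_weight e t \<le> C * profile x y t" by blast
  have "norm (k x y t) * log_weight e t \<le> C * profile x y t" if "0 < x" for x y t
    using C(2)[OF that, of y t] assms(3,4) mult_nonneg_nonneg[OF C(1) profile_nonneg, of x y t]
    by (cases "0 < y"; cases "0 < t") auto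
  then show ?thesis using C(1) assms(2,3) unfolding dominated_kernel_def by blast
qed

lemma dominated_kernels:
  "\<exists>C. dominated_kernel C compensated_kernel" "\<exists>C. dominated_kernel C far_kernel"
  "\<exists>C. dominated_kernel C near_kernel" "\<exists>C. dominated_kernel C difference_kernel"
proof -
  note [measurable] = borel_measurable_W[unfolded case_prod_beta'] borel_measurable_G[unfolded case_prod_beta']
  show "\<exists>C. dominated_kernel C compensated_kernel"
  proof (rule dominated_kernelI[OF compensated_kernel_bound])
    show "(\<lambda>(x, y, t). compensated_kernel x y t) \<in> borel_measurable (borel \<Otimes>\<^sub>M (borel \<Otimes>\<^sub>M borel))"
      unfolding compensated_kernel_def indicator_Bpos case_prod_beta' by measurable
  qed (auto simp: compensated_kernel_def)
  show "\<exists>C. dominated_kernel C far_kernel"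
  proof (rule dominated_kernelI[OF far_kernel_bound])
    show "(\<lambda>(x, y, t). far_kernel x y t) \<in> borel_measurable (borel \<Otimes>\<^sub>M (borel \<Otimes>\<^sub>M borel))"
      unfolding far_kernel_def indicator_Bpos_compl case_prod_beta' by measurable
  qed (auto simp: far_kernel_def)
  show "\<exists>C. dominated_kernel C near_kernel"
  proof (rule dominated_kernelI[OF near_kernel_bound])
    show "(\<lambda>(x, y, t). near_kernel x y t) \<in> borel_measurable (borel \<Otimes>\<^sub>M (borel \<Otimes>\<^sub>M borel))"
      unfolding near_kernel_def indicator_Bpos case_prod_beta' by measurable
  qed (auto simp: near_kernel_def Bpos_def)
  show "\<exists>C. dominated_kernel C difference_kernel"
  proof (rule dominated_kernelI[OF difference_kernel_bound])
    show "(\<lambda>(x, y, t). difference_kernel x y t) \<in> borel_measurable (borel \<Otimes>\<^sub>M (borel \<Otimes>\<^sub>M borel))"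
      unfolding difference_kernel_def case_prod_beta' by measurable
  qed (auto simp: difference_kernel_def)
qed

lemma dominated_kernel_add:
  assumes "dominated_kernel C k" "dominated_kernel D k'"
  shows "dominated_kernel (C + D) (\<lambda>x y t. k x y t + k' x y t)"
  unfolding dominated_kernel_def
proof (intro conjI allI impI)
  show "(\<lambda>(x, y, t). k x y t + k' x y t) \<in> borel_measurable (borel \<Otimes>\<^sub>M (borel \<Otimes>\<^sub>M borel))"
    using assms unfolding dominated_kernel_def case_prod_beta' by (intro borel_measurable_add) auto
  fix x y t :: real assume x: "0 < x"
  show "norm (k x y t + k' x y t) * log_weight e t \<le> (C + D) * profile x y t"
  proof (cases "t \<le> 0")
    case True
    then show ?thesis using assms by (simp add: dominated_kernel_def profile_nonneg)
  next
    case False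
    then have "norm (k x y t + k' x y t) * log_weight e t \<le> (norm (k x y t) + norm (k' x y t)) * log_weight e t"
      by (intro mult_right_mono norm_triangle_ineq log_weight_nonneg) auto
    also have "\<dots> = norm (k x y t) * log_weight e t + norm (k' x y t) * log_weight e t"
      by (rule distrib_right)
    also have "\<dots> \<le> C * profile x y t + D * profile x y t"
      using assms x by (intro add_mono) (auto simp: dominated_kernel_def)
    finally show ?thesis by (simp add: distrib_right)
  qed
qed (use assms in \<open>auto simp: dominated_kernel_def\<close>)

lemma dominated_kernel_uminus:
  "dominated_kernel C k \<Longrightarrow> dominated_kernel C (\<lambda>x y t. - k x y t)"
  unfolding dominated_kernel_def by (auto simp: case_prod_beta')

lemma dominated_kernel_bracket_kernel: "\<exists>C. dominated_kernel C bracket_kernel"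
proof -
  obtain C1 C2 C3 C4 where "dominated_kernel C1 compensated_kernel" "dominated_kernel C2 far_kernel"
    "dominated_kernel C3 near_kernel" "dominated_kernel C4 difference_kernel"
    using dominated_kernels by blast
  then have "dominated_kernel (C1 + C2 + C3 + C4)
      (\<lambda>x y t. compensated_kernel x y t + - far_kernel x y t + near_kernel x y t + difference_kernel x y t)"
    by (intro dominated_kernel_add dominated_kernel_uminus)
  then show ?thesis unfolding bracket_kernel_def by auto
qed

lemma iterated_kernel_integral:
  assumes "\<exists>C. dominated_kernel C k" "dominated_weight A \<phi>" "0 < x"
    "\<And>y t. \<phi> t *\<^sub>R k x y t = (u y * (v t * w y t)) *\<^sub>R c y"
  shows "(\<integral>z. \<phi> (snd z) *\<^sub>R k x (fst z) (snd z) \<partial>(lborel \<Otimes>\<^sub>M lborel))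
    = (\<integral>y. u y *\<^sub>R ((\<integral>t. v t * w y t \<partial>lborel) *\<^sub>R c y) \<partial>lborel)"
proof -
  obtain C where "dominated_kernel C k" using assms(1) by blast
  from lborel_pair.integral_fst'[OF kernel_integral(1)[OF this assms(2,3)]]
  have "(\<integral>z. \<phi> (snd z) *\<^sub>R k x (fst z) (snd z) \<partial>(lborel \<Otimes>\<^sub>M lborel))
    = (\<integral>y. \<integral>t. \<phi> t *\<^sub>R k x y t \<partial>lborel \<partial>lborel)" by simp
  also have "\<dots> = (\<integral>y. u y *\<^sub>R ((\<integral>t. v t * w y t \<partial>lborel) *\<^sub>R c y) \<partial>lborel)"
  proof (rule Bochner_Integration.integral_cong[OF refl])
    fix y :: real
    have "u y *\<^sub>R ((\<integral>t. v t * w y t \<partial>lborel) *\<^sub>R c y) = (\<integral>t. v t * w y t \<partial>lborel) *\<^sub>R (u y *\<^sub>R c y)"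
      by simp
    also have "\<dots> = (\<integral>t. (v t * w y t) *\<^sub>R (u y *\<^sub>R c y) \<partial>lborel)"
      by (rule scaleR_integral_left)
    finally show "(\<integral>t. \<phi> t *\<^sub>R k x y t \<partial>lborel) = u y *\<^sub>R ((\<integral>t. v t * w y t \<partial>lborel) *\<^sub>R c y)"
      unfolding assms(4) by (simp add: mult_ac)
  qed
  finally show ?thesis .
qed

text \<open>
  Fubini's theorem for each of the four terms. Once the bracket is a single absolutely convergent
  integral against the weight, its linearity in the weight is evident.
\<close>

theorem bessel_bracket_eq:
  assumes w: "dominated_weight A \<phi>" and x: "0 < x"
  shows "bessel_bracket l \<phi> f x = (\<integral>z. \<phi> (snd z) *\<^sub>R bracket_kernel x (fst z) (snd z) \<partial>(lborel \<Otimes>\<^sub>M lborel))"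
proof -
  let ?I = "\<lambda>k. (\<integral>z. \<phi> (snd z) *\<^sub>R k x (fst z) (snd z) \<partial>(lborel \<Otimes>\<^sub>M lborel))"
  have int: "integrable (lborel \<Otimes>\<^sub>M lborel) (\<lambda>z. \<phi> (snd z) *\<^sub>R k x (fst z) (snd z))"
    if "\<exists>C. dominated_kernel C k" for k
    using that kernel_integral(1)[OF _ w x] by blast
  have 1: "?I compensated_kernel = (LINT y:{0<..}|lborel.
       (LINT t:{0<..}|lborel. W_bessel l t x y * \<phi> t) *\<^sub>R (f y - indicator (Bpos x 1) y * f x))"
    unfolding set_lebesgue_integral_def real_scaleR_def
    by (rule iterated_kernel_integral[OF dominated_kernels(1) w x]) (simp add: compensated_kernel_def W_def mult_ac)
  have 2: "?I far_kernel = (LINT y:{0<..} - Bpos x 1|lborel. LINT t:{0<..<1}|lborel. W_bessel l t x y * \<phi> t) *\<^sub>R f x"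
    by (subst set_integral_scaleR, unfold set_lebesgue_integral_def real_scaleR_def,
      rule iterated_kernel_integral[OF dominated_kernels(2) w x], simp add: far_kernel_def W_def mult_ac)
  have 3: "?I near_kernel = (LINT y:Bpos x 1|lborel. LINT t:{1<..}|lborel. W_bessel l t x y * \<phi> t) *\<^sub>R f x"
    by (subst set_integral_scaleR, unfold set_lebesgue_integral_def real_scaleR_def,
      rule iterated_kernel_integral[OF dominated_kernels(3) w x], simp add: near_kernel_def W_def mult_ac)
  have 4: "?I difference_kernel = (LINT y:{0<..}|lborel. LINT t:{0<..<1}|lborel.
          (W_bessel l t x y - W_gauss t (x - y)) * \<phi> t) *\<^sub>R f x"
    by (subst set_integral_scaleR, unfold set_lebesgue_integral_def real_scaleR_def,
      rule iterated_kernel_integral[OF dominated_kernels(4) w x], simp add: difference_kernel_def W_def G_def mult_ac)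
  have "?I bracket_kernel = ?I compensated_kernel - ?I far_kernel + ?I near_kernel + ?I difference_kernel"
    unfolding bracket_kernel_def scaleR_add_right scaleR_diff_right
    using int[OF dominated_kernels(1)] int[OF dominated_kernels(2)]
      int[OF dominated_kernels(3)] int[OF dominated_kernels(4)] by simp
  then show ?thesis
    unfolding bessel_bracket_def 1 2 3 4 by (simp add: scaleR_add_left scaleR_diff_left)
qed

lemma borel_measurable_bracket:
  assumes w: "dominated_weight A \<phi>"
  shows "bessel_bracket l \<phi> f \<in> borel_measurable lborel_pos"
proof -
  obtain C where C: "dominated_kernel C bracket_kernel" using dominated_kernel_bracket_kernel by blast
  then have [measurable]: "(\<lambda>(x, y, t). bracket_kernel x y t) \<in> borel_measurable (borel \<Otimes>\<^sub>M (borel \<Otimes>\<^sub>M borel))"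
    by (simp add: dominated_kernel_def)
  have [measurable]: "\<phi> \<in> borel_measurable borel" using w by (simp add: dominated_weight_def)
  have "(\<lambda>p. \<phi> (snd (snd p)) *\<^sub>R bracket_kernel (fst p) (fst (snd p)) (snd (snd p)))
      \<in> borel_measurable (borel \<Otimes>\<^sub>M (lborel \<Otimes>\<^sub>M lborel))"
  proof -
    have "(\<lambda>p. \<phi> (snd (snd p)) *\<^sub>R (\<lambda>(x, y, t). bracket_kernel x y t) p) \<in> borel_measurable (borel \<Otimes>\<^sub>M (borel \<Otimes>\<^sub>M borel))"
      by measurable
    then show ?thesis by (simp add: case_prod_beta' cong: measurable_cong_sets)
  qed
  then have "(\<lambda>x. \<integral>z. \<phi> (snd z) *\<^sub>R bracket_kernel x (fst z) (snd z) \<partial>(lborel \<Otimes>\<^sub>M lborel)) \<in> borel_measurable borel"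
    by (intro lborel_pair.borel_measurable_lebesgue_integral) (simp add: case_prod_beta')
  then have "(\<lambda>x. \<integral>z. \<phi> (snd z) *\<^sub>R bracket_kernel x (fst z) (snd z) \<partial>(lborel \<Otimes>\<^sub>M lborel)) \<in> borel_measurable lborel_pos"
    by (intro measurable_restrict_space1) simp
  then show ?thesis
    by (subst measurable_cong[OF bessel_bracket_eq[OF w]]) (auto simp: space_restrict_space)
qed

definition bracket_constant :: real
  where "bracket_constant = (SOME C. dominated_kernel C bracket_kernel) * profile_mass"

lemma dominated_kernel_some: "dominated_kernel (SOME C. dominated_kernel C bracket_kernel) bracket_kernel"
  using dominated_kernel_bracket_kernel by (rule someI_ex)

lemma norm_bessel_bracket_le:
  assumes "dominated_weight A \<phi>" "0 < x"
  shows "norm (bessel_bracket l \<phi> f x) \<le> A * bracket_constant * (1 + x) powr (- \<beta>)"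
  using kernel_integral(2)[OF dominated_kernel_some assms]
  by (simp add: bessel_bracket_eq[OF assms] bracket_constant_def mult.assoc)

text \<open>
  Linearity and domination combined: an error bound between weights passes to the brackets,
  uniformly in \<open>x\<close> up to the decay factor.
\<close>

theorem norm_bessel_bracket_diff_le:
  fixes n :: nat
  assumes w: "dominated_weight A \<phi>" "\<And>j. dominated_weight (D j) (\<psi> j)"
    "dominated_weight B (\<lambda>t. \<phi> t - (\<Sum>j<n. c j * \<psi> j t))" and x: "0 < x"
  shows "norm (bessel_bracket l \<phi> f x - (\<Sum>j<n. c j *\<^sub>R bessel_bracket l (\<psi> j) f x))
    \<le> B * bracket_constant * (1 + x) powr (- \<beta>)"
proof -
  note int = kernel_integral(1)[OF dominated_kernel_some _ x]
  have "bessel_bracket l \<phi> f x - (\<Sum>j<n. c j *\<^sub>R bessel_bracket l (\<psi> j) f x)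
     = bessel_bracket l (\<lambda>t. \<phi> t - (\<Sum>j<n. c j * \<psi> j t)) f x"
    unfolding bessel_bracket_eq[OF w(1) x] bessel_bracket_eq[OF w(2) x] bessel_bracket_eq[OF w(3) x]
    using int[OF w(1)] int[OF w(2)]
    by (simp add: scaleR_diff_left scaleR_sum_left flip: scaleR_scaleR)
  then show ?thesis
    using norm_bessel_bracket_le[OF w(3) x] by simp
qed

end

section \<open>Expansion of the powers in the exponent\<close>

lemma power_le_fact_exp:
  assumes "0 \<le> (x::real)"
  shows "x ^ n \<le> fact n * exp x"
proof -
  obtain t where "exp x = (\<Sum>m<Suc n. x ^ m / fact m) + exp t / fact (Suc n) * x ^ Suc n"
    using Maclaurin_exp_le[of x "Suc n"] by blast
  moreover have "0 \<le> exp t / fact (Suc n) * x ^ Suc n" using assms by simp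
  moreover have "0 \<le> (\<Sum>m<n. x ^ m / fact m)" using assms by (intro sum_nonneg) auto
  ultimately have "x ^ n / fact n \<le> exp x" by simp
  then show ?thesis by (simp add: divide_le_eq mult.commute)
qed

lemma exp_taylor_remainder:
  "\<bar>exp v - (\<Sum>j<n. v ^ j / fact j)\<bar> \<le> \<bar>v\<bar> ^ n / fact n * exp \<bar>v :: real\<bar>"
proof -
  obtain t where t: "\<bar>t\<bar> \<le> \<bar>v\<bar>" "exp v = (\<Sum>j<n. v ^ j / fact j) + exp t / fact n * v ^ n"
    using Maclaurin_exp_le[of v n] by blast
  then have "\<bar>exp v - (\<Sum>j<n. v ^ j / fact j)\<bar> = \<bar>v\<bar> ^ n / fact n * exp t"
    by (simp add: abs_mult power_abs)
  also have "\<dots> \<le> \<bar>v\<bar> ^ n / fact n * exp \<bar>v\<bar>"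
    using t(1) by (intro mult_left_mono) auto
  finally show ?thesis .
qed

lemma exp_abs_ln_le_log_weight:
  assumes "0 < t"
  shows "exp (e * \<bar>ln t\<bar>) / t \<le> log_weight e t"
proof -
  have "exp (e * \<bar>ln t\<bar>) \<le> exp (e * ln t) + exp (- e * ln t)"
    by (cases "0 \<le> ln t") auto
  also have "\<dots> = t powr e + t powr (- e)"
    using assms by (simp add: powr_def)
  finally show ?thesis
    using assms unfolding log_weight_def by (intro divide_right_mono) auto
qed

lemma inverse_powr_eq_exp:
  fixes s t :: real
  assumes "0 < t"
  shows "1 / t powr (1 + s) = exp (- (s * ln t)) / t"
proof -
  have "t powr (1 + s) = t * exp (s * ln t)"
    using assms powr_add[of t 1 s] by (simp add: powr_def[of t s])
  then show ?thesis by (simp add: exp_minus divide_inverse mult.commute)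
qed

lemma ln_power_weight:
  assumes "0 < e" "0 < t"
  shows "\<bar>ln t ^ j / t\<bar> \<le> (fact j / e ^ j) * log_weight e t"
proof -
  have "e ^ j * \<bar>ln t\<bar> ^ j \<le> fact j * exp (e * \<bar>ln t\<bar>)"
    using power_le_fact_exp[of "e * \<bar>ln t\<bar>" j] assms by (simp add: power_mult_distrib)
  then have "\<bar>ln t\<bar> ^ j \<le> fact j / e ^ j * exp (e * \<bar>ln t\<bar>)"
    using assms by (simp add: field_simps)
  then have "\<bar>ln t\<bar> ^ j / t \<le> fact j / e ^ j * exp (e * \<bar>ln t\<bar>) / t"
    using assms by (intro divide_right_mono) auto
  also have "\<dots> \<le> fact j / e ^ j * log_weight e t"
    using mult_left_mono[OF exp_abs_ln_le_log_weight[OF assms(2), of e], of "fact j / e ^ j"] assms by simp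
  finally show ?thesis using assms by (simp add: power_abs)
qed

text \<open>
  Taylor's formula for \<open>1 / t powr (1 + s) = exp (- s u) / t\<close> with \<open>u = ln t\<close>. Half of the exponential
  room \<open>e \<bar>u\<bar>\<close> absorbs \<open>exp (\<bar>s\<bar> \<bar>u\<bar>)\<close>, the other half the power of \<open>u\<close>.
\<close>

lemma power_weight_remainder:
  assumes e: "0 < e" and s: "\<bar>s\<bar> \<le> e / 2" and t: "0 < t"
  shows "\<bar>1 / t powr (1 + s) - (\<Sum>j<n. ((- s) ^ j / fact j) * (ln t ^ j / t))\<bar>
    \<le> ((2 / e) ^ n * \<bar>s\<bar> ^ n) * log_weight e t"
proof -
  define u where "u = ln t"
  define v where "v = - (s * u)"
  have absv: "\<bar>v\<bar> = \<bar>s\<bar> * \<bar>u\<bar>" by (simp add: v_def abs_mult)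
  have eq: "1 / t powr (1 + s) - (\<Sum>j<n. ((- s) ^ j / fact j) * (ln t ^ j / t))
      = (exp v - (\<Sum>j<n. v ^ j / fact j)) / t"
    using t by (simp add: inverse_powr_eq_exp v_def u_def diff_divide_distrib sum_divide_distrib
        power_mult_distrib[symmetric] flip: minus_mult_left)
  have "\<bar>exp v - (\<Sum>j<n. v ^ j / fact j)\<bar> \<le> \<bar>v\<bar> ^ n / fact n * exp \<bar>v\<bar>"
    by (rule exp_taylor_remainder)
  also have "\<dots> = \<bar>s\<bar> ^ n * (\<bar>u\<bar> ^ n / fact n * exp \<bar>v\<bar>)"
    by (simp add: absv power_mult_distrib)
  also have "\<dots> \<le> \<bar>s\<bar> ^ n * (((2 / e) ^ n * exp (e / 2 * \<bar>u\<bar>)) * exp (e / 2 * \<bar>u\<bar>))"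
  proof (intro mult_left_mono mult_mono)
    have "(e / 2) ^ n * \<bar>u\<bar> ^ n \<le> fact n * exp (e / 2 * \<bar>u\<bar>)"
      unfolding power_mult_distrib[symmetric] by (rule power_le_fact_exp) (use e in simp)
    then show "\<bar>u\<bar> ^ n / fact n \<le> (2 / e) ^ n * exp (e / 2 * \<bar>u\<bar>)"
      using e by (simp add: power_divide field_simps)
    show "exp \<bar>v\<bar> \<le> exp (e / 2 * \<bar>u\<bar>)"
      using mult_right_mono[OF s, of "\<bar>u\<bar>"] unfolding absv by simp
  qed (use e in auto)
  also have "\<dots> = ((2 / e) ^ n * \<bar>s\<bar> ^ n) * exp (e * \<bar>u\<bar>)"
    by (simp add: exp_add[symmetric] mult_ac)
  finally have "\<bar>exp v - (\<Sum>j<n. v ^ j / fact j)\<bar> / t \<le> ((2 / e) ^ n * \<bar>s\<bar> ^ n) * exp (e * \<bar>u\<bar>) / t"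
    using t by (intro divide_right_mono) auto
  also have "\<dots> \<le> ((2 / e) ^ n * \<bar>s\<bar> ^ n) * log_weight e t"
    using mult_left_mono[OF exp_abs_ln_le_log_weight[OF t, of e], of "(2 / e) ^ n * \<bar>s\<bar> ^ n"] e
    by (simp add: u_def)
  finally show ?thesis using t unfolding eq by simp
qed

text \<open>
  The reciprocal Gamma function is entire; its complex derivatives, restricted to the real line,
  are the real ones.
\<close>

lemma inverse_Gamma_higher_derivatives:
  obtains d :: "nat \<Rightarrow> real \<Rightarrow> real" where
    "d 0 = (\<lambda>s. 1 / Gamma (1 - s))"
    "\<And>n s. (d n has_real_derivative d (Suc n) s) (at s)"
    "\<And>n. (deriv ^^ n) (\<lambda>s. 1 / Gamma (1 - s)) = d n"
proof -
  define F where "F n = (deriv ^^ n) (\<lambda>z::complex. rGamma (1 - z))" for n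
  define d where "d n s = Re (F n (of_real s))" for n s
  have hol: "F n holomorphic_on UNIV" for n
    unfolding F_def
    by (intro holomorphic_higher_deriv holomorphic_intros) auto
  have F: "(F n has_field_derivative F (Suc n) z) (at z)" for n z
    using holomorphic_derivI[OF hol open_UNIV, of z n] by (simp add: F_def)
  have d: "(d n has_real_derivative d (Suc n) s) (at s)" for n s
    unfolding d_def
    by (intro has_field_derivative_Re has_vector_derivative_real_field F)
  have d0: "d 0 = (\<lambda>s. 1 / Gamma (1 - s))"
  proof (rule ext)
    fix s :: real
    have "d 0 s = Re (rGamma (complex_of_real (1 - s)))" by (simp add: d_def F_def)
    also have "\<dots> = rGamma (1 - s)" by (simp only: rGamma_complex_of_real Re_complex_of_real)
    finally show "d 0 s = 1 / Gamma (1 - s)" by (simp add: rGamma_inverse_Gamma divide_inverse)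
  qed
  have "(deriv ^^ n) (\<lambda>s. 1 / Gamma (1 - s)) = d n" for n
  proof (induction n)
    case 0
    then show ?case by (simp add: d0)
  next
    case (Suc n)
    have "deriv (d n) = d (Suc n)"
      by (rule ext) (rule DERIV_imp_deriv[OF d])
    then show ?case by (simp add: Suc)
  qed
  with d0 d show ?thesis by (rule that)
qed

lemma inverse_Gamma_taylor:
  "\<exists>K\<ge>0. \<forall>s. \<bar>s\<bar> \<le> 1 \<longrightarrow> \<bar>1 / Gamma (1 - s) - (\<Sum>i<n. s ^ i / fact i * D_inv_Gamma i)\<bar> \<le> K * \<bar>s\<bar> ^ n"
proof -
  obtain d where d: "d 0 = (\<lambda>s. 1 / Gamma (1 - s))"
    "\<And>n s. (d n has_real_derivative d (Suc n) s) (at s)"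
    "\<And>n. (deriv ^^ n) (\<lambda>s. 1 / Gamma (1 - s)) = d n"
    by (rule inverse_Gamma_higher_derivatives) (rule that; assumption)
  have "continuous_on {- 1..1} (d n)"
    by (intro continuous_at_imp_continuous_on ballI) (rule DERIV_isCont[OF d(2)])
  then have "bounded (d n ` {- 1..1})"
    by (intro compact_imp_bounded compact_continuous_image) auto
  then obtain K where K: "\<And>t. t \<in> {- 1..1} \<Longrightarrow> \<bar>d n t\<bar> \<le> K"
    unfolding bounded_iff by (auto simp del: atLeastAtMost_iff)
  have K0: "0 \<le> K" using K[of 0] by auto
  have "\<bar>1 / Gamma (1 - s) - (\<Sum>i<n. s ^ i / fact i * D_inv_Gamma i)\<bar> \<le> K * \<bar>s\<bar> ^ n" if s: "\<bar>s\<bar> \<le> 1" for s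
  proof -
    obtain t where t: "\<bar>t\<bar> \<le> \<bar>s\<bar>" "d 0 s = (\<Sum>i<n. d i 0 / fact i * s ^ i) + d n t / fact n * s ^ n"
      using Maclaurin_all_le[of d "d 0" s n] d(2) by blast
    have "1 / Gamma (1 - s) - (\<Sum>i<n. s ^ i / fact i * D_inv_Gamma i) = d n t / fact n * s ^ n"
      using t(2) by (simp add: d(1) D_inv_Gamma_def d(3) mult_ac)
    then have "\<bar>1 / Gamma (1 - s) - (\<Sum>i<n. s ^ i / fact i * D_inv_Gamma i)\<bar> = \<bar>d n t\<bar> / fact n * \<bar>s\<bar> ^ n"
      by (simp add: abs_mult power_abs)
    also have "\<dots> \<le> K * \<bar>s\<bar> ^ n"
    proof (rule mult_right_mono)
      have "\<bar>d n t\<bar> / fact n \<le> \<bar>d n t\<bar> / 1"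
        by (intro divide_left_mono) (auto simp: fact_ge_1)
      also have "\<dots> \<le> K"
      proof -
        have "\<bar>t\<bar> \<le> 1" using t(1) s by linarith
        then show ?thesis using K[of t] by (simp add: abs_le_iff)
      qed
      finally show "\<bar>d n t\<bar> / fact n \<le> K" .
    qed simp
    finally show ?thesis .
  qed
  then show ?thesis using K0 by blast
qed

lemma D_inv_Gamma_0: "D_inv_Gamma 0 = 1"
  by (simp add: D_inv_Gamma_def)

lemma sum_triangle_antidiagonal:
  fixes A :: "nat \<Rightarrow> nat \<Rightarrow> 'a::comm_monoid_add"
  shows "(\<Sum>i<n. \<Sum>j\<le>i. A j (i - j)) = (\<Sum>j<n. \<Sum>k<n - j. A j k)"
proof (induction n)
  case (Suc n)
  have "(\<Sum>j<Suc n. \<Sum>k<Suc n - j. A j k) = (\<Sum>j<n. (\<Sum>k<n - j. A j k) + A j (n - j)) + A n 0"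
    by (simp add: Suc_diff_le)
  also have "\<dots> = (\<Sum>j<n. \<Sum>k<n - j. A j k) + (\<Sum>j\<le>n. A j (n - j))"
    by (simp add: sum.distrib lessThan_Suc_atMost[symmetric] add.assoc)
  finally show ?case using Suc by simp
qed simp

text \<open>
  Up to factorials and multiples of \<open>f x\<close>, the logarithms are the Taylor coefficients of the product
  of \<open>- s\<close>, \<open>1 / Gamma (1 - s)\<close> and the bracket of \<open>1 / t powr (1 + s)\<close>: the binomial coefficient in their definition is the Leibniz rule, and the factor
  \<open>- s\<close> shifts the order by one, which accounts for the factor \<open>m\<close>. The sum is arranged so
  that the term with the \<open>j\<close>-th logarithmic bracket carries the Taylor polynomial of degree below
  \<open>n - j\<close> of the reciprocal Gamma function.
\<close>

lemma sum_bessel_log: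
  "(\<Sum>k<Suc n. (s ^ k / fact k) *\<^sub>R bessel_log l k f x)
    = (\<Sum>k<Suc n. s ^ k / fact k * D_inv_Gamma k) *\<^sub>R f x
      - s *\<^sub>R (\<Sum>j<n. ((- s) ^ j / fact j * (\<Sum>i<n - j. s ^ i / fact i * D_inv_Gamma i))
          *\<^sub>R bessel_bracket l (\<lambda>t. ln t ^ j / t) f x)"
proof -
  define T where "T j = bessel_bracket l (\<lambda>t. ln t ^ j / t) f x" for j
  define S where "S k = (\<Sum>j<k. ((- 1) ^ j * real (k - 1 choose j) * D_inv_Gamma (k - j - 1)) *\<^sub>R T j)" for k
  define A where "A j i = ((- s) ^ j / fact j * (s ^ i / fact i * D_inv_Gamma i)) *\<^sub>R T j" for i j
  have "(\<Sum>k<Suc n. (s ^ k / fact k) *\<^sub>R bessel_log l k f x)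
    = (\<Sum>k<Suc n. (s ^ k / fact k * D_inv_Gamma k) *\<^sub>R f x - (s ^ k / fact k * real k) *\<^sub>R S k)"
    by (intro sum.cong refl) (simp add: bessel_log_def S_def T_def scaleR_diff_right)
  also have "\<dots> = (\<Sum>k<Suc n. s ^ k / fact k * D_inv_Gamma k) *\<^sub>R f x - (\<Sum>k<Suc n. (s ^ k / fact k * real k) *\<^sub>R S k)"
    by (simp only: sum_subtractf scaleR_sum_left)
  also have "(\<Sum>k<Suc n. (s ^ k / fact k * real k) *\<^sub>R S k) = (\<Sum>i<n. (s ^ Suc i / fact i) *\<^sub>R S (Suc i))"
    unfolding sum.lessThan_Suc_shift by (simp add: field_simps del: of_nat_Suc)
  also have "\<dots> = (\<Sum>i<n. s *\<^sub>R (\<Sum>j\<le>i. A j (i - j)))"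
  proof (rule sum.cong[OF refl])
    fix i assume "i \<in> {..<n}"
    have "(s ^ Suc i / fact i) *\<^sub>R S (Suc i)
      = s *\<^sub>R (\<Sum>j\<le>i. ((s ^ i / fact i) * ((- 1) ^ j * real (i choose j) * D_inv_Gamma (i - j))) *\<^sub>R T j)"
      by (simp add: S_def scaleR_sum_right lessThan_Suc_atMost mult_ac)
    also have "(\<Sum>j\<le>i. ((s ^ i / fact i) * ((- 1) ^ j * real (i choose j) * D_inv_Gamma (i - j))) *\<^sub>R T j)
      = (\<Sum>j\<le>i. A j (i - j))"
    proof (rule sum.cong[OF refl])
      fix j assume "j \<in> {..i}"
      then have j: "j \<le> i" by simp
      have "s ^ i = s ^ j * s ^ (i - j)" using j by (simp flip: power_add)
      then have "(s ^ i / fact i) * ((- 1) ^ j * real (i choose j) * D_inv_Gamma (i - j))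
        = (- s) ^ j / fact j * (s ^ (i - j) / fact (i - j) * D_inv_Gamma (i - j))"
        using j power_mult_distrib[of "- 1" s j] by (simp add: binomial_fact field_simps)
      then show "((s ^ i / fact i) * ((- 1) ^ j * real (i choose j) * D_inv_Gamma (i - j))) *\<^sub>R T j = A j (i - j)"
        by (simp add: A_def)
    qed
    finally show "(s ^ Suc i / fact i) *\<^sub>R S (Suc i) = s *\<^sub>R (\<Sum>j\<le>i. A j (i - j))" .
  qed
  also have "\<dots> = s *\<^sub>R (\<Sum>j<n. \<Sum>k<n - j. A j k)"
    by (simp only: scaleR_sum_right[symmetric] sum_triangle_antidiagonal)
  also have "\<dots> = s *\<^sub>R (\<Sum>j<n. ((- s) ^ j / fact j * (\<Sum>i<n - j. s ^ i / fact i * D_inv_Gamma i)) *\<^sub>R T j)"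
    by (simp add: A_def sum_distrib_left scaleR_sum_left)
  finally show ?thesis by (simp add: T_def)
qed

text \<open>
  Thus the statement on negative powers is that on positive powers with a negative parameter.
\<close>

lemma bessel_neg_pow_eq: "bessel_neg_pow l s f x = bessel_pow l (- s) f x"
proof -
  have "(\<lambda>t. 1 / t powr (1 + - s)) = (\<lambda>t. t powr (s - 1))"
    by (rule ext) (simp add: powr_minus_divide[symmetric])
  then show ?thesis by (simp add: bessel_neg_pow_def bessel_pow_def)
qed

context bessel_log_setting
begin

lemma dominated_weight_ln_power: "dominated_weight (fact j / e ^ j) (\<lambda>t. ln t ^ j / t)"
  using e ln_power_weight by (auto simp: dominated_weight_def)

lemma dominated_weight_remainder:
  assumes "\<bar>s\<bar> \<le> e / 2"
  shows "dominated_weight ((2 / e) ^ n * \<bar>s\<bar> ^ n)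
    (\<lambda>t. 1 / t powr (1 + s) - (\<Sum>j<n. ((- s) ^ j / fact j) * (ln t ^ j / t)))"
  using e power_weight_remainder[OF e(1) assms] by (auto simp: dominated_weight_def)

lemma dominated_weight_power:
  assumes "\<bar>s\<bar> \<le> e / 2"
  shows "dominated_weight 1 (\<lambda>t. 1 / t powr (1 + s))"
  using dominated_weight_remainder[OF assms, of 0] by simp

lemma borel_measurable_f_pos: "f \<in> borel_measurable lborel_pos"
  by (intro measurable_restrict_space1) simp

lemma borel_measurable_bessel_pow:
  assumes "\<bar>s\<bar> \<le> e / 2"
  shows "bessel_pow l s f \<in> borel_measurable lborel_pos"
proof -
  note [measurable] = borel_measurable_bracket[OF dominated_weight_power[OF assms]] borel_measurable_f_pos
  show ?thesis unfolding bessel_pow_def by measurable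
qed

lemma borel_measurable_bessel_log: "bessel_log l k f \<in> borel_measurable lborel_pos"
proof -
  note [measurable] = borel_measurable_bracket[OF dominated_weight_ln_power] borel_measurable_f_pos
  show ?thesis unfolding bessel_log_def by measurable
qed

lemma f_decay: "0 < x \<Longrightarrow> norm (f x) \<le> (M * (2 + b)) * (1 + x) powr (- \<beta>)"
proof (cases "x \<le> b")
  case True
  assume "0 < x"
  then have "M * 1 \<le> M * ((2 + b) * (1 + x) powr (- \<beta>))"
    using True M_nonneg by (intro mult_left_mono decay_ge_1) auto
  then show ?thesis using f_bound[of x] by simp
next
  case False
  then show ?thesis using f_support[of x] M_nonneg b by simp
qed

text \<open>
  The error splits into the Taylor errors of \<open>1 / Gamma (1 - s)\<close>, to order \<open>n + 1\<close> in front of \<open>f\<close> and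
  to order \<open>n - j\<close> in front of the \<open>j\<close>-th logarithmic bracket, which itself comes with \<open>s ^ j\<close>, and the
  Taylor error of the weight. The common factor \<open>s\<close> in front of the brackets raises all orders
  to \<open>n + 1\<close>.
\<close>

theorem bessel_pow_expansion:
  "\<exists>C. \<forall>s x. \<bar>s\<bar> \<le> e / 2 \<longrightarrow> 0 < x \<longrightarrow>
    norm (bessel_pow l s f x - (\<Sum>k<Suc n. (s ^ k / fact k) *\<^sub>R bessel_log l k f x))
      \<le> C * \<bar>s\<bar> ^ Suc n * (1 + x) powr (- \<beta>)"
proof -
  define T where "T j = bessel_bracket l (\<lambda>t. ln t ^ j / t) f" for j
  define g where "g s = 1 / Gamma (1 - s)" for s :: real
  define P where "P k s = (\<Sum>i<k. s ^ i / fact i * D_inv_Gamma i)" for k and s :: real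
  define C where "C = bracket_constant"
  have "\<forall>k. \<exists>K. 0 \<le> K \<and> (\<forall>s. \<bar>s\<bar> \<le> 1 \<longrightarrow> \<bar>g s - P k s\<bar> \<le> K * \<bar>s\<bar> ^ k)"
    using inverse_Gamma_taylor by (simp add: g_def P_def)
  then obtain K where K: "\<And>k. 0 \<le> K k" "\<And>k s. \<bar>s\<bar> \<le> 1 \<Longrightarrow> \<bar>g s - P k s\<bar> \<le> K k * \<bar>s\<bar> ^ k"
    by metis
  define C' where "C' = K (Suc n) * (M * (2 + b)) + (K 0 * ((2 / e) ^ n * C) + (\<Sum>j<n. K (n - j) * (fact j / e ^ j * C)))"
  have "norm (bessel_pow l s f x - (\<Sum>k<Suc n. (s ^ k / fact k) *\<^sub>R bessel_log l k f x))
      \<le> C' * \<bar>s\<bar> ^ Suc n * (1 + x) powr (- \<beta>)" if s: "\<bar>s\<bar> \<le> e / 2" and x: "0 < x" for s x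
  proof -
    have s1: "\<bar>s\<bar> \<le> 1" using s e_less by linarith
    define N where "N = (1 + x) powr (- \<beta>)"
    have N: "0 \<le> N" by (simp add: N_def)
    define B where "B = bessel_bracket l (\<lambda>t. 1 / t powr (1 + s)) f x"
    define R where "R = B - (\<Sum>j<n. ((- s) ^ j / fact j) *\<^sub>R T j x)"
    have R: "norm R \<le> ((2 / e) ^ n * \<bar>s\<bar> ^ n) * C * N"
      unfolding R_def B_def T_def N_def
      unfolding C_def by (rule norm_bessel_bracket_diff_le[OF dominated_weight_power[OF s]
          dominated_weight_ln_power dominated_weight_remainder[OF s] x])
    have T: "norm (T j x) \<le> fact j / e ^ j * C * N" for j
      unfolding T_def N_def C_def by (rule norm_bessel_bracket_le[OF dominated_weight_ln_power x])
    have g0: "\<bar>g s\<bar> \<le> K 0" using K(2)[OF s1, of 0] by (simp add: P_def)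
    have "bessel_pow l s f x - (\<Sum>k<Suc n. (s ^ k / fact k) *\<^sub>R bessel_log l k f x)
      = (g s - P (Suc n) s) *\<^sub>R f x
        - s *\<^sub>R (g s *\<^sub>R B - (\<Sum>j<n. ((- s) ^ j / fact j * P (n - j) s) *\<^sub>R T j x))"
      unfolding sum_bessel_log bessel_pow_def B_def T_def g_def P_def
      by (simp add: scaleR_diff_left scaleR_diff_right)
    also have "g s *\<^sub>R B - (\<Sum>j<n. ((- s) ^ j / fact j * P (n - j) s) *\<^sub>R T j x)
      = g s *\<^sub>R R + (\<Sum>j<n. ((- s) ^ j / fact j * (g s - P (n - j) s)) *\<^sub>R T j x)"
      unfolding R_def
      by (simp add: scaleR_diff_right scaleR_sum_right right_diff_distrib scaleR_diff_left sum_subtractf mult_ac)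
    finally have "norm (bessel_pow l s f x - (\<Sum>k<Suc n. (s ^ k / fact k) *\<^sub>R bessel_log l k f x))
      \<le> \<bar>g s - P (Suc n) s\<bar> * norm (f x) + \<bar>s\<bar> * (\<bar>g s\<bar> * norm R
          + (\<Sum>j<n. \<bar>(- s) ^ j / fact j * (g s - P (n - j) s)\<bar> * norm (T j x)))"
      by (auto intro!: order_trans[OF norm_triangle_ineq4] order_trans[OF norm_triangle_ineq]
          order_trans[OF norm_sum] add_mono mult_left_mono sum_mono)
    also have "\<dots> \<le> (K (Suc n) * \<bar>s\<bar> ^ Suc n) * ((M * (2 + b)) * N)
      + \<bar>s\<bar> * (K 0 * (((2 / e) ^ n * \<bar>s\<bar> ^ n) * C * N) + (\<Sum>j<n. (K (n - j) * \<bar>s\<bar> ^ n) * (fact j / e ^ j * C * N)))"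
    proof (intro add_mono mult_left_mono sum_mono)
      show "\<bar>g s - P (Suc n) s\<bar> * norm (f x) \<le> (K (Suc n) * \<bar>s\<bar> ^ Suc n) * ((M * (2 + b)) * N)"
        unfolding N_def by (intro mult_mono K(2)[OF s1] f_decay[OF x]) (auto intro!: mult_nonneg_nonneg K(1))
      show "\<bar>g s\<bar> * norm R \<le> K 0 * (((2 / e) ^ n * \<bar>s\<bar> ^ n) * C * N)"
        using g0 R K(1) by (intro mult_mono) auto
      fix j assume j: "j \<in> {..<n}"
      have "\<bar>(- s) ^ j / fact j * (g s - P (n - j) s)\<bar> \<le> \<bar>s\<bar> ^ j * (K (n - j) * \<bar>s\<bar> ^ (n - j))"
        unfolding abs_mult
      proof (intro mult_mono K(2)[OF s1])
        have "\<bar>s\<bar> ^ j / fact j \<le> \<bar>s\<bar> ^ j / 1"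
          by (intro divide_left_mono) (auto simp: fact_ge_1)
        then show "\<bar>(- s) ^ j / fact j\<bar> \<le> \<bar>s\<bar> ^ j" by (simp add: power_abs)
      qed auto
      also have "\<dots> = K (n - j) * \<bar>s\<bar> ^ n"
        using j by (simp add: power_add[symmetric])
      finally show "\<bar>(- s) ^ j / fact j * (g s - P (n - j) s)\<bar> * norm (T j x)
          \<le> (K (n - j) * \<bar>s\<bar> ^ n) * (fact j / e ^ j * C * N)"
        using T K(1) by (intro mult_mono) auto
    qed auto
    also have "\<dots> = C' * \<bar>s\<bar> ^ Suc n * N"
      unfolding C'_def by (simp add: algebra_simps sum_distrib_left sum_distrib_right)
    finally show ?thesis by (simp add: N_def)
  qed
  then show ?thesis by blast
qed

lemma bessel_log_decay: "\<exists>C. \<forall>x>0. norm (bessel_log l k f x) \<le> C * (1 + x) powr (- \<beta>)"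
proof -
  define C where "C = bracket_constant"
  define c where "c j = (- 1) ^ j * real (k - 1 choose j) * D_inv_Gamma (k - j - 1)" for j
  have "norm (bessel_log l k f x)
    \<le> (real k * (\<Sum>j<k. \<bar>c j\<bar> * (fact j / e ^ j * C)) + \<bar>D_inv_Gamma k\<bar> * (M * (2 + b))) * (1 + x) powr (- \<beta>)"
    if x: "0 < x" for x
  proof -
    have "norm (bessel_log l k f x) \<le> real k * norm (\<Sum>j<k. c j *\<^sub>R bessel_bracket l (\<lambda>t. ln t ^ j / t) f x)
       + \<bar>D_inv_Gamma k\<bar> * norm (f x)"
      unfolding bessel_log_def c_def[symmetric]
      by (rule order_trans[OF norm_triangle_ineq]) simp
    also have "norm (\<Sum>j<k. c j *\<^sub>R bessel_bracket l (\<lambda>t. ln t ^ j / t) f x)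
      \<le> (\<Sum>j<k. \<bar>c j\<bar> * (fact j / e ^ j * C * (1 + x) powr (- \<beta>)))"
    proof (rule order_trans[OF norm_sum], rule sum_mono)
      fix j assume "j \<in> {..<k}"
      show "norm (c j *\<^sub>R bessel_bracket l (\<lambda>t. ln t ^ j / t) f x)
          \<le> \<bar>c j\<bar> * (fact j / e ^ j * C * (1 + x) powr (- \<beta>))"
        unfolding norm_scaleR C_def
        by (intro mult_left_mono norm_bessel_bracket_le[OF dominated_weight_ln_power x]) simp
    qed
    also have "norm (f x) \<le> (M * (2 + b)) * (1 + x) powr (- \<beta>)" by (rule f_decay[OF x])
    finally show ?thesis
      by (simp add: distrib_right sum_distrib_right mult.assoc add_mono mult_left_mono)
  qed
  then show ?thesis by blast
qed

end

section \<open>Convergence in the Lebesgue spaces\<close>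

lemma emeasure_lborel_pos_space: "emeasure lborel_pos (space lborel_pos) \<noteq> 0"
proof -
  have "emeasure lborel {0<..1::real} \<le> emeasure lborel {0::real<..}"
    by (intro emeasure_mono) auto
  then have "1 \<le> emeasure lborel {0::real<..}" by simp
  then have "emeasure lborel {0::real<..} \<noteq> 0" by auto
  then show ?thesis by (simp add: space_restrict_space emeasure_restrict_space)
qed

lemma integrable_decay:
  assumes "1 < (r::real)"
  shows "integrable lborel_pos (\<lambda>x. (1 + x) powr (- r))"
proof -
  have "((\<lambda>t. t powr (- r)) has_integral - (1 powr ((- r) + 1)) / ((- r) + 1)) {1::real..}"
    using assms by (intro has_integral_powr_to_inf) auto
  then have "(\<lambda>t. t powr (- r)) absolutely_integrable_on {1::real..}"
    by (subst absolutely_integrable_on_iff_nonneg) (auto simp: integrable_on_def)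
  then have "integrable lborel (\<lambda>t. indicator {1..} t *\<^sub>R t powr (- r))"
    unfolding set_integrable_def by (subst (asm) integrable_completion) auto
  from lborel_integrable_real_affine[OF this, of 1 1]
  have 1: "integrable lborel (\<lambda>t. indicator {1..} (1 + t) *\<^sub>R (1 + t) powr (- r))" by simp
  have "integrable lborel (\<lambda>t. indicator {0<..} t *\<^sub>R (1 + t) powr (- r))"
    by (rule Bochner_Integration.integrable_bound[OF 1]) (auto simp: indicator_def)
  then show ?thesis by (subst integrable_restrict_space) auto
qed

text \<open>
  For \<open>p = \<infinity>\<close> the decay factor is at most 1; for finite \<open>p\<close> its \<open>p\<close>-th power is integrable.
\<close>

lemma Lp_of_decay:
  assumes p: "1 < p" and \<beta>: "0 < \<beta>" "p \<noteq> \<infinity> \<Longrightarrow> 1 < \<beta> * enn2real p"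
  shows "\<exists>K. \<forall>C\<ge>0. \<forall>h\<in>borel_measurable lborel_pos. (\<forall>x>0. norm (h x :: complex) \<le> C * (1 + x) powr (- \<beta>)) \<longrightarrow>
    h \<in> Lp_space lborel_pos p \<and> 0 \<le> Lp_norm lborel_pos p h \<and> Lp_norm lborel_pos p h \<le> C * K"
proof (cases "p = \<infinity>")
  case True
  have "h \<in> Lp_space lborel_pos p \<and> 0 \<le> Lp_norm lborel_pos p h \<and> Lp_norm lborel_pos p h \<le> C * 1"
    if C: "0 \<le> C" and h [measurable]: "h \<in> borel_measurable lborel_pos"
      and le: "\<And>x. 0 < x \<Longrightarrow> norm (h x) \<le> C * (1 + x) powr (- \<beta>)" for C and h :: "real \<Rightarrow> complex"
  proof -
    let ?E = "esssup lborel_pos (\<lambda>x. ereal (norm (h x)))"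
    have "ereal (norm (h x)) \<le> ereal C" if "x \<in> space lborel_pos" for x
    proof -
      have "0 < x" using that by (simp add: space_restrict_space)
      then have "C * (1 + x) powr (- \<beta>) \<le> C * (1 + x) powr 0"
        using C \<beta> by (intro mult_left_mono powr_mono) auto
      then show ?thesis using le[OF \<open>0 < x\<close>] \<open>0 < x\<close> by simp
    qed
    then have up: "?E \<le> ereal C"
      by (intro esssup_I AE_I2) auto
    have "esssup lborel_pos (\<lambda>x. 0 :: ereal) \<le> ?E"
      by (intro esssup_AE_mono AE_I2) auto
    then have lo: "0 \<le> ?E"
      by (simp add: esssup_const[OF emeasure_lborel_pos_space])
    have "?E < \<infinity>" using up by (rule le_less_trans) simp
    moreover have "0 \<le> real_of_ereal ?E" using lo by (rule real_of_ereal_pos)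
    moreover have "real_of_ereal ?E \<le> C"
      using up lo by (cases ?E) auto
    ultimately show ?thesis using True h by (simp add: Lp_space_def Lp_norm_def)
  qed
  then show ?thesis by blast
next
  case False
  define q where "q = enn2real p"
  have q: "1 < q"
  proof -
    have "enn2real 1 < enn2real p"
      using p False by (subst enn2real_less_iff) (auto simp: less_top)
    then show ?thesis by (simp add: q_def)
  qed
  have \<beta>q: "1 < \<beta> * q" using \<beta>(2)[OF False] by (simp add: q_def)
  define J where "J = (\<integral>x. (1 + x) powr (- (\<beta> * q)) \<partial>lborel_pos)"
  have J: "0 \<le> J" by (simp add: J_def)
  have "h \<in> Lp_space lborel_pos p \<and> 0 \<le> Lp_norm lborel_pos p h \<and> Lp_norm lborel_pos p h \<le> C * J powr (1 / q)"
    if C: "0 \<le> C" and h [measurable]: "h \<in> borel_measurable lborel_pos"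
      and le: "\<And>x. 0 < x \<Longrightarrow> norm (h x) \<le> C * (1 + x) powr (- \<beta>)" for C and h :: "real \<Rightarrow> complex"
  proof -
    have bound: "norm (h x) powr q \<le> C powr q * (1 + x) powr (- (\<beta> * q))" if "x \<in> space lborel_pos" for x
    proof -
      have x: "0 < x" using that by (simp add: space_restrict_space)
      have "norm (h x) powr q \<le> (C * (1 + x) powr (- \<beta>)) powr q"
        using le[OF x] q by (intro powr_mono2) auto
      also have "\<dots> = C powr q * (1 + x) powr (- (\<beta> * q))"
        using C x by (simp add: powr_mult powr_powr)
      finally show ?thesis .
    qed
    have I: "integrable lborel_pos (\<lambda>x. C powr q * (1 + x) powr (- (\<beta> * q)))"
      by (intro integrable_mult_right integrable_decay \<beta>q)
    have Ih: "integrable lborel_pos (\<lambda>x. norm (h x) powr q)"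
      by (rule Bochner_Integration.integrable_bound[OF I]) (use bound in \<open>auto intro!: AE_I2\<close>)
    have "(\<integral>x. norm (h x) powr q \<partial>lborel_pos) \<le> (\<integral>x. C powr q * (1 + x) powr (- (\<beta> * q)) \<partial>lborel_pos)"
      by (rule integral_mono[OF Ih I bound])
    also have "\<dots> = C powr q * J" by (simp add: J_def)
    finally have "(\<integral>x. norm (h x) powr q \<partial>lborel_pos) powr (1 / q) \<le> (C powr q * J) powr (1 / q)"
      using q by (intro powr_mono2) auto
    also have "\<dots> = C * J powr (1 / q)"
      using C J q by (simp add: powr_mult powr_powr)
    finally show ?thesis
      using False Ih h by (simp add: Lp_space_def Lp_norm_def q_def)
  qed
  then show ?thesis by blast
qed

text \<open>
  A pointwise error of first order in \<open>s\<close> with a fixed decaying majorant gives convergence at rate \<open>s\<close>.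
\<close>

lemma tendsto_Lp_of_decay:
  fixes g :: "real \<Rightarrow> complex"
  assumes p: "1 < p" and \<beta>: "0 < \<beta>" "p \<noteq> \<infinity> \<Longrightarrow> 1 < \<beta> * enn2real p"
    and g: "g \<in> borel_measurable lborel_pos" "\<And>x. 0 < x \<Longrightarrow> norm (g x) \<le> B * (1 + x) powr (- \<beta>)"
    and \<delta>: "0 < \<delta>"
    and G: "\<And>s. 0 < s \<Longrightarrow> s < \<delta> \<Longrightarrow> G s \<in> borel_measurable lborel_pos"
      "\<And>s x. 0 < s \<Longrightarrow> s < \<delta> \<Longrightarrow> 0 < x \<Longrightarrow> norm (G s x - g x) \<le> (C * s) * (1 + x) powr (- \<beta>)"
  shows "tendsto_Lp lborel_pos p G g (at_right 0)"
proof -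
  obtain K where K: "\<And>C h. 0 \<le> C \<Longrightarrow> h \<in> borel_measurable lborel_pos \<Longrightarrow>
    (\<And>x. 0 < x \<Longrightarrow> norm (h x :: complex) \<le> C * (1 + x) powr (- \<beta>)) \<Longrightarrow>
    h \<in> Lp_space lborel_pos p \<and> 0 \<le> Lp_norm lborel_pos p h \<and> Lp_norm lborel_pos p h \<le> C * K"
    using Lp_of_decay[OF p \<beta>] by blast
  have nonneg: "0 \<le> D" if "norm (z::complex) \<le> D * (1 + 1) powr (- \<beta>)" for z D
    using order_trans[OF norm_ge_zero that] by (simp add: zero_le_mult_iff not_le)
  have B: "0 \<le> B" using nonneg g(2)[of 1] by simp
  have small: "\<forall>\<^sub>F s in at_right 0. 0 < s \<and> s < \<delta>"
    unfolding eventually_at_right_field using \<delta> by blast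
  have diff: "Lp_norm lborel_pos p (\<lambda>x. G s x - g x) \<le> \<bar>C\<bar> * s * K \<and> 0 \<le> Lp_norm lborel_pos p (\<lambda>x. G s x - g x)"
    and mem: "G s \<in> Lp_space lborel_pos p" if s: "0 < s" "s < \<delta>" for s
  proof -
    have Cs: "norm (G s x - g x) \<le> (\<bar>C\<bar> * s) * (1 + x) powr (- \<beta>)" if "0 < x" for x
      by (rule order_trans[OF G(2)[OF s that]]) (use s in \<open>auto intro!: mult_right_mono\<close>)
    show "Lp_norm lborel_pos p (\<lambda>x. G s x - g x) \<le> \<bar>C\<bar> * s * K \<and> 0 \<le> Lp_norm lborel_pos p (\<lambda>x. G s x - g x)"
      using K[of "\<bar>C\<bar> * s" "\<lambda>x. G s x - g x"] Cs s G(1)[OF s] g(1) by simp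
    have "norm (G s x) \<le> (\<bar>C\<bar> * s + B) * (1 + x) powr (- \<beta>)" if "0 < x" for x
      using norm_triangle_ineq[of "G s x - g x" "g x"] Cs[OF that] g(2)[OF that]
      by (simp add: distrib_right)
    then show "G s \<in> Lp_space lborel_pos p"
      using K[of "\<bar>C\<bar> * s + B" "G s"] B s G(1)[OF s] by simp
  qed
  show ?thesis
    unfolding tendsto_Lp_def
  proof (intro conjI)
    show "g \<in> Lp_space lborel_pos p" using K[OF B g] by simp
    show "\<forall>\<^sub>F s in at_right 0. G s \<in> Lp_space lborel_pos p"
      using small by (rule eventually_mono) (use mem in auto)
    show "((\<lambda>s. Lp_norm lborel_pos p (\<lambda>x. G s x - g x)) \<longlongrightarrow> 0) (at_right 0)"
    proof (rule tendsto_sandwich)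
      show "\<forall>\<^sub>F s in at_right 0. 0 \<le> Lp_norm lborel_pos p (\<lambda>x. G s x - g x)"
        using small by (rule eventually_mono) (use diff in auto)
      show "\<forall>\<^sub>F s in at_right 0. Lp_norm lborel_pos p (\<lambda>x. G s x - g x) \<le> \<bar>C\<bar> * s * K"
        using small by (rule eventually_mono) (use diff in auto)
      show "((\<lambda>s. \<bar>C\<bar> * s * K) \<longlongrightarrow> 0) (at_right 0)"
        by (auto intro!: tendsto_eq_intros)
    qed simp
  qed
qed

text \<open>
  Only the values on the open half-line matter, so \<open>f\<close> may be replaced by its extension by 0, which
  is measurable on the whole line.
\<close>

lemma bessel_bracket_cong:
  assumes "\<And>y. 0 < y \<Longrightarrow> f y = g y" "0 < x"
  shows "bessel_bracket l \<phi> f x = bessel_bracket l \<phi> g x"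
proof -
  have "(LINT y:{0<..}|lborel. (LINT t:{0<..}|lborel. W_bessel l t x y * \<phi> t) *\<^sub>R
         (f y - indicator (Bpos x 1) y * f x))
    = (LINT y:{0<..}|lborel. (LINT t:{0<..}|lborel. W_bessel l t x y * \<phi> t) *\<^sub>R
         (g y - indicator (Bpos x 1) y * g x))"
    using assms by (intro set_lebesgue_integral_cong) auto
  then show ?thesis
    using assms by (simp add: bessel_bracket_def)
qed

lemma bessel_pow_cong:
  assumes "\<And>y. 0 < y \<Longrightarrow> f y = g y" "0 < x"
  shows "bessel_pow l s f x = bessel_pow l s g x"
  using assms bessel_bracket_cong[of f g x] by (simp add: bessel_pow_def)

lemma bessel_log_cong:
  assumes "\<And>y. 0 < y \<Longrightarrow> f y = g y" "0 < x"
  shows "bessel_log l k f x = bessel_log l k g x"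
  using assms bessel_bracket_cong[of f g x] by (simp add: bessel_log_def)

text \<open>
  The support is a compact subset of the open half-line, hence contained in some \<open>[a, b]\<close> with \<open>a > 0\<close>.
\<close>

lemma bessel_log_setting_exists:
  assumes \<theta>: "0 < \<theta>" "\<theta> \<le> 1" and f: "f \<in> Cc_pos \<inter> Lip_loc_uni \<theta>" and l: "- 1 / 2 < l"
    and e: "0 < e" "4 * e < \<theta>"
  shows "\<exists>a b M L. bessel_log_setting l \<theta> e a b M L (\<lambda>x. indicator {0<..} x *\<^sub>R f x)"
proof -
  let ?f = "\<lambda>x. indicator {0<..} x *\<^sub>R f x"
  define S where "S = closure (support_on {0<..} f)"
  have cont: "continuous_on {0<..} f" and S: "compact S" "S \<subseteq> {0<..}"
    using f by (auto simp: Cc_pos_def S_def)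
  have supp: "?f x = 0" if "x \<notin> S" for x
    using that closure_subset[of "support_on {0<..} f"] by (auto simp: S_def support_on_def indicator_def)
  obtain a b where ab: "0 < a" "0 < b" "S \<subseteq> {a..b}"
  proof (cases "S = {}")
    case True
    then show ?thesis using that[of 1 1] by simp
  next
    case False
    obtain u where u: "u \<in> S" "\<And>y. y \<in> S \<Longrightarrow> u \<le> y"
      using compact_attains_inf[OF S(1) False] by blast
    obtain v where v: "v \<in> S" "\<And>y. y \<in> S \<Longrightarrow> y \<le> v"
      using compact_attains_sup[OF S(1) False] by blast
    show ?thesis
      by (rule that[of u v]) (use u v S(2) in auto)
  qed
  have "continuous_on {a..b} f"
    by (rule continuous_on_subset[OF cont]) (use ab in auto)
  then have "bounded (f ` {a..b})"
    by (intro compact_imp_bounded compact_continuous_image) auto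
  then obtain M where M: "\<And>x. x \<in> {a..b} \<Longrightarrow> norm (f x) \<le> M"
    unfolding bounded_iff by blast
  have bound: "norm (?f x) \<le> max M 0" for x
    using M[of x] supp[of x] ab by (cases "x \<in> S") (auto simp: indicator_def)
  have "(SUP x\<in>{0<..}. Lip_loc_norm \<theta> x f) < top"
    using f by (simp add: Lip_loc_uni_def)
  then obtain L where L: "0 \<le> L" "(SUP x\<in>{0<..}. Lip_loc_norm \<theta> x f) = ennreal L"
    by (cases "SUP x\<in>{0<..}. Lip_loc_norm \<theta> x f" rule: ennreal_cases) auto
  have holder: "norm (f x - f y) \<le> L * \<bar>x - y\<bar> powr \<theta>" if "0 < x" "0 < y" "\<bar>x - y\<bar> < 1" for x y
  proof (cases "x = y")
    case False
    have "ennreal (norm (f x - f y) / \<bar>x - y\<bar> powr \<theta>) \<le> Lip_loc_norm \<theta> x f"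
      unfolding Lip_loc_norm_def using that by (intro SUP_upper) (auto simp: Bpos_def)
    also have "\<dots> \<le> (SUP x\<in>{0<..}. Lip_loc_norm \<theta> x f)"
      using that by (intro SUP_upper) auto
    finally have "norm (f x - f y) / \<bar>x - y\<bar> powr \<theta> \<le> L"
      using L by simp
    then show ?thesis using False by (simp add: divide_le_eq)
  qed simp
  have "bessel_log_setting l \<theta> e a b (max M 0) L ?f"
  proof
    show "?f \<in> borel_measurable borel"
      by (intro borel_measurable_continuous_on_indicator cont) simp
    show "?f x = 0" if "x \<notin> {a..b}" for x
    proof -
      have "x \<notin> S" using that ab by auto
      then show ?thesis by (rule supp)
    qed
    show "norm (?f x - ?f y) \<le> L * \<bar>x - y\<bar> powr \<theta>" if "0 < x" "0 < y" "\<bar>x - y\<bar> < 1" for x y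
      using holder[OF that] that by simp
  qed (use assms ab L bound in auto)
  then show ?thesis by blast
qed

text \<open>
  The leading term \<open>f\<close> is the logarithm of order 0, because \<open>1 / Gamma 1 = 1\<close>.
\<close>

lemma sum_from_zeroth_log:
  "f x + (\<Sum>j=1..m. (s ^ j / fact j) *\<^sub>R bessel_log l j f x) = (\<Sum>k<Suc m. (s ^ k / fact k) *\<^sub>R bessel_log l k f x)"
proof -
  have "bessel_log l 0 f x = f x" by (simp add: bessel_log_def D_inv_Gamma_0)
  then have "(\<Sum>k<Suc m. (s ^ k / fact k) *\<^sub>R bessel_log l k f x)
    = f x + (\<Sum>k<m. (s ^ Suc k / fact (Suc k)) *\<^sub>R bessel_log l (Suc k) f x)"
    unfolding sum.lessThan_Suc_shift by simp
  also have "(\<Sum>k<m. (s ^ Suc k / fact (Suc k)) *\<^sub>R bessel_log l (Suc k) f x)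
    = (\<Sum>j=1..m. (s ^ j / fact j) *\<^sub>R bessel_log l j f x)"
    by (simp add: sum.atLeast1_atMost_eq del: power_Suc fact_Suc)
  finally show ?thesis by simp
qed

context bessel_log_setting
begin

text \<open>
  Both limits at once: \<open>\<sigma>\<close> is the sign of the exponent. The expansion is used to order \<open>m + 2\<close>, one
  order beyond the power \<open>s ^ (m + 1)\<close> by which the remainder is divided.
\<close>

lemma tendsto_Lp_remainder:
  fixes h :: "real \<Rightarrow> complex" and \<sigma> :: real
  assumes p: "1 < p" "p \<noteq> \<infinity> \<Longrightarrow> 1 < \<beta> * enn2real p"
    and h: "\<And>y. 0 < y \<Longrightarrow> h y = f y" and \<sigma>: "\<bar>\<sigma>\<bar> = 1"
  shows "tendsto_Lp lborel_pos p
       (\<lambda>s x. (fact (m + 1) / s ^ (m + 1)) *\<^sub>R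
          (bessel_pow l (\<sigma> * s) h x - (h x + (\<Sum>j=1..m. ((\<sigma> * s) ^ j / fact j) *\<^sub>R bessel_log l j h x))))
       (\<lambda>x. \<sigma> ^ (m + 1) *\<^sub>R bessel_log l (m + 1) h x) (at_right 0)"
proof -
  obtain C where C: "\<And>s x. \<bar>s\<bar> \<le> e / 2 \<Longrightarrow> 0 < x \<Longrightarrow>
    norm (bessel_pow l s f x - (\<Sum>k<Suc (Suc m). (s ^ k / fact k) *\<^sub>R bessel_log l k f x))
      \<le> C * \<bar>s\<bar> ^ Suc (Suc m) * (1 + x) powr (- \<beta>)"
    using bessel_pow_expansion by blast
  obtain B where B: "\<And>x. 0 < x \<Longrightarrow> norm (bessel_log l (m + 1) f x) \<le> B * (1 + x) powr (- \<beta>)"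
    using bessel_log_decay by blast
  have pow: "bessel_pow l s h x = bessel_pow l s f x" if "0 < x" for s x
    by (rule bessel_pow_cong) (use h that in auto)
  have log: "bessel_log l k h x = bessel_log l k f x" if "0 < x" for k x
    by (rule bessel_log_cong) (use h that in auto)
  have h_meas: "h \<in> borel_measurable lborel_pos"
    by (subst measurable_cong[of _ _ f]) (auto simp: space_restrict_space h borel_measurable_f_pos)
  have log_meas: "bessel_log l k h \<in> borel_measurable lborel_pos" for k
    by (subst measurable_cong[of _ _ "bessel_log l k f"])
      (auto simp: space_restrict_space log borel_measurable_bessel_log)
  have pow_meas: "bessel_pow l s h \<in> borel_measurable lborel_pos" if "\<bar>s\<bar> \<le> e / 2" for s
    by (subst measurable_cong[of _ _ "bessel_pow l s f"])
      (use borel_measurable_bessel_pow[OF that] in \<open>auto simp: space_restrict_space pow\<close>)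
  show ?thesis
  proof (rule tendsto_Lp_of_decay[OF p(1) \<beta>(1) p(2)])
    show "0 < e / 2" using e by simp
    show "(\<lambda>x. \<sigma> ^ (m + 1) *\<^sub>R bessel_log l (m + 1) h x) \<in> borel_measurable lborel_pos"
      using log_meas by measurable
    show "norm (\<sigma> ^ (m + 1) *\<^sub>R bessel_log l (m + 1) h x) \<le> B * (1 + x) powr (- \<beta>)" if "0 < x" for x
    proof -
      have "\<bar>\<sigma> ^ (m + 1)\<bar> = 1" by (simp only: power_abs \<sigma> power_one)
      then show ?thesis using B[OF that] by (simp only: norm_scaleR log[OF that] mult_1_left)
    qed
  next
    fix s :: real assume s: "0 < s" "s < e / 2"
    then have \<sigma>s: "\<bar>\<sigma> * s\<bar> = s" using \<sigma> by (simp add: abs_mult)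
    note [measurable] = pow_meas[of "\<sigma> * s"] log_meas h_meas
    have [measurable]: "bessel_pow l (\<sigma> * s) h \<in> borel_measurable lborel_pos"
      using pow_meas[of "\<sigma> * s"] s \<sigma>s by simp
    show "(\<lambda>x. (fact (m + 1) / s ^ (m + 1)) *\<^sub>R
          (bessel_pow l (\<sigma> * s) h x - (h x + (\<Sum>j=1..m. ((\<sigma> * s) ^ j / fact j) *\<^sub>R bessel_log l j h x))))
        \<in> borel_measurable lborel_pos"
      by measurable
    fix x :: real assume x: "0 < x"
    let ?c = "fact (m + 1) / s ^ (m + 1)" and ?t = "\<sigma> * s"
    define E where "E = bessel_pow l ?t f x - (\<Sum>k<Suc (Suc m). (?t ^ k / fact k) *\<^sub>R bessel_log l k f x)"
    have split: "(\<Sum>k<Suc (Suc m). (?t ^ k / fact k) *\<^sub>R bessel_log l k f x)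
        = (\<Sum>k<Suc m. (?t ^ k / fact k) *\<^sub>R bessel_log l k f x)
          + (?t ^ (m + 1) / fact (m + 1)) *\<^sub>R bessel_log l (m + 1) f x"
      by (subst sum.lessThan_Suc) simp
    have "?c * (?t ^ (m + 1) / fact (m + 1)) = \<sigma> ^ (m + 1)"
      using s by (simp add: power_mult_distrib del: fact_Suc power_Suc)
    then have "?c *\<^sub>R (?t ^ (m + 1) / fact (m + 1)) *\<^sub>R bessel_log l (m + 1) f x
        = \<sigma> ^ (m + 1) *\<^sub>R bessel_log l (m + 1) f x"
      by (simp only: scaleR_scaleR)
    then have "?c *\<^sub>R E = ?c *\<^sub>R bessel_pow l ?t f x
        - (?c *\<^sub>R (\<Sum>k<Suc m. (?t ^ k / fact k) *\<^sub>R bessel_log l k f x)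
          + \<sigma> ^ (m + 1) *\<^sub>R bessel_log l (m + 1) f x)"
      unfolding E_def split scaleR_diff_right scaleR_add_right by (simp only:)
    then have "?c *\<^sub>R (bessel_pow l ?t h x - (h x + (\<Sum>j=1..m. (?t ^ j / fact j) *\<^sub>R bessel_log l j h x)))
        - \<sigma> ^ (m + 1) *\<^sub>R bessel_log l (m + 1) h x = ?c *\<^sub>R E"
      unfolding sum_from_zeroth_log
      by (simp only: pow[OF x] log[OF x] scaleR_diff_right diff_diff_eq)
    then have "norm (?c *\<^sub>R (bessel_pow l ?t h x - (h x + (\<Sum>j=1..m. (?t ^ j / fact j) *\<^sub>R bessel_log l j h x)))
        - \<sigma> ^ (m + 1) *\<^sub>R bessel_log l (m + 1) h x) = ?c * norm E"
      using s by simp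
    also have "\<dots> \<le> ?c * (C * s ^ Suc (Suc m) * (1 + x) powr (- \<beta>))"
      using C[of ?t x] x s \<sigma>s unfolding E_def by (intro mult_left_mono) auto
    also have "\<dots> = (fact (m + 1) * C * s) * (1 + x) powr (- \<beta>)"
      using s by (simp add: field_simps)
    finally show "norm (?c *\<^sub>R (bessel_pow l ?t h x - (h x + (\<Sum>j=1..m. (?t ^ j / fact j) *\<^sub>R bessel_log l j h x)))
        - \<sigma> ^ (m + 1) *\<^sub>R bessel_log l (m + 1) h x) \<le> (fact (m + 1) * C * s) * (1 + x) powr (- \<beta>)" .
  qed
qed

end

theorem theorem1p3:
  fixes \<theta> l :: real and p :: ennreal and m :: nat and f :: "real \<Rightarrow> complex"
  assumes "0 < \<theta>" "\<theta> \<le> 1"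
    and "f \<in> Cc_pos \<inter> Lip_loc_uni \<theta>"
    and "1 < p" "p \<le> \<infinity>"
    and "- 1 / 2 < l"
  shows
    "tendsto_Lp lborel_pos p
       (\<lambda>s x. (fact (m + 1) / s ^ (m + 1)) *\<^sub>R
          (bessel_pow l s f x - (f x + (\<Sum>j=1..m. (s ^ j / fact j) *\<^sub>R bessel_log l j f x))))
       (\<lambda>x. bessel_log l (m + 1) f x) (at_right 0) \<and>
     tendsto_Lp lborel_pos p
       (\<lambda>s x. (fact (m + 1) / s ^ (m + 1)) *\<^sub>R
          (bessel_neg_pow l s f x
             - (f x + (\<Sum>j=1..m. ((-1) ^ j * s ^ j / fact j) *\<^sub>R bessel_log l j f x))))
       (\<lambda>x. (-1) ^ (m + 1) * bessel_log l (m + 1) f x) (at_right 0)"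
proof -
  \<comment> \<open>The second bound on \<open>e\<close> makes \<open>\<beta> p \<ge> (p + 1) / 2 > 1\<close>.\<close>
  define e where "e = (if p = \<infinity> then \<theta> / 8 else min (\<theta> / 8) ((1 - 1 / enn2real p) / 8))"
  have q: "1 < enn2real p" if "p \<noteq> \<infinity>"
  proof -
    have "enn2real 1 < enn2real p"
      using assms(4) that by (subst enn2real_less_iff) (auto simp: less_top)
    then show ?thesis by simp
  qed
  have e: "0 < e" "4 * e < \<theta>"
    using assms(1) q by (auto simp: e_def min_def)
  obtain a b M L where "bessel_log_setting l \<theta> e a b M L (\<lambda>x. indicator {0<..} x *\<^sub>R f x)"
    using bessel_log_setting_exists[OF assms(1,2,3,6) e] by blast
  then interpret bessel_log_setting l \<theta> e a b M L "\<lambda>x. indicator {0<..} x *\<^sub>R f x" .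
  have pq: "1 < \<beta> * enn2real p" if "p \<noteq> \<infinity>"
  proof -
    define r where "r = enn2real p"
    have r: "1 < r" using q[OF that] by (simp add: r_def)
    have "e \<le> (1 - 1 / r) / 8" 
      using that unfolding e_def r_def by (simp only: if_False min.cobounded2)
    then have "4 * e \<le> (1 - 1 / r) / 2" by simp
    have "1 < (r + 1) / 2" using r by simp
    also have "\<dots> = (1 - (1 - 1 / r) / 2) * r"
      using r by (simp add: field_simps)
    also have "\<dots> \<le> \<beta> * r"
      using r \<open>4 * e \<le> _\<close> by (intro mult_right_mono) (auto simp: \<beta>_def)
    finally show ?thesis by (simp only: r_def)
  qed
  have f: "f y = indicator {0<..} y *\<^sub>R f y" if "0 < y" for y :: real
    using that by simp
  from tendsto_Lp_remainder[OF assms(4) pq f, of 1 m] tendsto_Lp_remainder[OF assms(4) pq f, of "- 1" m]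
  show ?thesis
    by (simp add: bessel_neg_pow_eq power_mult_distrib[symmetric] scaleR_conv_of_real)
qed

end
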